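(* Let $v>0$, $\sigma>0$ and, for a constant $N$, let $\mu_1,\mu_2$ be the proportional navigation coefficients defined in the context. Then for every $N\ge2$ and every $(r,\theta)\in\mathbb{R}_+\times\mathbb{R}$ there exists a unique (in the sense of pathwise uniqueness) strong solution up to $\tau$, i.e. on $[0,\tau]$ where $\tau=\inf\{t\ge 0: R_t=0\}$, in the sense of the definition given in the context, to the system $$dR_t=\mu_1(R_t,\Theta_t)\,dt,\quad R_0=r,\qquad d\Theta_t=\mu_2(R_t,\Theta_t)\,dt+\sigma\,dB_t,\quad \Theta_0=\theta.$$
   Context: $(\Omega,\mathcal{F},\{\mathcal{F}_t\}_{t\ge0},\mathbb{P})$ is a filtered probability space supporting a standard Brownian motion $(B_t)_{t\ge0}$; $\mathbb{R}_+=\,]0,\infty[$. Proportional navigation coefficients. With $v>0$ and the navigation constant $N\ge2$, for $r>0$, $\mu_1(r,\theta)=\mu_1(\theta)$ (it does not depend on $r$) and - for $\theta\in[-\frac{\pi}{2},\frac{\pi}{2}]$: $\mu_1=-v\cos\theta$, $\mu_2=-(N-1)\frac{v\sin\theta}{r}$; - for $\theta\in\,]\frac{\pi}{2},\frac{3\pi}{2}[$: $\mu_1=v\cos\theta$, $\mu_2=(N-1)\frac{v\sin\theta}{r}$; and $\mu_1,\mu_2$ are extended to all $\theta\in\mathbb{R}$ by $2\pi$-periodicity in $\theta$. Definition (strong solution up to $\tau$). Let $\tau=\inf\{t\ge0:R_t=0\}$. An $(\mathcal{F}_t)$-adapted process $(R_t,\Theta_t)_{t\in[0,\tau]}$ is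 a strong solution up to $\tau$ if: 1. for every $t<\tau$ one has $R_t>0$, and $(R_s,\Theta_s)_{s\in[0,t]}$ is a strong solution of the system on $[0,t]$ in the usual sense (with respect to the given Brownian motion $B$ and the given initial condition, adapted to the augmented filtration generated by $B$); in particular it is continuous, $\int_0^t(|\mu_1(R_s,\Theta_s)|+|\mu_2(R_s,\Theta_s)|)\,ds<\infty$ for every $t<\tau$, and $$R_t=r+\int_0^t\mu_1(R_s,\Theta_s)\,ds,\qquad \Theta_t=\theta+\int_0^t\mu_2(R_s,\Theta_s)\,ds+\sigma B_t;$$ 2. the limit $(R_\tau,\Theta_\tau):=\lim_{t\nearrow\tau}(R_t,\Theta_t)$ exists almost surely. Pathwise uniqueness up to $\tau$: if $(R,\Theta)$ and $(\widetilde R,\widetilde\Theta)$ are two strong solutions up to their respective hitting times $\tau,\widetilde\tau$ of the origin, driven by the same $B$ with the same initial condition, then almost surely $\tau=\widetilde\tau$ and $(R_t,\Theta_t)=(\widetilde R_t,\widetilde\Theta_t)$ for all $t\in[0,\tau]$. *)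

theory Defs
  imports "HOL-Probability.Probability"
begin

section \<open>Brownian motion on a filtered probability space\<close>

text \<open>Time is a real number \<open>t \<ge> 0\<close>; nothing is required at negative indices.\<close>

locale filtered_prob_space = prob_space M for M :: "'a measure" +
  fixes F :: "real \<Rightarrow> 'a measure"
  assumes subalgebra_F: "0 \<le> t \<Longrightarrow> subalgebra M (F t)"
    and F_mono: "0 \<le> s \<Longrightarrow> s \<le> t \<Longrightarrow> sets (F s) \<subseteq> sets (F t)"

locale standard_brownian_motion = filtered_prob_space M F
  for M :: "'a measure" and F :: "real \<Rightarrow> 'a measure" +
  fixes B :: "real \<Rightarrow> 'a \<Rightarrow> real"
  assumes adapted: "0 \<le> t \<Longrightarrow> B t \<in> borel_measurable (F t)"
    and start: "AE \<omega> in M. B 0 \<omega> = 0"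
    and continuous_paths: "AE \<omega> in M. continuous_on {0..} (\<lambda>t. B t \<omega>)"
    and normal_increments: "0 \<le> s \<Longrightarrow> s < t \<Longrightarrow>
      distributed M lborel (\<lambda>\<omega>. B t \<omega> - B s \<omega>) (normal_density 0 (sqrt (t - s)))"
    and indep_increments: "0 \<le> s \<Longrightarrow> s < t \<Longrightarrow>
      indep_set (sets (F s)) (sets (vimage_algebra (space M) (\<lambda>\<omega>. B t \<omega> - B s \<omega>) borel))"

text \<open>The filtration generated by \<open>B\<close>, augmented by all subsets of \<open>M\<close>-null sets. As \<open>M\<close> need not be
  complete, its members need not be measurable for \<open>M\<close> itself.\<close>

definition augmented_filtration :: "'a measure \<Rightarrow> (real \<Rightarrow> 'a \<Rightarrow> real) \<Rightarrow> real \<Rightarrow> 'a measure" where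
  "augmented_filtration M B t = sigma (space M)
     ({B s -` A \<inter> space M | s A. 0 \<le> s \<and> s \<le> t \<and> A \<in> sets borel} \<union>
      {A. \<exists>C\<in>null_sets M. A \<subseteq> C})"

section \<open>Strong solutions up to the hitting time of the origin\<close>

definition hitting_time :: "(real \<Rightarrow> 'a \<Rightarrow> real) \<Rightarrow> 'a \<Rightarrow> ereal" where
  "hitting_time R \<omega> = Inf (ereal ` {t. 0 \<le> t \<and> R t \<omega> = 0})"

text \<open>A process on the random interval \<open>[0, \<tau>]\<close> is represented by a total function of time whose
  values after \<open>\<tau>\<close> are irrelevant. Adaptedness therefore only concerns \<open>X t\<close> on the event
  \<open>t \<le> \<tau>\<close>.\<close>

definition adapted_until ::
  "'a measure \<Rightarrow> (real \<Rightarrow> 'a measure) \<Rightarrow> ('a \<Rightarrow> ereal) \<Rightarrow> (real \<Rightarrow> 'a \<Rightarrow> real) \<Rightarrow> bool" where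
  "adapted_until M G \<tau> X \<longleftrightarrow>
     (\<forall>t\<ge>0. \<forall>A\<in>sets borel. {\<omega>\<in>space M. ereal t \<le> \<tau> \<omega> \<and> X t \<omega> \<in> A} \<in> sets (G t))"

definition integral_equations ::
  "(real \<Rightarrow> 'a \<Rightarrow> real) \<Rightarrow> real \<Rightarrow> (real \<Rightarrow> real \<Rightarrow> real) \<Rightarrow> (real \<Rightarrow> real \<Rightarrow> real) \<Rightarrow> real \<Rightarrow> real \<Rightarrow>
   (real \<Rightarrow> 'a \<Rightarrow> real) \<Rightarrow> (real \<Rightarrow> 'a \<Rightarrow> real) \<Rightarrow> real \<Rightarrow> 'a \<Rightarrow> bool" where
  "integral_equations B \<sigma> \<mu>1 \<mu>2 r \<theta> R \<Theta> t \<omega> \<longleftrightarrow>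
     set_integrable lborel {0..t} (\<lambda>s. \<bar>\<mu>1 (R s \<omega>) (\<Theta> s \<omega>)\<bar> + \<bar>\<mu>2 (R s \<omega>) (\<Theta> s \<omega>)\<bar>) \<and>
     R t \<omega> = r + (LBINT s:{0..t}. \<mu>1 (R s \<omega>) (\<Theta> s \<omega>)) \<and>
     \<Theta> t \<omega> = \<theta> + (LBINT s:{0..t}. \<mu>2 (R s \<omega>) (\<Theta> s \<omega>)) + \<sigma> * B t \<omega>"

text \<open>The clause \<open>R T \<omega> = 0\<close> says that \<open>\<tau>\<close> is the hitting time of the process living on
  \<open>[0, \<tau>]\<close>: without it the infimum could be approached solely through zeros at times after \<open>\<tau>\<close>,
  where the values of \<open>R\<close> carry no meaning. The initial condition is listed separately because the
  integral equations are only imposed for \<open>t < \<tau>\<close>.\<close>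

definition strong_solution_up_to_hitting ::
  "'a measure \<Rightarrow> (real \<Rightarrow> 'a measure) \<Rightarrow> (real \<Rightarrow> 'a \<Rightarrow> real) \<Rightarrow> real \<Rightarrow>
   (real \<Rightarrow> real \<Rightarrow> real) \<Rightarrow> (real \<Rightarrow> real \<Rightarrow> real) \<Rightarrow> real \<Rightarrow> real \<Rightarrow>
   (real \<Rightarrow> 'a \<Rightarrow> real) \<Rightarrow> (real \<Rightarrow> 'a \<Rightarrow> real) \<Rightarrow> bool" where
  "strong_solution_up_to_hitting M F B \<sigma> \<mu>1 \<mu>2 r \<theta> R \<Theta> \<longleftrightarrow>
     (\<forall>X\<in>{R, \<Theta>}. adapted_until M F (hitting_time R) X \<and>
        adapted_until M (augmented_filtration M B) (hitting_time R) X) \<and>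
     (AE \<omega> in M. R 0 \<omega> = r \<and> \<Theta> 0 \<omega> = \<theta> \<and>
        (\<forall>t\<ge>0. ereal t < hitting_time R \<omega> \<longrightarrow>
           R t \<omega> > 0 \<and>
           continuous_on {0..t} (\<lambda>s. (R s \<omega>, \<Theta> s \<omega>)) \<and>
           integral_equations B \<sigma> \<mu>1 \<mu>2 r \<theta> R \<Theta> t \<omega>)) \<and>
     (AE \<omega> in M.
        (\<forall>T. hitting_time R \<omega> = ereal T \<longrightarrow> R T \<omega> = 0 \<and>
           ((\<lambda>t. (R t \<omega>, \<Theta> t \<omega>)) \<longlongrightarrow> (R T \<omega>, \<Theta> T \<omega>)) (at_left T)) \<and>
        (hitting_time R \<omega> = \<infinity> \<longrightarrow>
           (\<exists>l. ((\<lambda>t. (R t \<omega>, \<Theta> t \<omega>)) \<longlongrightarrow> l) at_top)))"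

definition pathwise_unique_up_to_hitting ::
  "'a measure \<Rightarrow> (real \<Rightarrow> 'a measure) \<Rightarrow> (real \<Rightarrow> 'a \<Rightarrow> real) \<Rightarrow> real \<Rightarrow>
   (real \<Rightarrow> real \<Rightarrow> real) \<Rightarrow> (real \<Rightarrow> real \<Rightarrow> real) \<Rightarrow> real \<Rightarrow> real \<Rightarrow> bool" where
  "pathwise_unique_up_to_hitting M F B \<sigma> \<mu>1 \<mu>2 r \<theta> \<longleftrightarrow>
     (\<forall>R \<Theta> R' \<Theta>'.
        strong_solution_up_to_hitting M F B \<sigma> \<mu>1 \<mu>2 r \<theta> R \<Theta> \<longrightarrow>
        strong_solution_up_to_hitting M F B \<sigma> \<mu>1 \<mu>2 r \<theta> R' \<Theta>' \<longrightarrow>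
        (AE \<omega> in M. hitting_time R \<omega> = hitting_time R' \<omega> \<and>
           (\<forall>t\<ge>0. ereal t \<le> hitting_time R \<omega> \<longrightarrow> (R t \<omega>, \<Theta> t \<omega>) = (R' t \<omega>, \<Theta>' t \<omega>))))"

section \<open>Proportional navigation coefficients\<close>

text \<open>The representative of \<open>\<theta>\<close> modulo \<open>2 * pi\<close> in \<open>[-pi/2, 3*pi/2)\<close>, for the periodic extension.\<close>

definition reduce_angle :: "real \<Rightarrow> real" where
  "reduce_angle \<theta> = \<theta> - 2 * pi * of_int \<lfloor>(\<theta> + pi / 2) / (2 * pi)\<rfloor>"

definition pn_mu1 :: "real \<Rightarrow> real \<Rightarrow> real \<Rightarrow> real" where
  "pn_mu1 v r \<theta> = (let \<phi> = reduce_angle \<theta> in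
     if \<phi> \<le> pi / 2 then - v * cos \<phi> else v * cos \<phi>)"

definition pn_mu2 :: "real \<Rightarrow> real \<Rightarrow> real \<Rightarrow> real \<Rightarrow> real" where
  "pn_mu2 v N r \<theta> = (let \<phi> = reduce_angle \<theta> in
     if \<phi> \<le> pi / 2 then - (N - 1) * (v * sin \<phi> / r) else (N - 1) * (v * sin \<phi> / r))"

lemma reduce_angle_id: "reduce_angle \<theta> = \<theta>" if "\<theta> \<in> {-pi/2..<3*pi/2}"
proof -
  have "\<lfloor>(\<theta> + pi / 2) / (2 * pi)\<rfloor> = 0"
    using that by (simp add: floor_eq_iff field_simps)
  then show ?thesis by (simp add: reduce_angle_def)
qed

lemma reduce_angle_periodic: "reduce_angle (\<theta> + 2 * pi) = reduce_angle \<theta>"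
proof -
  have "(\<theta> + 2 * pi + pi / 2) / (2 * pi) = (\<theta> + pi / 2) / (2 * pi) + 1"
    by (simp add: field_simps)
  then show ?thesis by (simp add: reduce_angle_def algebra_simps)
qed

lemma pn_mu_periodic:
  "pn_mu1 v r (\<theta> + 2 * pi) = pn_mu1 v r \<theta>" "pn_mu2 v N r (\<theta> + 2 * pi) = pn_mu2 v N r \<theta>"
  by (simp_all add: pn_mu1_def pn_mu2_def reduce_angle_periodic)

lemma pn_mu_front:
  assumes "\<theta> \<in> {-pi/2..pi/2}"
  shows "pn_mu1 v r \<theta> = - v * cos \<theta>" "pn_mu2 v N r \<theta> = - (N - 1) * (v * sin \<theta> / r)"
proof -
  have "\<theta> \<in> {-pi/2..<3*pi/2}" using assms by (simp, use pi_gt_zero in linarith)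
  then show "pn_mu1 v r \<theta> = - v * cos \<theta>" "pn_mu2 v N r \<theta> = - (N - 1) * (v * sin \<theta> / r)"
    using assms by (simp_all add: pn_mu1_def pn_mu2_def reduce_angle_id)
qed

lemma pn_mu_back:
  assumes "\<theta> \<in> {pi/2<..<3*pi/2}"
  shows "pn_mu1 v r \<theta> = v * cos \<theta>" "pn_mu2 v N r \<theta> = (N - 1) * (v * sin \<theta> / r)"
proof -
  have "\<theta> \<in> {-pi/2..<3*pi/2}" using assms pi_gt_zero by auto
  then show "pn_mu1 v r \<theta> = v * cos \<theta>" "pn_mu2 v N r \<theta> = (N - 1) * (v * sin \<theta> / r)"
    using assms by (simp_all add: pn_mu1_def pn_mu2_def reduce_angle_id)
qed

end

theory Submission
  imports Defs
begin

text \<open>Write \<open>S\<close> for the sign of \<open>cos \<theta>\<close>. Then \<open>\<mu>1 = - v * \<bar>cos \<theta>\<bar>\<close> and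
  \<open>\<mu>2 = - (N - 1) * v * sin \<theta> * S / r\<close>, so that for \<open>r\<close> bounded away from \<open>0\<close> the coefficients are
  Lipschitz except for a jump of \<open>\<mu>2\<close> across the walls \<open>cos \<theta> = 0\<close>. For a single path of the noise,
  every solution stays close to the Euler scheme as long as the scheme is not near a wall, and the error
  is dominated by a gap sequence computed from the scheme alone, which grows at the rate of the jump when
  the scheme is within the current gap of a wall and exponentially otherwise. A smoothed version of
  \<open>exp (- \<alpha> * \<bar>cos \<theta>\<bar>)\<close> weighted by the gap has bounded growth in expectation, because the Ito term of
  the kink on the wall outweighs the jump. Hence, on suitable levels with cut-off \<open>1 / (k + 1)\<close> for the
  radius, the gap is almost surely at most \<open>2 ^ - k\<close> eventually (Borel--Cantelli).

  On this almost sure event everything is deterministic: the schemes form a Cauchy sequence as long as the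
  limiting radius is positive, the time spent on walls is null so the limit solves the equations, and every
  solution agrees with that limit. Towards a finite hitting time, the drift of order \<open>1 / (T - t)\<close> either
  traps the angle at the centre of a well between two walls or the angle ends on a wall, so it converges.
  The hitting time is almost surely finite since the noise does not let the angle stay near the walls, and
  away from them the radius decreases at a positive speed.\<close>

section \<open>The coefficients\<close>

text \<open>The obstacle is the sign of the jump. On both sides of a wall the angular drift points
  away from it, so no one-sided Lipschitz estimate is available; with \<sigma> = 0 and a start on a
  wall, leaving to either side would give two solutions. Uniqueness has to come from the noise, and
  the noise acts on the angle alone. The gap sequence reduces the question to one explicit adapted
  process instead of a pair of unknown solutions. Its growth by the jump happens only while the
  scheme is in a strip of width d around the walls, d being the current gap. A diffusing angle
  spends an expected time of order d there, so the expected growth is again linear in d and a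
  Gronwall argument closes. The weight encodes this occupation time estimate in a one-step
  inequality, whose proof takes a Taylor expansion and Gaussian moments up to order four. The gap
  starts at a positive \<eta>, which bounds the smoothing scale from below. Taylor errors grow like
  a negative power of \<eta>, but they carry a factor \<open>sqrt h\<close>, and the mesh h is
  chosen after \<eta>.\<close>

definition wall_sgn :: "real \<Rightarrow> real" where
  "wall_sgn x = (if 0 \<le> cos x then 1 else -1)"

lemma reduce_angle_eqs:
  "sin (reduce_angle x) = sin x" "cos (reduce_angle x) = cos x"
  "reduce_angle x \<in> {- (pi/2)..<3 * pi / 2}"
proof -
  define n where "n = \<lfloor>(x + pi / 2) / (2 * pi)\<rfloor>"
  have e: "reduce_angle x = x - 2 * pi * of_int n" by (simp add: reduce_angle_def n_def)
  show "sin (reduce_angle x) = sin x" "cos (reduce_angle x) = cos x"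
    unfolding e by (simp_all add: sin_diff cos_diff sin_int_2pin cos_int_2pin)
  have "of_int n \<le> (x + pi / 2) / (2 * pi)" "(x + pi / 2) / (2 * pi) < of_int n + 1"
    unfolding n_def by (rule of_int_floor_le, linarith)
  then show "reduce_angle x \<in> {- (pi/2)..<3 * pi / 2}"
    unfolding e by (auto simp: field_simps)
qed

text \<open>On the reduced range \<open>cos\<close> is non-negative exactly up to pi / 2, and the
  left endpoint - pi / 2 is a zero of \<open>cos\<close> too. Hence every wall takes the front
  branch, which is why \<open>wall_sgn\<close> is 1 where \<open>cos\<close> vanishes.\<close>

lemma reduce_angle_le_iff: "reduce_angle x \<le> pi / 2 \<longleftrightarrow> 0 \<le> cos x"
proof -
  let ?p = "reduce_angle x"
  note r = reduce_angle_eqs[of x]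
  show ?thesis
  proof
    assume "?p \<le> pi / 2"
    then show "0 \<le> cos x" using r(3) cos_ge_zero[of ?p] r(2) by auto
  next
    assume c: "0 \<le> cos x"
    show "?p \<le> pi / 2"
    proof (rule ccontr)
      assume "\<not> ?p \<le> pi / 2"
      then have "0 < cos (?p - pi)" using r(3) by (intro cos_gt_zero_pi) auto
      then show False using r(2) c by (simp add: cos_diff)
    qed
  qed
qed

lemma pn_mu1_eq: "pn_mu1 v \<rho> x = - v * \<bar>cos x\<bar>"
  unfolding pn_mu1_def Let_def reduce_angle_le_iff reduce_angle_eqs by auto

lemma pn_mu2_eq: "pn_mu2 v N \<rho> x = - (N - 1) * v * sin x * wall_sgn x / \<rho>"
  unfolding pn_mu2_def Let_def reduce_angle_le_iff reduce_angle_eqs wall_sgn_def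
  by (auto simp: minus_divide_left algebra_simps)

lemma abs_cos_diff_le: "\<bar>cos x - cos y\<bar> \<le> \<bar>x - y\<bar>" for x y :: real
proof -
  have "\<bar>cos x - cos y\<bar> = 2 * (\<bar>sin ((x + y) / 2)\<bar> * \<bar>sin ((y - x) / 2)\<bar>)"
    by (simp add: cos_diff_cos abs_mult)
  also have "\<dots> \<le> 2 * (1 * \<bar>(y - x) / 2\<bar>)"
    by (intro mult_left_mono mult_mono abs_sin_le_one abs_sin_x_le_abs_x) auto
  also have "\<dots> = \<bar>x - y\<bar>" by simp
  finally show ?thesis .
qed

lemma abs_sin_diff_le: "\<bar>sin x - sin y\<bar> \<le> \<bar>x - y\<bar>" for x y :: real
proof -
  have "\<bar>sin x - sin y\<bar> = 2 * (\<bar>sin ((x - y) / 2)\<bar> * \<bar>cos ((x + y) / 2)\<bar>)"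
    by (simp add: sin_diff_sin abs_mult)
  also have "\<dots> \<le> 2 * (\<bar>(x - y) / 2\<bar> * 1)"
    by (intro mult_left_mono mult_mono abs_cos_le_one abs_sin_x_le_abs_x) auto
  also have "\<dots> = \<bar>x - y\<bar>" by simp
  finally show ?thesis .
qed

lemma abs_wall_sgn [simp]: "\<bar>wall_sgn x\<bar> = 1"
  by (simp add: wall_sgn_def)

lemma pn_mu1_borel [measurable]: "(\<lambda>x. pn_mu1 v (f x) (g x)) \<in> borel_measurable M"
  if [measurable]: "g \<in> borel_measurable M" for f g :: "'b \<Rightarrow> real"
  unfolding pn_mu1_eq by measurable

lemma pn_mu2_borel [measurable]: "(\<lambda>x. pn_mu2 v N (f x) (g x)) \<in> borel_measurable M"
  if [measurable]: "f \<in> borel_measurable M" "g \<in> borel_measurable M" for f g :: "'b \<Rightarrow> real"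
  unfolding pn_mu2_eq wall_sgn_def by measurable

lemma abs_pn_mu1_le: "\<bar>pn_mu1 v \<rho> x\<bar> \<le> v" if "0 \<le> v"
proof -
  have "v * \<bar>cos x\<bar> \<le> v * 1" by (intro mult_left_mono) (use that in auto)
  then show ?thesis using that by (simp add: pn_mu1_eq abs_mult)
qed

lemma pn_mu1_diff_le: "\<bar>pn_mu1 v \<rho> x - pn_mu1 v \<rho>' y\<bar> \<le> v * \<bar>x - y\<bar>" if "0 \<le> v"
proof -
  have "\<bar>pn_mu1 v \<rho> x - pn_mu1 v \<rho>' y\<bar> = \<bar>v * (\<bar>cos y\<bar> - \<bar>cos x\<bar>)\<bar>"
    unfolding pn_mu1_eq by (simp add: algebra_simps)
  also have "\<dots> = v * \<bar>\<bar>cos y\<bar> - \<bar>cos x\<bar>\<bar>" using that by (simp add: abs_mult)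
  also have "\<dots> \<le> v * \<bar>x - y\<bar>"
    using abs_cos_diff_le[of x y] that by (intro mult_left_mono) auto
  finally show ?thesis .
qed

lemma abs_pn_mu2_le: "\<bar>pn_mu2 v N \<rho> x\<bar> \<le> (N - 1) * v / \<epsilon>"
  if "0 \<le> v" "1 \<le> N" "0 < \<epsilon>" "\<epsilon> \<le> \<rho>"
proof -
  have "\<bar>pn_mu2 v N \<rho> x\<bar> = (N - 1) * v * \<bar>sin x\<bar> / \<rho>"
    unfolding pn_mu2_eq using that by (simp add: abs_mult)
  also have "\<dots> \<le> (N - 1) * v * 1 / \<epsilon>"
    using that by (intro frac_le mult_left_mono) auto
  finally show ?thesis by simp
qed

text \<open>If the signs differ, \<open>cos x\<close> and \<open>cos y\<close> lie on different
  sides of 0, and as \<open>cos\<close> is 1-Lipschitz this forces \<bar>cos y\<bar> \<le> \<bar>x -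
  y\<bar>. The jump is thus charged under a condition that sees x only through its distance from y;
  y will be the scheme and x the unknown process.\<close>

lemma pn_mu2_diff_le:
  assumes "0 \<le> v" "1 \<le> N" "0 < \<epsilon>" "\<epsilon> \<le> \<rho>" "\<epsilon> \<le> \<rho>'"
  defines "K \<equiv> (N - 1) * v / \<epsilon>"
  shows "\<bar>pn_mu2 v N \<rho> x - pn_mu2 v N \<rho>' y\<bar>
    \<le> (if \<bar>cos y\<bar> \<le> \<bar>x - y\<bar> then 2 * K else 0) + K * \<bar>x - y\<bar> + K / \<epsilon> * \<bar>\<rho> - \<rho>'\<bar>"
proof -
  have K: "0 \<le> K" unfolding K_def using assms by simp
  have rest: "0 \<le> K * \<bar>x - y\<bar> + K / \<epsilon> * \<bar>\<rho> - \<rho>'\<bar>"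
    using K assms by simp
  show ?thesis
  proof (cases "wall_sgn x = wall_sgn y")
    case False
    then have "\<bar>cos y\<bar> \<le> \<bar>x - y\<bar>"
      using abs_cos_diff_le[of x y] by (auto simp: wall_sgn_def split: if_splits)
    moreover have "\<bar>pn_mu2 v N \<rho> x - pn_mu2 v N \<rho>' y\<bar> \<le> 2 * K"
      using abs_pn_mu2_le[OF assms(1-4), of x] abs_pn_mu2_le[OF assms(1-3,5), of y]
      unfolding K_def by linarith
    ultimately show ?thesis using rest by simp
  next
    case True
    have pos: "0 < \<rho>" "0 < \<rho>'" using assms by auto
    have "pn_mu2 v N \<rho> x - pn_mu2 v N \<rho>' y
      = - (N - 1) * v * wall_sgn y * ((sin x - sin y) / \<rho> + sin y * (\<rho>' - \<rho>) / (\<rho> * \<rho>'))"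
      unfolding pn_mu2_eq True using pos by (simp add: field_simps)
    then have "\<bar>pn_mu2 v N \<rho> x - pn_mu2 v N \<rho>' y\<bar>
      = (N - 1) * v * \<bar>(sin x - sin y) / \<rho> + sin y * (\<rho>' - \<rho>) / (\<rho> * \<rho>')\<bar>"
      using assms by (simp add: abs_mult)
    also have "\<dots> \<le> (N - 1) * v * (\<bar>sin x - sin y\<bar> / \<rho> + \<bar>sin y\<bar> * \<bar>\<rho> - \<rho>'\<bar> / (\<rho> * \<rho>'))"
      using assms pos by (intro mult_left_mono order_trans[OF abs_triangle_ineq])
        (auto simp: abs_mult abs_minus_commute)
    also have "\<dots> \<le> (N - 1) * v * (\<bar>x - y\<bar> / \<epsilon> + 1 * \<bar>\<rho> - \<rho>'\<bar> / (\<epsilon> * \<epsilon>))"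
      using assms pos by (intro mult_left_mono add_mono frac_le mult_right_mono mult_mono abs_sin_diff_le) auto
    also have "\<dots> = K * \<bar>x - y\<bar> + K / \<epsilon> * \<bar>\<rho> - \<rho>'\<bar>"
      unfolding K_def by (simp add: field_simps)
    finally show ?thesis using K by simp
  qed
qed

section \<open>A smoothed distance to the walls\<close>

text \<open>The scale d will be the current gap, so that the kink of \<bar>cos\<bar> is spread over
  just the strip in which the jump is charged.\<close>

definition smooth_cos :: "real \<Rightarrow> real \<Rightarrow> real" where
  "smooth_cos d x = sqrt ((cos x)\<^sup>2 + d\<^sup>2)"

definition smooth_cos1 :: "real \<Rightarrow> real \<Rightarrow> real" where
  "smooth_cos1 d x = - cos x * sin x / smooth_cos d x"

text \<open>Solved from the derivative of \<open>smooth_cos * smooth_cos1 = - cos * sin\<close>;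
  differentiating that identity once more gives \<open>smooth_cos3\<close>. In this form each
  derivative is a bounded numerator over \<open>smooth_cos\<close>, which is at least d.\<close>

definition smooth_cos2 :: "real \<Rightarrow> real \<Rightarrow> real" where
  "smooth_cos2 d x = ((sin x)\<^sup>2 - (cos x)\<^sup>2 - (smooth_cos1 d x)\<^sup>2) / smooth_cos d x"

definition smooth_cos3 :: "real \<Rightarrow> real \<Rightarrow> real" where
  "smooth_cos3 d x = (4 * sin x * cos x - 3 * smooth_cos1 d x * smooth_cos2 d x) / smooth_cos d x"

context
  fixes d :: real
  assumes d: "0 < d"
begin

lemma smooth_cos_ge: "d \<le> smooth_cos d x" "\<bar>cos x\<bar> \<le> smooth_cos d x"
  unfolding smooth_cos_def using d by (auto intro!: real_le_rsqrt simp: power2_abs)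

lemma smooth_cos_pos: "0 < smooth_cos d x"
  using smooth_cos_ge(1)[of x] d by linarith

lemma smooth_cos_sq: "(smooth_cos d x)\<^sup>2 = (cos x)\<^sup>2 + d\<^sup>2"
  unfolding smooth_cos_def by simp

lemma DERIV_smooth_cos: "(smooth_cos d has_real_derivative smooth_cos1 d x) (at x)"
proof -
  have "0 < (cos x)\<^sup>2 + d\<^sup>2" using d by (simp add: add_nonneg_pos)
  then have "((\<lambda>x. sqrt ((cos x)\<^sup>2 + d\<^sup>2)) has_real_derivative smooth_cos1 d x) (at x)"
    unfolding smooth_cos1_def smooth_cos_def
    by (auto intro!: derivative_eq_intros simp: field_simps)
  then show ?thesis unfolding smooth_cos_def by (simp add: fun_eq_iff[symmetric])
qed

lemma DERIV_smooth_cos1: "(smooth_cos1 d has_real_derivative smooth_cos2 d x) (at x)"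
proof -
  note [derivative_intros] = DERIV_smooth_cos
  have "((\<lambda>x. - cos x * sin x / smooth_cos d x) has_real_derivative smooth_cos2 d x) (at x)"
    using smooth_cos_pos[of x]
    by (auto intro!: derivative_eq_intros
      simp: smooth_cos2_def smooth_cos1_def field_simps power2_eq_square)
  then show ?thesis by (simp add: smooth_cos1_def[abs_def])
qed

lemma DERIV_smooth_cos2: "(smooth_cos2 d has_real_derivative smooth_cos3 d x) (at x)"
proof -
  note [derivative_intros] = DERIV_smooth_cos DERIV_smooth_cos1
  have "((\<lambda>x. ((sin x)\<^sup>2 - (cos x)\<^sup>2 - (smooth_cos1 d x)\<^sup>2) / smooth_cos d x)
     has_real_derivative smooth_cos3 d x) (at x)"
    using smooth_cos_pos[of x]
    by (auto intro!: derivative_eq_intros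
      simp: smooth_cos3_def smooth_cos2_def field_simps power2_eq_square)
  then show ?thesis by (simp add: smooth_cos2_def[abs_def])
qed

lemma abs_smooth_cos1_le: "\<bar>smooth_cos1 d x\<bar> \<le> 1"
proof -
  have "\<bar>cos x\<bar> * \<bar>sin x\<bar> \<le> smooth_cos d x * 1"
    by (intro mult_mono smooth_cos_ge) (use smooth_cos_pos[of x] in auto)
  then show ?thesis unfolding smooth_cos1_def
    using smooth_cos_pos[of x] by (simp add: abs_mult)
qed

text \<open>The first summand is the smeared delta of the kink: it is of order 1 / d on a strip of
  width d around a wall, with mass about 2, the jump of the slope of \<bar>cos\<bar>. The second
  summand is between 0 and 1, so it costs only a bounded amount.\<close>

lemma smooth_cos2_eq:
  "smooth_cos2 d x = (sin x)\<^sup>2 * d\<^sup>2 / (smooth_cos d x)^3 - (cos x)\<^sup>2 / smooth_cos d x"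
proof -
  let ?s = "smooth_cos d x"
  have e: "(smooth_cos1 d x)\<^sup>2 * ?s\<^sup>2 = (cos x)\<^sup>2 * (sin x)\<^sup>2"
    unfolding smooth_cos1_def using smooth_cos_pos[of x] by (simp add: power_divide power_mult_distrib)
  have "smooth_cos2 d x * ?s^3 = ((sin x)\<^sup>2 - (cos x)\<^sup>2) * ?s\<^sup>2 - (smooth_cos1 d x)\<^sup>2 * ?s\<^sup>2"
  proof -
    have "smooth_cos2 d x * ?s = (sin x)\<^sup>2 - (cos x)\<^sup>2 - (smooth_cos1 d x)\<^sup>2"
      unfolding smooth_cos2_def using smooth_cos_pos[of x] by simp
    then have "smooth_cos2 d x * ?s * ?s\<^sup>2 = ((sin x)\<^sup>2 - (cos x)\<^sup>2 - (smooth_cos1 d x)\<^sup>2) * ?s\<^sup>2"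
      by simp
    then show ?thesis by (simp add: power3_eq_cube power2_eq_square algebra_simps)
  qed
  also have "\<dots> = (sin x)\<^sup>2 * d\<^sup>2 - (cos x)\<^sup>2 * ?s\<^sup>2"
    unfolding e unfolding smooth_cos_sq by (simp add: algebra_simps)
  finally show ?thesis using smooth_cos_pos[of x]
    by (simp add: field_simps power3_eq_cube power2_eq_square)
qed

lemma cos_sq_div_smooth_cos_le: "(cos x)\<^sup>2 / smooth_cos d x \<le> 1"
proof -
  have "(cos x)\<^sup>2 = \<bar>cos x\<bar> * \<bar>cos x\<bar>" by (simp add: power2_eq_square)
  also have "\<dots> \<le> 1 * smooth_cos d x"
    by (intro mult_mono smooth_cos_ge) auto
  finally show ?thesis using smooth_cos_pos[of x] by simp
qed

lemma abs_smooth_cos2_le: "\<bar>smooth_cos2 d x\<bar> \<le> 3 / d"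
proof -
  have a: "0 \<le> (sin x)\<^sup>2" "(sin x)\<^sup>2 \<le> 1" "0 \<le> (cos x)\<^sup>2" "(cos x)\<^sup>2 \<le> 1" "(smooth_cos1 d x)\<^sup>2 \<le> 1"
    using abs_smooth_cos1_le[of x] by (auto simp: abs_square_le_1)
  then have "\<bar>(sin x)\<^sup>2 - (cos x)\<^sup>2 - (smooth_cos1 d x)\<^sup>2\<bar> \<le> 3"
    using zero_le_power2[of "smooth_cos1 d x"] by linarith
  then show ?thesis unfolding smooth_cos2_def abs_divide
    using smooth_cos_ge(1)[of x] d by (intro frac_le) auto
qed

lemma abs_smooth_cos3_le: "\<bar>smooth_cos3 d x\<bar> \<le> (4 + 9 / d) / d"
proof -
  have "\<bar>4 * sin x * cos x\<bar> \<le> 4"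
    by (simp add: abs_mult mult_le_one)
  moreover have "\<bar>3 * smooth_cos1 d x * smooth_cos2 d x\<bar> \<le> 3 * 1 * (3 / d)"
    unfolding abs_mult using abs_smooth_cos1_le[of x] abs_smooth_cos2_le[of x] d
    by (intro mult_mono) auto
  ultimately have "\<bar>4 * sin x * cos x - 3 * smooth_cos1 d x * smooth_cos2 d x\<bar> \<le> 4 + 9 / d"
    by simp
  then show ?thesis unfolding smooth_cos3_def abs_divide
    using smooth_cos_ge(1)[of x] d by (intro frac_le) auto
qed

end

text \<open>The weight is largest at the walls. Its exponential form makes the first derivative at
  most \<alpha> times the weight itself, so the angular drift contributes a multiple of the weighted
  gap, while \<alpha> is free to make the kink term as strong as needed.\<close>

definition gap_weight :: "real \<Rightarrow> real \<Rightarrow> real \<Rightarrow> real" where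
  "gap_weight \<alpha> d x = exp (- \<alpha> * smooth_cos d x)"

definition gap_weight1 :: "real \<Rightarrow> real \<Rightarrow> real \<Rightarrow> real" where
  "gap_weight1 \<alpha> d x = gap_weight \<alpha> d x * (- \<alpha> * smooth_cos1 d x)"

definition gap_weight2 :: "real \<Rightarrow> real \<Rightarrow> real \<Rightarrow> real" where
  "gap_weight2 \<alpha> d x = gap_weight \<alpha> d x * (\<alpha>\<^sup>2 * (smooth_cos1 d x)\<^sup>2 - \<alpha> * smooth_cos2 d x)"

definition gap_weight3 :: "real \<Rightarrow> real \<Rightarrow> real \<Rightarrow> real" where
  "gap_weight3 \<alpha> d x = gap_weight \<alpha> d x *
     (- (\<alpha>^3) * (smooth_cos1 d x)^3 + 3 * \<alpha>\<^sup>2 * smooth_cos1 d x * smooth_cos2 d x - \<alpha> * smooth_cos3 d x)"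

context
  fixes d \<alpha> :: real
  assumes d: "0 < d" and \<alpha>_nonneg: "0 \<le> \<alpha>"
begin

lemma DERIV_gap_weight: "(gap_weight \<alpha> d has_real_derivative gap_weight1 \<alpha> d x) (at x)"
  unfolding gap_weight_def[abs_def] gap_weight1_def
  by (auto intro!: derivative_eq_intros DERIV_smooth_cos[OF d] simp: gap_weight_def)

lemma DERIV_gap_weight1: "(gap_weight1 \<alpha> d has_real_derivative gap_weight2 \<alpha> d x) (at x)"
  unfolding gap_weight1_def[abs_def] gap_weight2_def
  by (auto intro!: derivative_eq_intros DERIV_gap_weight DERIV_smooth_cos1[OF d]
      simp: gap_weight1_def algebra_simps power2_eq_square)

lemma DERIV_gap_weight2: "(gap_weight2 \<alpha> d has_real_derivative gap_weight3 \<alpha> d x) (at x)"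
  unfolding gap_weight2_def[abs_def] gap_weight3_def
  by (auto intro!: derivative_eq_intros DERIV_gap_weight DERIV_smooth_cos1[OF d] DERIV_smooth_cos2[OF d]
      simp: gap_weight1_def algebra_simps power2_eq_square power3_eq_cube)

lemma gap_weight_bounds: "0 < gap_weight \<alpha> d x" "gap_weight \<alpha> d x \<le> 1"
  unfolding gap_weight_def using \<alpha>_nonneg smooth_cos_pos[OF d, of x] by auto

lemma abs_gap_weight1_le: "\<bar>gap_weight1 \<alpha> d x\<bar> \<le> \<alpha> * gap_weight \<alpha> d x"
proof -
  have "\<alpha> * \<bar>smooth_cos1 d x\<bar> \<le> \<alpha> * 1"
    using \<alpha>_nonneg abs_smooth_cos1_le[OF d, of x] by (intro mult_left_mono)
  then have "gap_weight \<alpha> d x * (\<alpha> * \<bar>smooth_cos1 d x\<bar>) \<le> gap_weight \<alpha> d x * (\<alpha> * 1)"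
    by (rule mult_left_mono) (use gap_weight_bounds(1)[of x] in auto)
  moreover have "\<bar>gap_weight1 \<alpha> d x\<bar> = gap_weight \<alpha> d x * (\<alpha> * \<bar>smooth_cos1 d x\<bar>)"
    unfolding gap_weight1_def using \<alpha>_nonneg gap_weight_bounds(1)[of x] by (simp add: abs_mult)
  ultimately show ?thesis by (simp add: mult.commute)
qed

text \<open>The kink of the absolute value, smeared out over the scale \<open>d\<close>, makes \<open>d * gap_weight2\<close>
  negative of order one on the wall region \<open>\<bar>cos x\<bar> \<le> d\<close>; away from it only a multiple of \<open>d\<close> is lost.\<close>

lemma gap_weight_drift:
  assumes "0 \<le> \<kappa>" "0 < \<sigma>" and big: "32 * \<kappa> \<le> \<alpha> * \<sigma>\<^sup>2"
  shows "(if \<bar>cos x\<bar> \<le> d then \<kappa> else 0) * gap_weight \<alpha> d x + \<sigma>\<^sup>2 / 2 * (d * gap_weight2 \<alpha> d x)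
    \<le> (4 * \<kappa> + \<sigma>\<^sup>2 / 2 * (\<alpha>\<^sup>2 + \<alpha>)) * (d * gap_weight \<alpha> d x)"
proof -
  let ?s = "smooth_cos d x" and ?f = "gap_weight \<alpha> d x"
  define q where "q = (sin x)\<^sup>2 * d^3 / ?s^3"
  note s = smooth_cos_pos[OF d, of x] and f = gap_weight_bounds(1)[of x]
  have q0: "0 \<le> q" unfolding q_def using s d by simp
  have "\<alpha>\<^sup>2 * (smooth_cos1 d x)\<^sup>2 \<le> \<alpha>\<^sup>2 * 1"
    using abs_smooth_cos1_le[OF d, of x] by (intro mult_left_mono) (auto simp: abs_square_le_1)
  then have a: "d * (\<alpha>\<^sup>2 * (smooth_cos1 d x)\<^sup>2) \<le> d * \<alpha>\<^sup>2" using d by simp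
  have b: "d * (\<alpha> * smooth_cos2 d x) \<ge> \<alpha> * q - d * \<alpha>"
  proof -
    have "d * (\<alpha> * smooth_cos2 d x) = \<alpha> * q - d * \<alpha> * ((cos x)\<^sup>2 / ?s)"
      unfolding smooth_cos2_eq[OF d] q_def by (simp add: field_simps power3_eq_cube power2_eq_square)
    moreover have "d * \<alpha> * ((cos x)\<^sup>2 / ?s) \<le> d * \<alpha> * 1"
      using d \<alpha>_nonneg cos_sq_div_smooth_cos_le[OF d, of x] by (intro mult_left_mono) auto
    ultimately show ?thesis by simp
  qed
  have "d * gap_weight2 \<alpha> d x = ?f * (d * (\<alpha>\<^sup>2 * (smooth_cos1 d x)\<^sup>2) - d * (\<alpha> * smooth_cos2 d x))"
    unfolding gap_weight2_def by (simp add: algebra_simps)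
  also have "\<dots> \<le> ?f * (d * \<alpha>\<^sup>2 + d * \<alpha> - \<alpha> * q)"
    using a b f by (intro mult_left_mono) auto
  finally have c: "\<sigma>\<^sup>2 / 2 * (d * gap_weight2 \<alpha> d x) \<le> \<sigma>\<^sup>2 / 2 * (?f * (d * \<alpha>\<^sup>2 + d * \<alpha> - \<alpha> * q))"
    by (intro mult_left_mono) auto
  \<comment> \<open>The case d > 1/4 is paid by \<open>4 * \<kappa> * d\<close>. Otherwise, in the
    strip, \<open>smooth_cos\<close> is at most 2 * d and \<open>sin\<close> squared at least 1/2,
    so q \<ge> 1/2 * 1/8 = 1/16; the kink term is then at least \<kappa> precisely when
    \<open>32 * \<kappa> \<le> \<alpha> * \<sigma>\<^sup>2\<close>.\<close>
  have "(if \<bar>cos x\<bar> \<le> d then \<kappa> else 0) \<le> 4 * \<kappa> * d + \<sigma>\<^sup>2 / 2 * (\<alpha> * q)"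
  proof (cases "\<bar>cos x\<bar> \<le> d \<and> d \<le> 1 / 4")
    case False
    have "\<kappa> * 1 \<le> \<kappa> * (4 * d)" if "1 / 4 < d"
      using that assms(1) by (intro mult_left_mono) auto
    moreover have "0 \<le> \<sigma>\<^sup>2 / 2 * (\<alpha> * q)" "0 \<le> 4 * \<kappa> * d" using q0 \<alpha>_nonneg d assms(1) by simp_all
    ultimately have "\<kappa> \<le> 4 * \<kappa> * d + \<sigma>\<^sup>2 / 2 * (\<alpha> * q)" if "1 / 4 < d"
      using that by (simp add: mult_ac)
    then show ?thesis using False \<open>0 \<le> 4 * \<kappa> * d\<close> \<open>0 \<le> \<sigma>\<^sup>2 / 2 * (\<alpha> * q)\<close>
      by (smt (verit))
  next
    case True
    have "?s\<^sup>2 \<le> (2 * d)\<^sup>2"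
    proof -
      have "(cos x)\<^sup>2 \<le> d\<^sup>2" using True d by (metis abs_le_square_iff abs_of_pos)
      moreover have "(2 * d)\<^sup>2 = 4 * d\<^sup>2" by (simp add: power2_eq_square)
      ultimately show ?thesis unfolding smooth_cos_sq[OF d] using zero_le_power2[of d] by linarith
    qed
    then have "?s \<le> 2 * d" by (rule power2_le_imp_le) (use d in simp)
    then have "?s^3 \<le> (2 * d)^3" by (rule power_mono) (use s in simp)
    then have "d^3 / (2 * d)^3 \<le> d^3 / ?s^3" using s d by (intro divide_left_mono) auto
    moreover have "d^3 / (2 * d)^3 = 1 / 8" using d by (simp add: power_mult_distrib)
    ultimately have s3: "1 / 8 \<le> d^3 / ?s^3" by linarith
    have "(cos x)\<^sup>2 \<le> (1 / 4)\<^sup>2" using True power_mono[of "\<bar>cos x\<bar>" "1 / 4" 2] by simp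
    then have "1 / 2 \<le> (sin x)\<^sup>2" using sin_cos_squared_add[of x] by (simp add: power2_eq_square)
    then have "1 / 2 * (1 / 8) \<le> (sin x)\<^sup>2 * (d^3 / ?s^3)"
      using s3 by (intro mult_mono) auto
    then have "1 / 16 \<le> q" unfolding q_def by simp
    then have "\<sigma>\<^sup>2 / 2 * (\<alpha> * (1 / 16)) \<le> \<sigma>\<^sup>2 / 2 * (\<alpha> * q)"
      using \<alpha>_nonneg by (intro mult_left_mono) auto
    moreover have "\<kappa> \<le> \<sigma>\<^sup>2 / 2 * (\<alpha> * (1 / 16))" using big by (simp add: algebra_simps)
    moreover have "0 \<le> 4 * \<kappa> * d" using assms(1) d by simp
    ultimately have "\<kappa> \<le> 4 * \<kappa> * d + \<sigma>\<^sup>2 / 2 * (\<alpha> * q)" by linarith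
    then show ?thesis using True by simp
  qed
  then have "(if \<bar>cos x\<bar> \<le> d then \<kappa> else 0) * ?f \<le> (4 * \<kappa> * d + \<sigma>\<^sup>2 / 2 * (\<alpha> * q)) * ?f"
    using f by (intro mult_right_mono) auto
  moreover have "(4 * \<kappa> * d + \<sigma>\<^sup>2 / 2 * (\<alpha> * q)) * ?f + \<sigma>\<^sup>2 / 2 * (?f * (d * \<alpha>\<^sup>2 + d * \<alpha> - \<alpha> * q))
    = (4 * \<kappa> + \<sigma>\<^sup>2 / 2 * (\<alpha>\<^sup>2 + \<alpha>)) * (d * ?f)"
    by (simp add: field_simps)
  ultimately show ?thesis using c by linarith
qed

text \<open>The constant 13 = 4 + 9 stems from the bound on \<open>smooth_cos3\<close>, and one cube
  dominates all the polynomials in \<alpha> that occur. Here \<eta> is the initial value of the gap,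
  hence a lower bound for the scale d.\<close>

lemma gap_weight_taylor_bounds:
  assumes "\<eta> \<le> d" "0 < \<eta>" "\<eta> \<le> 1"
  shows "\<bar>gap_weight2 \<alpha> d x\<bar> \<le> (\<alpha> + 13)^3 / \<eta>\<^sup>2" "\<bar>gap_weight3 \<alpha> d x\<bar> \<le> (\<alpha> + 13)^3 / \<eta>\<^sup>2"
proof -
  let ?f = "gap_weight \<alpha> d x"
  note f = gap_weight_bounds[of x]
  have d1: "1 / d \<le> 1 / \<eta>" using assms by (intro frac_le) auto
  have e: "1 \<le> 1 / \<eta>" using assms by simp
  have a1: "\<bar>smooth_cos1 d x\<bar> \<le> 1" by (rule abs_smooth_cos1_le[OF d])
  have a2: "\<bar>smooth_cos2 d x\<bar> \<le> 3 / \<eta>" using abs_smooth_cos2_le[OF d, of x] d1 by linarith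
  have a3: "\<bar>smooth_cos3 d x\<bar> \<le> 13 / \<eta>\<^sup>2"
  proof -
    have "9 / d \<le> 9 / \<eta>" using assms by (intro frac_le) auto
    then have "4 + 9 / d \<le> 4 * (1 / \<eta>) + 9 / \<eta>" using e by linarith
    then have "(4 + 9 / d) / d \<le> (4 * (1 / \<eta>) + 9 / \<eta>) / \<eta>"
      using d assms by (intro frac_le) auto
    also have "\<dots> = 13 / \<eta>\<^sup>2" using assms by (simp add: power2_eq_square field_simps)
    finally show ?thesis using abs_smooth_cos3_le[OF d, of x] by linarith
  qed
  have e2: "1 / \<eta> \<le> 1 / \<eta>\<^sup>2" using assms by (intro frac_le) (auto simp: power2_eq_square mult_left_le)
  have s1: "(smooth_cos1 d x)\<^sup>2 \<le> 1" using a1 by (simp add: abs_square_le_1)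
  have "\<bar>\<alpha>\<^sup>2 * (smooth_cos1 d x)\<^sup>2 - \<alpha> * smooth_cos2 d x\<bar>
      \<le> \<alpha>\<^sup>2 * 1 + \<alpha> * (3 / \<eta>)"
  proof -
    have "\<alpha>\<^sup>2 * (smooth_cos1 d x)\<^sup>2 \<le> \<alpha>\<^sup>2 * 1" using s1 by (intro mult_left_mono) auto
    moreover have "\<alpha> * \<bar>smooth_cos2 d x\<bar> \<le> \<alpha> * (3 / \<eta>)" using a2 \<alpha>_nonneg by (intro mult_left_mono)
    moreover have "\<bar>\<alpha> * smooth_cos2 d x\<bar> = \<alpha> * \<bar>smooth_cos2 d x\<bar>" using \<alpha>_nonneg by (simp add: abs_mult)
    moreover have "0 \<le> \<alpha>\<^sup>2 * (smooth_cos1 d x)\<^sup>2" by simp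
    ultimately show ?thesis by linarith
  qed
  also have "\<dots> \<le> \<alpha>\<^sup>2 * (1 / \<eta>\<^sup>2) + \<alpha> * (3 * (1 / \<eta>\<^sup>2))"
    using e e2 \<alpha>_nonneg by (intro add_mono mult_left_mono) auto
  also have "\<dots> = (\<alpha>\<^sup>2 + 3 * \<alpha>) / \<eta>\<^sup>2" by (simp add: add_divide_distrib)
  also have "\<dots> \<le> (\<alpha> + 13)^3 / \<eta>\<^sup>2"
  proof -
    have "(\<alpha> + 13)^3 = \<alpha>^3 + 39 * \<alpha>\<^sup>2 + 507 * \<alpha> + 2197"
      by (simp add: power3_eq_cube power2_eq_square algebra_simps)
    then show ?thesis using \<alpha>_nonneg by (intro divide_right_mono) auto
  qed
  finally have b: "\<bar>\<alpha>\<^sup>2 * (smooth_cos1 d x)\<^sup>2 - \<alpha> * smooth_cos2 d x\<bar> \<le> (\<alpha> + 13)^3 / \<eta>\<^sup>2" .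
  have "?f * \<bar>\<alpha>\<^sup>2 * (smooth_cos1 d x)\<^sup>2 - \<alpha> * smooth_cos2 d x\<bar> \<le> 1 * ((\<alpha> + 13)^3 / \<eta>\<^sup>2)"
    using f b by (intro mult_mono) auto
  then show "\<bar>gap_weight2 \<alpha> d x\<bar> \<le> (\<alpha> + 13)^3 / \<eta>\<^sup>2"
    unfolding gap_weight2_def using f by (simp add: abs_mult)
  define A where "A = - (\<alpha>^3) * (smooth_cos1 d x)^3"
  define B where "B = 3 * \<alpha>\<^sup>2 * smooth_cos1 d x * smooth_cos2 d x"
  define C where "C = \<alpha> * smooth_cos3 d x"
  have "\<bar>A\<bar> \<le> \<alpha>^3 * 1"
    unfolding A_def abs_mult using a1 \<alpha>_nonneg
    by (intro mult_mono) (auto simp: power_abs power_le_one)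
  also have "\<dots> \<le> \<alpha>^3 * (1 / \<eta>\<^sup>2)" using e e2 \<alpha>_nonneg by (intro mult_left_mono) auto
  finally have A: "\<bar>A\<bar> \<le> \<alpha>^3 * (1 / \<eta>\<^sup>2)" .
  have "\<bar>B\<bar> \<le> 3 * \<alpha>\<^sup>2 * 1 * (3 / \<eta>)"
    unfolding B_def abs_mult using a1 a2 \<alpha>_nonneg by (intro mult_mono) auto
  also have "\<dots> = 9 * \<alpha>\<^sup>2 * (1 / \<eta>)" by simp
  also have "\<dots> \<le> 9 * \<alpha>\<^sup>2 * (1 / \<eta>\<^sup>2)" using e2 by (intro mult_left_mono) auto
  finally have B: "\<bar>B\<bar> \<le> 9 * \<alpha>\<^sup>2 * (1 / \<eta>\<^sup>2)" .
  have "\<bar>C\<bar> \<le> \<alpha> * (13 / \<eta>\<^sup>2)"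
    unfolding C_def abs_mult using a3 \<alpha>_nonneg by (intro mult_mono) auto
  then have "\<bar>A + B - C\<bar> \<le> \<alpha>^3 * (1 / \<eta>\<^sup>2) + 9 * \<alpha>\<^sup>2 * (1 / \<eta>\<^sup>2) + \<alpha> * (13 / \<eta>\<^sup>2)"
    using A B by linarith
  also have "\<dots> = (\<alpha>^3 + 9 * \<alpha>\<^sup>2 + 13 * \<alpha>) / \<eta>\<^sup>2" by (simp add: add_divide_distrib)
  also have "\<dots> \<le> (\<alpha> + 13)^3 / \<eta>\<^sup>2"
  proof -
    have "(\<alpha> + 13)^3 = \<alpha>^3 + 39 * \<alpha>\<^sup>2 + 507 * \<alpha> + 2197"
      by (simp add: power3_eq_cube power2_eq_square algebra_simps)
    then show ?thesis using \<alpha>_nonneg by (intro divide_right_mono) auto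
  qed
  finally have "?f * \<bar>A + B - C\<bar> \<le> 1 * ((\<alpha> + 13)^3 / \<eta>\<^sup>2)"
    using f by (intro mult_mono) auto
  then show "\<bar>gap_weight3 \<alpha> d x\<bar> \<le> (\<alpha> + 13)^3 / \<eta>\<^sup>2"
    unfolding gap_weight3_def A_def[symmetric] B_def[symmetric] C_def[symmetric]
    using f by (simp add: abs_mult)
qed

end

lemma taylor2_bound:
  fixes f f1 f2 f3 :: "real \<Rightarrow> real"
  assumes "\<And>x. (f has_real_derivative f1 x) (at x)"
    and "\<And>x. (f1 has_real_derivative f2 x) (at x)"
    and "\<And>x. (f2 has_real_derivative f3 x) (at x)"
    and b: "\<And>x. \<bar>f3 x\<bar> \<le> C"
  shows "f (x + y) \<le> f x + f1 x * y + f2 x * y\<^sup>2 / 2 + C * \<bar>y\<bar>^3"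
proof (cases "y = 0")
  case False
  define D where "D = (\<lambda>m::nat. if m = 0 then f else if m = 1 then f1 else if m = 2 then f2 else f3)"
  have D: "DERIV (D m) t :> D (Suc m) t" if "m < 3" for m t
  proof -
    have "m = 0 \<or> m = 1 \<or> m = 2" using that by auto
    then show ?thesis by (elim disjE) (simp_all add: D_def assms)
  qed
  have "\<exists>t. (if x + y < x then x + y < t \<and> t < x else x < t \<and> t < x + y) \<and>
    f (x + y) = (\<Sum>m<3. (D m x / fact m) * (x + y - x)^m) + (D 3 t / fact 3) * (x + y - x)^3"
    by (rule Taylor[where a = "min x (x + y)" and b = "max x (x + y)"])
      (use False D in \<open>auto simp: D_def\<close>)
  then obtain t where "f (x + y) = (\<Sum>m<3. (D m x / fact m) * y^m) + (D 3 t / fact 3) * y^3"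
    by auto
  then have e: "f (x + y) = f x + f1 x * y + f2 x * y\<^sup>2 / 2 + f3 t / 6 * y^3"
    by (simp add: D_def numeral_3_eq_3 power2_eq_square)
  have "f3 t / 6 * y^3 \<le> \<bar>f3 t / 6 * y^3\<bar>" by (rule abs_ge_self)
  also have "\<dots> = \<bar>f3 t\<bar> / 6 * \<bar>y\<bar>^3" by (simp add: abs_mult power_abs)
  also have "\<dots> \<le> C * \<bar>y\<bar>^3"
    using b[of t] by (intro mult_right_mono) auto
  finally show ?thesis using e by simp
qed simp

section \<open>Brownian increments\<close>

context standard_brownian_motion
begin

lemma space_F: "0 \<le> t \<Longrightarrow> space (F t) = space M"
  using subalgebra_F by (simp add: subalgebra_def)

lemma measurable_F_M: "0 \<le> t \<Longrightarrow> X \<in> borel_measurable (F t) \<Longrightarrow> X \<in> borel_measurable M"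
  using subalgebra_F measurable_from_subalg by blast

lemma measurable_F_mono:
  "0 \<le> s \<Longrightarrow> s \<le> t \<Longrightarrow> X \<in> borel_measurable (F s) \<Longrightarrow> X \<in> borel_measurable (F t)"
  using measurable_mono[OF order_refl _ F_mono, of borel s t] space_F[of s] space_F[of t]
  by auto

lemma B_borel_measurable: "0 \<le> t \<Longrightarrow> B t \<in> borel_measurable M"
  using adapted measurable_F_M by blast

context
  fixes s t :: real
  assumes st: "0 \<le> s" "s < t"
begin

lemma increment_measurable [measurable]: "(\<lambda>\<omega>. B t \<omega> - B s \<omega>) \<in> borel_measurable M"
  using st by (intro borel_measurable_diff B_borel_measurable) auto

lemma increment_even_moment:
  "has_bochner_integral M (\<lambda>\<omega>. (B t \<omega> - B s \<omega>)^(2 * k)) (fact (2 * k) / (2^k * fact k) * (t - s)^k)"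
proof -
  have d: "distributed M lborel (\<lambda>\<omega>. B t \<omega> - B s \<omega>) (normal_density 0 (sqrt (t - s)))"
    using normal_increments st by simp
  have e: "has_bochner_integral lborel (\<lambda>x. normal_density 0 (sqrt (t - s)) x * x^(2 * k))
      (fact (2 * k) / ((2 / (sqrt (t - s))\<^sup>2)^k * fact k))"
    using normal_moment_even[of "sqrt (t - s)" 0 k] st by simp
  then have i: "integrable M (\<lambda>\<omega>. (B t \<omega> - B s \<omega>)^(2 * k))"
    by (subst distributed_integrable[OF d, symmetric]) (auto simp: has_bochner_integral_iff)
  have "(\<integral>\<omega>. (B t \<omega> - B s \<omega>)^(2 * k) \<partial>M) = fact (2 * k) / ((2 / (sqrt (t - s))\<^sup>2)^k * fact k)"
    using e by (subst distributed_integral[OF d, symmetric]) (auto simp: has_bochner_integral_iff)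
  also have "\<dots> = fact (2 * k) / (2^k * fact k) * (t - s)^k"
    using st by (simp add: power_divide field_simps)
  finally show ?thesis using i by (simp add: has_bochner_integral_iff)
qed

lemma increment_mean: "has_bochner_integral M (\<lambda>\<omega>. B t \<omega> - B s \<omega>) 0"
proof -
  have d: "distributed M lborel (\<lambda>\<omega>. B t \<omega> - B s \<omega>) (normal_density 0 (sqrt (t - s)))"
    using normal_increments st by simp
  have e: "has_bochner_integral lborel (\<lambda>x. normal_density 0 (sqrt (t - s)) x * x) 0"
    using normal_moment_nz_1[of "sqrt (t - s)" 0] st by simp
  then have "integrable M (\<lambda>\<omega>. B t \<omega> - B s \<omega>)"
    by (subst distributed_integrable[OF d, symmetric]) (auto simp: has_bochner_integral_iff)
  moreover have "(\<integral>\<omega>. B t \<omega> - B s \<omega> \<partial>M) = 0"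
    using e by (subst distributed_integral[OF d, symmetric]) (auto simp: has_bochner_integral_iff)
  ultimately show ?thesis by (simp add: has_bochner_integral_iff)
qed

lemma increment_indep:
  fixes X :: "'a \<Rightarrow> real" and g :: "real \<Rightarrow> real"
  assumes X: "X \<in> borel_measurable (F s)" and g: "g \<in> borel_measurable borel"
  shows "indep_var borel X borel (\<lambda>\<omega>. g (B t \<omega> - B s \<omega>))"
proof -
  have gi: "(\<lambda>\<omega>. g (B t \<omega> - B s \<omega>)) \<in> borel_measurable M"
    using g by (intro measurable_compose[OF increment_measurable])
  have "{X -` A \<inter> space M |A. A \<in> sets borel} \<subseteq> sets (F s)"
    using measurable_sets[OF X] space_F[of s] st by auto
  then have a: "sigma_sets (space M) {X -` A \<inter> space M |A. A \<in> sets borel} \<subseteq> sets (F s)"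
    using sets.sigma_sets_subset[of _ "F s"] space_F[of s] st by simp
  let ?V = "vimage_algebra (space M) (\<lambda>\<omega>. B t \<omega> - B s \<omega>) (borel :: real measure)"
  have "(\<lambda>\<omega>. g (B t \<omega> - B s \<omega>)) \<in> borel_measurable ?V"
    by (intro measurable_compose[OF measurable_vimage_algebra1 g]) auto
  then have "{(\<lambda>\<omega>. g (B t \<omega> - B s \<omega>)) -` A \<inter> space M |A. A \<in> sets borel} \<subseteq> sets ?V"
    using measurable_sets[of _ ?V borel] by auto
  then have b: "sigma_sets (space M) {(\<lambda>\<omega>. g (B t \<omega> - B s \<omega>)) -` A \<inter> space M |A. A \<in> sets borel} \<subseteq> sets ?V"
    using sets.sigma_sets_subset[of _ ?V] by simp
  have c: "indep_set (sets (F s)) (sets ?V)" using indep_increments st by simp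
  have "indep_set (sigma_sets (space M) {X -` A \<inter> space M |A. A \<in> sets borel})
    (sigma_sets (space M) {(\<lambda>\<omega>. g (B t \<omega> - B s \<omega>)) -` A \<inter> space M |A. A \<in> sets borel})"
    unfolding indep_set_def
    by (rule indep_sets_mono_sets[OF c[unfolded indep_set_def]])
      (use a b in \<open>auto split: bool.split\<close>)
  then show ?thesis
    unfolding indep_var_eq using measurable_F_M[OF _ X] st gi by simp
qed

text \<open>Needed for two choices of g: the identity, whose mean 0 removes the term linear in the
  increment, and the square, whose mean is the length of the time step and produces the Ito
  correction.\<close>

lemma increment_mult_integral:
  fixes X :: "'a \<Rightarrow> real" and g :: "real \<Rightarrow> real"
  assumes X: "X \<in> borel_measurable (F s)" "\<And>\<omega>. \<omega> \<in> space M \<Longrightarrow> \<bar>X \<omega>\<bar> \<le> C"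
    and g: "g \<in> borel_measurable borel" "has_bochner_integral M (\<lambda>\<omega>. g (B t \<omega> - B s \<omega>)) m"
  shows "has_bochner_integral M (\<lambda>\<omega>. X \<omega> * g (B t \<omega> - B s \<omega>)) (m * (\<integral>\<omega>. X \<omega> \<partial>M))"
proof -
  have iX: "integrable M X"
    using X st by (intro integrable_const_bound[where B = C] AE_I2 measurable_F_M[OF st(1)]) auto
  have ig: "integrable M (\<lambda>\<omega>. g (B t \<omega> - B s \<omega>))" using g(2) by (simp add: has_bochner_integral_iff)
  note ind = increment_indep[OF X(1) g(1)]
  have "integrable M (\<lambda>\<omega>. X \<omega> * g (B t \<omega> - B s \<omega>))"
    using indep_var_integrable[OF ind iX ig] .
  moreover have "(\<integral>\<omega>. X \<omega> * g (B t \<omega> - B s \<omega>) \<partial>M) = (\<integral>\<omega>. X \<omega> \<partial>M) * m"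
    using indep_var_lebesgue_integral[OF ind iX ig] g(2) by (simp add: has_bochner_integral_iff)
  ultimately show ?thesis by (simp add: has_bochner_integral_iff mult.commute)
qed

end

text \<open>A discrete Ito inequality. Y is a weight known at time t, Z the value of a function
  after the step, and a0, a1, a2 are its Taylor coefficients before the step. The linear noise term
  has mean zero, the squared increment has mean h, and everything else is of order
  \<open>h * sqrt h\<close>, so that the errors of T / h steps add up to a multiple of
  \<open>sqrt h\<close>.\<close>

lemma one_step:
  fixes Y a0 a1 a2 g Z :: "'a \<Rightarrow> real" and t h K P Q \<sigma> :: real
  assumes t: "0 \<le> t" and h: "0 < h" "h \<le> 1" and \<sigma>: "0 < \<sigma>"
    and meas: "Y \<in> borel_measurable (F t)" "a0 \<in> borel_measurable (F t)" "a1 \<in> borel_measurable (F t)"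
      "a2 \<in> borel_measurable (F t)" "g \<in> borel_measurable (F t)" "Z \<in> borel_measurable M"
    and bounds: "\<And>\<omega>. \<omega> \<in> space M \<Longrightarrow> 0 \<le> Y \<omega> \<and> Y \<omega> \<le> P \<and> \<bar>a0 \<omega>\<bar> \<le> Q \<and> \<bar>a1 \<omega>\<bar> \<le> Q \<and> \<bar>a2 \<omega>\<bar> \<le> Q
      \<and> \<bar>Z \<omega>\<bar> \<le> Q \<and> \<bar>g \<omega>\<bar> \<le> K"
    and taylor: "\<And>\<omega>. \<omega> \<in> space M \<Longrightarrow>
      Z \<omega> \<le> a0 \<omega> + a1 \<omega> * (h * g \<omega> + \<sigma> * (B (t + h) \<omega> - B t \<omega>))
        + a2 \<omega> * (h * g \<omega> + \<sigma> * (B (t + h) \<omega> - B t \<omega>))\<^sup>2 / 2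
        + Q * \<bar>h * g \<omega> + \<sigma> * (B (t + h) \<omega> - B t \<omega>)\<bar>^3"
  shows "(\<integral>\<omega>. Y \<omega> * Z \<omega> \<partial>M) \<le> (\<integral>\<omega>. Y \<omega> * (a0 \<omega> + h * (a1 \<omega> * g \<omega> + \<sigma>\<^sup>2 / 2 * a2 \<omega>)) \<partial>M)
    + P * Q * (K * \<sigma> + K\<^sup>2 + 4 * K^3 + 8 * \<sigma>^3) * (h * sqrt h)"
proof -
  define \<xi> where "\<xi> = (\<lambda>\<omega>. B (t + h) \<omega> - B t \<omega>)"
  \<comment> \<open>All error terms are dominated by even powers of the increment through
    \<bar>x\<bar> \<le> (sqrt h + \<open>x\<^sup>2\<close> / sqrt h) / 2, the AM-GM inequality
    balanced at the typical size \<open>sqrt h\<close>. Only second and fourth moments are then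
    required.\<close>
  define e where "e = (\<lambda>x::real. h * K * \<sigma> * ((sqrt h + x\<^sup>2 / sqrt h) / 2) + h\<^sup>2 * K\<^sup>2 / 2
    + 4 * h^3 * K^3 + 2 * \<sigma>^3 * (sqrt h * x\<^sup>2 + x^4 / sqrt h))"
  have th: "t < t + h" using h by simp
  have K: "0 \<le> K" and Q: "0 \<le> Q" and P: "0 \<le> P"
    using bounds not_empty by (meson abs_ge_zero all_not_in_conv order_trans)+
  have sh: "0 < sqrt h" "sqrt h * sqrt h = h" using h by auto
  have am: "\<bar>x\<bar> \<le> (sqrt h + x\<^sup>2 / sqrt h) / 2" for x
  proof -
    have "0 \<le> (\<bar>x\<bar> - sqrt h)\<^sup>2" by simp
    also have "\<dots> = x\<^sup>2 + h - 2 * \<bar>x\<bar> * sqrt h" using h by (simp add: power2_diff algebra_simps)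
    finally have "2 * \<bar>x\<bar> * sqrt h \<le> h + x\<^sup>2" by simp
    then show ?thesis using sh by (simp add: field_simps)
  qed
  have cube: "\<bar>x\<bar>^3 \<le> (sqrt h * x\<^sup>2 + x^4 / sqrt h) / 2" for x
  proof -
    have "\<bar>x\<bar>^3 = \<bar>x\<bar> * x\<^sup>2" by (simp add: power3_eq_cube power2_eq_square)
    also have "\<dots> \<le> (sqrt h + x\<^sup>2 / sqrt h) / 2 * x\<^sup>2" using am[of x] by (intro mult_right_mono) auto
    also have "\<dots> = (sqrt h * x\<^sup>2 + x^4 / sqrt h) / 2" by (simp add: field_simps power2_eq_square power4_eq_xxxx)
    finally show ?thesis .
  qed
  have pt: "Y \<omega> * Z \<omega> \<le> Y \<omega> * (a0 \<omega> + h * (a1 \<omega> * g \<omega>)) + (Y \<omega> * a1 \<omega> * \<sigma>) * \<xi> \<omega>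
      + (Y \<omega> * a2 \<omega> * \<sigma>\<^sup>2 / 2) * (\<xi> \<omega>)\<^sup>2 + P * Q * e (\<xi> \<omega>)" if \<omega>: "\<omega> \<in> space M" for \<omega>
  proof -
    note b = bounds[OF \<omega>]
    define y where "y = h * g \<omega> + \<sigma> * \<xi> \<omega>"
    have hg: "\<bar>h * g \<omega>\<bar> \<le> h * K" using b h by (simp add: abs_mult)
    have 1: "a2 \<omega> * y\<^sup>2 / 2 \<le> a2 \<omega> * \<sigma>\<^sup>2 / 2 * (\<xi> \<omega>)\<^sup>2
        + Q * (h * K * \<sigma> * ((sqrt h + (\<xi> \<omega>)\<^sup>2 / sqrt h) / 2) + h\<^sup>2 * K\<^sup>2 / 2)"
    proof -
      have "a2 \<omega> * y\<^sup>2 / 2 = a2 \<omega> * \<sigma>\<^sup>2 / 2 * (\<xi> \<omega>)\<^sup>2 + a2 \<omega> * ((h * g \<omega>) * \<sigma> * \<xi> \<omega> + (h * g \<omega>)\<^sup>2 / 2)"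
        unfolding y_def by (simp add: power2_eq_square algebra_simps)
      also have "a2 \<omega> * ((h * g \<omega>) * \<sigma> * \<xi> \<omega> + (h * g \<omega>)\<^sup>2 / 2)
          \<le> \<bar>a2 \<omega>\<bar> * \<bar>(h * g \<omega>) * \<sigma> * \<xi> \<omega> + (h * g \<omega>)\<^sup>2 / 2\<bar>"
        by (metis abs_ge_self abs_mult)
      also have "\<dots> \<le> Q * (h * K * \<sigma> * ((sqrt h + (\<xi> \<omega>)\<^sup>2 / sqrt h) / 2) + (h * K)\<^sup>2 / 2)"
      proof (intro mult_mono)
        have "\<bar>(h * g \<omega>) * \<sigma> * \<xi> \<omega>\<bar> \<le> h * K * \<sigma> * ((sqrt h + (\<xi> \<omega>)\<^sup>2 / sqrt h) / 2)"
          unfolding abs_mult[of "h * g \<omega> * \<sigma>"] abs_mult[of "h * g \<omega>"]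
          using hg am[of "\<xi> \<omega>"] \<sigma> h K by (intro mult_mono) auto
        moreover have "(h * g \<omega>)\<^sup>2 \<le> (h * K)\<^sup>2"
          using hg h K by (metis abs_le_square_iff abs_of_nonneg mult_nonneg_nonneg less_imp_le)
        ultimately show "\<bar>(h * g \<omega>) * \<sigma> * \<xi> \<omega> + (h * g \<omega>)\<^sup>2 / 2\<bar>
            \<le> h * K * \<sigma> * ((sqrt h + (\<xi> \<omega>)\<^sup>2 / sqrt h) / 2) + (h * K)\<^sup>2 / 2"
          by (smt (verit, best) abs_triangle_ineq abs_of_nonneg zero_le_power2 field_sum_of_halves divide_right_mono)
      qed (use b Q in auto)
      finally show ?thesis by (simp add: power_mult_distrib)
    qed
    have 2: "\<bar>y\<bar>^3 \<le> 4 * h^3 * K^3 + 2 * \<sigma>^3 * (sqrt h * (\<xi> \<omega>)\<^sup>2 + (\<xi> \<omega>)^4 / sqrt h)"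
    proof -
      have "\<bar>y\<bar> \<le> h * K + \<sigma> * \<bar>\<xi> \<omega>\<bar>"
        unfolding y_def using hg \<sigma> abs_triangle_ineq[of "h * g \<omega>" "\<sigma> * \<xi> \<omega>"] by (simp add: abs_mult)
      then have "\<bar>y\<bar>^3 \<le> (h * K + \<sigma> * \<bar>\<xi> \<omega>\<bar>)^3" by (intro power_mono) auto
      also have "\<dots> \<le> 4 * ((h * K)^3 + (\<sigma> * \<bar>\<xi> \<omega>\<bar>)^3)"
      proof -
        have "(a + b)^3 \<le> 4 * (a^3 + b^3)" if "0 \<le> a" "0 \<le> b" for a b :: real
        proof -
          have "4 * (a^3 + b^3) - (a + b)^3 = 3 * (a + b) * (a - b)\<^sup>2"
            by (simp add: power3_eq_cube power2_eq_square algebra_simps)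
          moreover have "0 \<le> 3 * (a + b) * (a - b)\<^sup>2" using that by simp
          ultimately show ?thesis by linarith
        qed
        then show ?thesis using h K \<sigma> by simp
      qed
      also have "\<dots> = 4 * h^3 * K^3 + 4 * \<sigma>^3 * \<bar>\<xi> \<omega>\<bar>^3" by (simp add: power_mult_distrib)
      also have "4 * \<sigma>^3 * \<bar>\<xi> \<omega>\<bar>^3 \<le> 4 * \<sigma>^3 * ((sqrt h * (\<xi> \<omega>)\<^sup>2 + (\<xi> \<omega>)^4 / sqrt h) / 2)"
        using cube \<sigma> by (intro mult_left_mono) auto
      finally show ?thesis by simp
    qed
    have "Z \<omega> \<le> a0 \<omega> + a1 \<omega> * y + a2 \<omega> * y\<^sup>2 / 2 + Q * \<bar>y\<bar>^3"
      unfolding y_def \<xi>_def using taylor[OF \<omega>] .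
    also have "\<dots> \<le> a0 \<omega> + a1 \<omega> * y + a2 \<omega> * \<sigma>\<^sup>2 / 2 * (\<xi> \<omega>)\<^sup>2 + Q * e (\<xi> \<omega>)"
    proof -
      have "Q * e (\<xi> \<omega>) = Q * (h * K * \<sigma> * ((sqrt h + (\<xi> \<omega>)\<^sup>2 / sqrt h) / 2) + h\<^sup>2 * K\<^sup>2 / 2)
        + Q * (4 * h^3 * K^3 + 2 * \<sigma>^3 * (sqrt h * (\<xi> \<omega>)\<^sup>2 + (\<xi> \<omega>)^4 / sqrt h))"
        unfolding e_def distrib_left[symmetric] by simp
      then show ?thesis using 1 mult_left_mono[OF 2 Q] by linarith
    qed
    finally have "Y \<omega> * Z \<omega> \<le> Y \<omega> * (a0 \<omega> + a1 \<omega> * y + a2 \<omega> * \<sigma>\<^sup>2 / 2 * (\<xi> \<omega>)\<^sup>2 + Q * e (\<xi> \<omega>))"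
      using b by (intro mult_left_mono) auto
    also have "\<dots> = Y \<omega> * (a0 \<omega> + h * (a1 \<omega> * g \<omega>)) + (Y \<omega> * a1 \<omega> * \<sigma>) * \<xi> \<omega>
      + (Y \<omega> * a2 \<omega> * \<sigma>\<^sup>2 / 2) * (\<xi> \<omega>)\<^sup>2 + Y \<omega> * (Q * e (\<xi> \<omega>))"
      unfolding y_def by (simp add: algebra_simps)
    also have "Y \<omega> * (Q * e (\<xi> \<omega>)) \<le> P * (Q * e (\<xi> \<omega>))"
    proof (intro mult_right_mono)
      show "0 \<le> Q * e (\<xi> \<omega>)" unfolding e_def using Q h K \<sigma> by simp
    qed (use b in auto)
    finally show ?thesis by simp
  qed
  have m2: "has_bochner_integral M (\<lambda>\<omega>. (\<xi> \<omega>)\<^sup>2) h"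
    using increment_even_moment[OF t th, of 1] unfolding \<xi>_def by simp
  have m4: "has_bochner_integral M (\<lambda>\<omega>. (\<xi> \<omega>)^4) (3 * h\<^sup>2)"
    using increment_even_moment[OF t th, of 2] unfolding \<xi>_def by (simp add: fact_numeral)
  have m1: "has_bochner_integral M (\<lambda>\<omega>. \<xi> \<omega>) 0"
    using increment_mean[OF t th] unfolding \<xi>_def .
  have m0: "has_bochner_integral M (\<lambda>\<omega>. c) c" for c :: real
    by (simp add: has_bochner_integral_iff prob_space)
  define E where "E = h * K * \<sigma> * ((sqrt h + h / sqrt h) / 2) + h\<^sup>2 * K\<^sup>2 / 2
    + 4 * h^3 * K^3 + 2 * \<sigma>^3 * (sqrt h * h + 3 * h\<^sup>2 / sqrt h)"
  have eE: "has_bochner_integral M (\<lambda>\<omega>. P * Q * e (\<xi> \<omega>)) (P * Q * E)"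
    unfolding e_def E_def
    by (intro has_bochner_integral_mult_right has_bochner_integral_add has_bochner_integral_divide m0 m2 m4)
  \<comment> \<open>The factor 8 is 2 * (1 + 3), from the moments h and
    \<open>3 * h\<^sup>2\<close>. The terms in \<open>h\<^sup>2\<close> and \<open>h^3\<close> are
    below \<open>h * sqrt h\<close> because h \<le> 1.\<close>
  have EE: "E \<le> (K * \<sigma> + K\<^sup>2 + 4 * K^3 + 8 * \<sigma>^3) * (h * sqrt h)"
  proof -
    have s1: "h / sqrt h = sqrt h" "h\<^sup>2 / sqrt h = h * sqrt h" using sh h by (auto simp: field_simps power2_eq_square)
    have hs: "h \<le> sqrt h" using h by (simp add: real_le_rsqrt power2_eq_square mult_left_le)
    have "h\<^sup>2 \<le> h * sqrt h" using hs h by (simp add: power2_eq_square)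
    then have "h\<^sup>2 * K\<^sup>2 \<le> (h * sqrt h) * K\<^sup>2" by (intro mult_right_mono) auto
    moreover have "h^3 \<le> h * sqrt h"
    proof -
      have "h^3 \<le> h^2" using h by (intro power_decreasing) auto
      then show ?thesis using \<open>h\<^sup>2 \<le> h * sqrt h\<close> by linarith
    qed
    then have "h^3 * K^3 \<le> (h * sqrt h) * K^3" using K by (intro mult_right_mono) auto
    moreover have "E = K * \<sigma> * (h * sqrt h) + h\<^sup>2 * K\<^sup>2 / 2 + 4 * (h^3 * K^3) + 8 * \<sigma>^3 * (h * sqrt h)"
    proof -
      have "3 * h\<^sup>2 / sqrt h = 3 * (h * sqrt h)" using s1(2) by (metis times_divide_eq_right)
      then show ?thesis unfolding E_def s1(1) by (simp add: algebra_simps)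
    qed
    moreover have "0 \<le> h\<^sup>2 * K\<^sup>2" by simp
    moreover have "(K * \<sigma> + K\<^sup>2 + 4 * K^3 + 8 * \<sigma>^3) * (h * sqrt h) = K * \<sigma> * (h * sqrt h)
      + (h * sqrt h) * K\<^sup>2 + 4 * ((h * sqrt h) * K^3) + 8 * \<sigma>^3 * (h * sqrt h)"
      by (simp add: algebra_simps)
    ultimately show ?thesis by linarith
  qed
  have mM: "X \<in> borel_measurable M" if "X \<in> borel_measurable (F t)" for X :: "'a \<Rightarrow> real"
    using that measurable_F_M[OF t] by blast
  have bm: "\<bar>Y \<omega> * X\<bar> \<le> P * C" if "\<omega> \<in> space M" "\<bar>X\<bar> \<le> C" for \<omega> X C
    unfolding abs_mult using bounds[OF that(1)] that(2) by (intro mult_mono) auto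
  define A where "A = (\<lambda>\<omega>. Y \<omega> * (a0 \<omega> + h * (a1 \<omega> * g \<omega>)))"
  have iA: "integrable M A"
  proof (rule integrable_const_bound[where B = "P * (Q + h * (Q * K))"])
    show "AE \<omega> in M. norm (A \<omega>) \<le> P * (Q + h * (Q * K))"
    proof (rule AE_I2)
      fix \<omega> assume \<omega>: "\<omega> \<in> space M"
      have "\<bar>a1 \<omega> * g \<omega>\<bar> \<le> Q * K" unfolding abs_mult using bounds[OF \<omega>] by (intro mult_mono) auto
      then have "h * \<bar>a1 \<omega> * g \<omega>\<bar> \<le> h * (Q * K)" using h by (intro mult_left_mono) auto
      then have "\<bar>h * (a1 \<omega> * g \<omega>)\<bar> \<le> h * (Q * K)" using h by (simp add: abs_mult)
      then have "\<bar>a0 \<omega> + h * (a1 \<omega> * g \<omega>)\<bar> \<le> Q + h * (Q * K)" using bounds[OF \<omega>] by linarith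
      then show "norm (A \<omega>) \<le> P * (Q + h * (Q * K))" unfolding A_def using bm[OF \<omega>] by simp
    qed
    show "A \<in> borel_measurable M" unfolding A_def using meas(1-5)[THEN mM] by measurable
  qed
  have 1: "has_bochner_integral M (\<lambda>\<omega>. (Y \<omega> * a1 \<omega> * \<sigma>) * \<xi> \<omega>) (0 * (\<integral>\<omega>. Y \<omega> * a1 \<omega> * \<sigma> \<partial>M))"
    unfolding \<xi>_def
  proof (rule increment_mult_integral[OF t th, where C = "P * Q * \<sigma>"])
    show "\<bar>Y \<omega> * a1 \<omega> * \<sigma>\<bar> \<le> P * Q * \<sigma>" if "\<omega> \<in> space M" for \<omega>
      using bm[OF that, of "a1 \<omega>" Q] bounds[OF that] \<sigma> by (simp add: abs_mult)
  qed (use meas m1 in \<open>auto simp: \<xi>_def\<close>)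
  have 2: "has_bochner_integral M (\<lambda>\<omega>. (Y \<omega> * a2 \<omega> * \<sigma>\<^sup>2 / 2) * (\<xi> \<omega>)\<^sup>2) (h * (\<integral>\<omega>. Y \<omega> * a2 \<omega> * \<sigma>\<^sup>2 / 2 \<partial>M))"
    unfolding \<xi>_def
  proof (rule increment_mult_integral[OF t th, where C = "P * Q * \<sigma>\<^sup>2 / 2" and g = "\<lambda>x. x\<^sup>2"])
    show "\<bar>Y \<omega> * a2 \<omega> * \<sigma>\<^sup>2 / 2\<bar> \<le> P * Q * \<sigma>\<^sup>2 / 2" if "\<omega> \<in> space M" for \<omega>
      using bm[OF that, of "a2 \<omega>" Q] bounds[OF that] \<sigma> by (simp add: abs_mult)
  qed (use meas m2 in \<open>auto simp: \<xi>_def\<close>)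
  have b2: "\<bar>Y \<omega> * a2 \<omega> * \<sigma>\<^sup>2 / 2\<bar> \<le> P * Q * \<sigma>\<^sup>2 / 2" if "\<omega> \<in> space M" for \<omega>
    using bm[OF that, of "a2 \<omega>" Q] bounds[OF that] by (simp add: abs_mult mult_right_mono)
  have i2: "integrable M (\<lambda>\<omega>. Y \<omega> * a2 \<omega> * \<sigma>\<^sup>2 / 2)"
  proof (rule integrable_const_bound[where B = "P * Q * \<sigma>\<^sup>2 / 2"])
    show "(\<lambda>\<omega>. Y \<omega> * a2 \<omega> * \<sigma>\<^sup>2 / 2) \<in> borel_measurable M" using meas(1-5)[THEN mM] by measurable
  qed (use b2 in \<open>auto intro!: AE_I2\<close>)
  have bZ: "\<bar>Y \<omega> * Z \<omega>\<bar> \<le> P * Q" if "\<omega> \<in> space M" for \<omega>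
    using bm[OF that, of "Z \<omega>" Q] bounds[OF that] by simp
  have iYZ: "integrable M (\<lambda>\<omega>. Y \<omega> * Z \<omega>)"
  proof (rule integrable_const_bound[where B = "P * Q"])
    show "(\<lambda>\<omega>. Y \<omega> * Z \<omega>) \<in> borel_measurable M" using meas(1)[THEN mM] meas(6) by measurable
  qed (use bZ in \<open>auto intro!: AE_I2\<close>)
  have tot: "has_bochner_integral M (\<lambda>\<omega>. A \<omega> + (Y \<omega> * a1 \<omega> * \<sigma>) * \<xi> \<omega>
      + (Y \<omega> * a2 \<omega> * \<sigma>\<^sup>2 / 2) * (\<xi> \<omega>)\<^sup>2 + P * Q * e (\<xi> \<omega>))
      ((\<integral>\<omega>. A \<omega> \<partial>M) + 0 * (\<integral>\<omega>. Y \<omega> * a1 \<omega> * \<sigma> \<partial>M) + h * (\<integral>\<omega>. Y \<omega> * a2 \<omega> * \<sigma>\<^sup>2 / 2 \<partial>M) + P * Q * E)"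
    using iA by (intro has_bochner_integral_add 1 2 eE) (simp add: has_bochner_integral_iff)
  have "(\<integral>\<omega>. Y \<omega> * Z \<omega> \<partial>M) \<le> (\<integral>\<omega>. A \<omega> \<partial>M) + 0 * (\<integral>\<omega>. Y \<omega> * a1 \<omega> * \<sigma> \<partial>M) + h * (\<integral>\<omega>. Y \<omega> * a2 \<omega> * \<sigma>\<^sup>2 / 2 \<partial>M) + P * Q * E"
  proof -
    have "(\<integral>\<omega>. Y \<omega> * Z \<omega> \<partial>M) \<le> (\<integral>\<omega>. A \<omega> + (Y \<omega> * a1 \<omega> * \<sigma>) * \<xi> \<omega>
      + (Y \<omega> * a2 \<omega> * \<sigma>\<^sup>2 / 2) * (\<xi> \<omega>)\<^sup>2 + P * Q * e (\<xi> \<omega>) \<partial>M)"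
      using tot pt unfolding A_def by (intro integral_mono iYZ) (auto simp: has_bochner_integral_iff)
    then show ?thesis using has_bochner_integral_integral_eq[OF tot] by simp
  qed
  also have "\<dots> = (\<integral>\<omega>. A \<omega> + h * (Y \<omega> * a2 \<omega> * \<sigma>\<^sup>2 / 2) \<partial>M) + P * Q * E"
  proof -
    have "(\<integral>\<omega>. A \<omega> + h * (Y \<omega> * a2 \<omega> * \<sigma>\<^sup>2 / 2) \<partial>M)
        = (\<integral>\<omega>. A \<omega> \<partial>M) + (\<integral>\<omega>. h * (Y \<omega> * a2 \<omega> * \<sigma>\<^sup>2 / 2) \<partial>M)"
      by (rule Bochner_Integration.integral_add[OF iA integrable_mult_right[OF i2]])
    also have "(\<integral>\<omega>. h * (Y \<omega> * a2 \<omega> * \<sigma>\<^sup>2 / 2) \<partial>M) = h * (\<integral>\<omega>. Y \<omega> * a2 \<omega> * \<sigma>\<^sup>2 / 2 \<partial>M)"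
      by (rule integral_mult_right_zero)
    finally show ?thesis by linarith
  qed
  also have "(\<lambda>\<omega>. A \<omega> + h * (Y \<omega> * a2 \<omega> * \<sigma>\<^sup>2 / 2)) = (\<lambda>\<omega>. Y \<omega> * (a0 \<omega> + h * (a1 \<omega> * g \<omega> + \<sigma>\<^sup>2 / 2 * a2 \<omega>)))"
    unfolding A_def by (simp add: fun_eq_iff algebra_simps)
  also have "P * Q * E \<le> P * Q * ((K * \<sigma> + K\<^sup>2 + 4 * K^3 + 8 * \<sigma>^3) * (h * sqrt h))"
    using P Q EE by (intro mult_left_mono) auto
  finally show ?thesis by (simp add: mult.assoc)
qed

end

section \<open>The Euler scheme and its gap sequence\<close>

text \<open>The cut-off \<epsilon> enters the angular drift only, since the radial drift does not
  depend on the radius. The scheme is therefore defined for all indices, even after its radius has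
  become negative.\<close>

primrec euler :: "real \<Rightarrow> real \<Rightarrow> real \<Rightarrow> real \<Rightarrow> (real \<Rightarrow> real) \<Rightarrow> real \<Rightarrow> real \<Rightarrow> nat \<Rightarrow> real \<times> real"
  where
    "euler v N \<epsilon> h w r \<theta> 0 = (r, \<theta>)"
  | "euler v N \<epsilon> h w r \<theta> (Suc i) = (let (\<rho>, x) = euler v N \<epsilon> h w r \<theta> i in
       (\<rho> + h * pn_mu1 v \<rho> x,
        x + h * pn_mu2 v N (max \<rho> \<epsilon>) x + (w (h * real (Suc i)) - w (h * real i))))"

text \<open>The drift differs by at most \<open>\<kappa>\<close> on the two sides of a wall, and a solution within distance \<open>gap\<close> of
  the scheme can be on the other side only if the scheme itself is that close to the wall.\<close>

primrec gap :: "real \<Rightarrow> real \<Rightarrow> real \<Rightarrow> real \<Rightarrow> (nat \<Rightarrow> real) \<Rightarrow> nat \<Rightarrow> real" where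
    "gap \<kappa> L h \<eta> x 0 = \<eta>"
  | "gap \<kappa> L h \<eta> x (Suc i) = gap \<kappa> L h \<eta> x i
       + h * ((if \<bar>cos (x i)\<bar> \<le> gap \<kappa> L h \<eta> x i then \<kappa> else 0) + L * gap \<kappa> L h \<eta> x i)"

context
  fixes \<kappa> L h \<eta> :: real and x :: "nat \<Rightarrow> real"
  assumes pos: "0 \<le> \<kappa>" "0 \<le> L" "0 \<le> h" "0 < \<eta>"
begin

lemma gap_ge: "\<eta> \<le> gap \<kappa> L h \<eta> x i"
proof (induction i)
  case (Suc i)
  then have "0 \<le> h * ((if \<bar>cos (x i)\<bar> \<le> gap \<kappa> L h \<eta> x i then \<kappa> else 0) + L * gap \<kappa> L h \<eta> x i)"
    using pos by (intro mult_nonneg_nonneg add_nonneg_nonneg) auto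
  then show ?case using Suc by simp
qed simp

lemma gap_pos: "0 < gap \<kappa> L h \<eta> x i"
  using gap_ge[of i] pos by linarith

lemma gap_mono: "i \<le> j \<Longrightarrow> gap \<kappa> L h \<eta> x i \<le> gap \<kappa> L h \<eta> x j"
proof (rule lift_Suc_mono_le)
  fix i
  have "0 \<le> h * ((if \<bar>cos (x i)\<bar> \<le> gap \<kappa> L h \<eta> x i then \<kappa> else 0) + L * gap \<kappa> L h \<eta> x i)"
    using pos gap_pos[of i] by (intro mult_nonneg_nonneg add_nonneg_nonneg) auto
  then show "gap \<kappa> L h \<eta> x i \<le> gap \<kappa> L h \<eta> x (Suc i)" by simp
qed

text \<open>The worst case, with the jump charged at every step. It is not small, but it bounds the
  gap uniformly over all paths, which gives integrability and the constant D of the expectation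
  estimates.\<close>

lemma gap_le: "gap \<kappa> L h \<eta> x i \<le> (\<eta> + \<kappa> * (h * real i)) * exp (L * (h * real i))"
proof -
  have "gap \<kappa> L h \<eta> x i \<le> (\<eta> + \<kappa> * (h * real i)) * (1 + h * L)^i"
  proof (induction i)
    case (Suc i)
    let ?g = "gap \<kappa> L h \<eta> x i"
    have hL: "0 \<le> h * L" using pos by simp
    have "?g + h * ((if \<bar>cos (x i)\<bar> \<le> ?g then \<kappa> else 0) + L * ?g) \<le> ?g * (1 + h * L) + h * \<kappa>"
      using pos by (auto simp: algebra_simps)
    also have "\<dots> \<le> (\<eta> + \<kappa> * (h * real i)) * (1 + h * L)^i * (1 + h * L) + h * \<kappa> * (1 + h * L)^Suc i"
    proof (intro add_mono mult_right_mono Suc.IH)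
      show "h * \<kappa> \<le> h * \<kappa> * (1 + h * L)^Suc i"
        using mult_left_mono[OF one_le_power[of "1 + h * L" "Suc i"], of "h * \<kappa>"] pos hL by simp
    qed (use hL in simp)
    also have "\<dots> = (\<eta> + \<kappa> * (h * real (Suc i))) * (1 + h * L)^Suc i"
      by (simp add: algebra_simps)
    finally show ?case by simp
  qed simp
  also have "\<dots> \<le> (\<eta> + \<kappa> * (h * real i)) * exp (L * (h * real i))"
  proof (intro mult_left_mono)
    have "(1 + h * L)^i \<le> exp (h * L)^i" using pos by (intro power_mono) auto
    then show "(1 + h * L)^i \<le> exp (L * (h * real i))"
      by (simp add: exp_of_nat_mult[symmetric] mult_ac)
  qed (use pos in auto)
  finally show ?thesis .
qed

end

text \<open>The sigma-algebra G is left open so that the lemma serves the given filtration, the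
  augmented filtration and the whole space.\<close>

lemma euler_measurable:
  assumes "\<And>s. 0 \<le> s \<Longrightarrow> s \<le> h * real i \<Longrightarrow> b s \<in> borel_measurable G" and "0 \<le> h"
  shows "(\<lambda>\<omega>. fst (euler v N \<epsilon> h (\<lambda>s. \<sigma> * b s \<omega>) r \<theta> i)) \<in> borel_measurable G \<and>
    (\<lambda>\<omega>. snd (euler v N \<epsilon> h (\<lambda>s. \<sigma> * b s \<omega>) r \<theta> i)) \<in> borel_measurable G"
  using assms(1)
proof (induction i)
  case (Suc i)
  have le: "h * real i \<le> h * real (Suc i)" using assms(2) by (intro mult_left_mono) auto
  have [measurable]: "b (h * real i) \<in> borel_measurable G" "b (h * real (Suc i)) \<in> borel_measurable G"
    using assms(2) le by (auto intro!: Suc.prems simp del: of_nat_Suc)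
  have [measurable]: "(\<lambda>\<omega>. fst (euler v N \<epsilon> h (\<lambda>s. \<sigma> * b s \<omega>) r \<theta> i)) \<in> borel_measurable G"
    "(\<lambda>\<omega>. snd (euler v N \<epsilon> h (\<lambda>s. \<sigma> * b s \<omega>) r \<theta> i)) \<in> borel_measurable G"
    using Suc.IH[OF Suc.prems] le by auto
  show ?case unfolding euler.simps Let_def case_prod_beta fst_conv snd_conv
    by (intro conjI; measurable)
qed simp

lemma gap_measurable:
  assumes "\<And>j. j < i \<Longrightarrow> x j \<in> borel_measurable G"
  shows "(\<lambda>\<omega>. gap \<kappa> L h \<eta> (\<lambda>j. x j \<omega>) i) \<in> borel_measurable G"
  using assms
proof (induction i)
  case (Suc i)
  have [measurable]: "x i \<in> borel_measurable G" "(\<lambda>\<omega>. gap \<kappa> L h \<eta> (\<lambda>j. x j \<omega>) i) \<in> borel_measurable G"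
    using Suc by auto
  show ?case by simp
qed simp

lemma smooth_cos_measurable [measurable (raw)]:
  assumes [measurable]: "f \<in> borel_measurable G" "g \<in> borel_measurable G"
  shows "(\<lambda>\<omega>. smooth_cos (f \<omega>) (g \<omega>)) \<in> borel_measurable G"
    "(\<lambda>\<omega>. smooth_cos1 (f \<omega>) (g \<omega>)) \<in> borel_measurable G"
    "(\<lambda>\<omega>. smooth_cos2 (f \<omega>) (g \<omega>)) \<in> borel_measurable G"
    "(\<lambda>\<omega>. gap_weight \<alpha> (f \<omega>) (g \<omega>)) \<in> borel_measurable G"
    "(\<lambda>\<omega>. gap_weight1 \<alpha> (f \<omega>) (g \<omega>)) \<in> borel_measurable G"
    "(\<lambda>\<omega>. gap_weight2 \<alpha> (f \<omega>) (g \<omega>)) \<in> borel_measurable G"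
  unfolding smooth_cos_def smooth_cos1_def smooth_cos2_def gap_weight_def gap_weight1_def gap_weight2_def
  by measurable

lemma discrete_gronwall:
  fixes m :: "nat \<Rightarrow> real"
  assumes step: "\<And>i. i < n \<Longrightarrow> m (Suc i) \<le> (1 + C * h) * m i + b" and "0 \<le> C" "0 \<le> h" "0 \<le> b"
    and "0 \<le> m 0"
  shows "m n \<le> (m 0 + real n * b) * exp (C * (h * real n))"
proof -
  have "k \<le> n \<Longrightarrow> m k \<le> (m 0 + real k * b) * (1 + C * h)^k" for k
  proof (induction k)
    case (Suc k)
    have Ch: "0 \<le> C * h" using assms by simp
    have "(1 + C * h) * m k \<le> (1 + C * h) * ((m 0 + real k * b) * (1 + C * h)^k)"
      by (rule mult_left_mono) (use Suc Ch in auto)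
    then have "m (Suc k) \<le> (1 + C * h) * ((m 0 + real k * b) * (1 + C * h)^k) + b"
      using step[of k] Suc.prems by linarith
    also have "\<dots> \<le> (1 + C * h) * ((m 0 + real k * b) * (1 + C * h)^k) + b * (1 + C * h)^Suc k"
      using mult_left_mono[OF one_le_power[of "1 + C * h" "Suc k"] assms(4)] Ch by simp
    also have "\<dots> = (m 0 + real (Suc k) * b) * (1 + C * h)^Suc k" by (simp add: algebra_simps)
    finally show ?case .
  qed simp
  then have "m n \<le> (m 0 + real n * b) * (1 + C * h)^n" by simp
  also have "\<dots> \<le> (m 0 + real n * b) * exp (C * (h * real n))"
  proof (intro mult_left_mono)
    have "(1 + C * h)^n \<le> exp (C * h)^n" using assms by (intro power_mono) auto
    then show "(1 + C * h)^n \<le> exp (C * (h * real n))"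
      by (simp add: exp_of_nat_mult[symmetric] mult_ac)
  qed (use assms in auto)
  finally show ?thesis .
qed

section \<open>Expected growth of the gap along the scheme\<close>

context standard_brownian_motion
begin

context
  fixes v N \<sigma> r \<theta> \<epsilon> :: real
  assumes par: "0 < v" "1 \<le> N" "0 < \<sigma>" "0 < \<epsilon>"
begin

abbreviation chain :: "real \<Rightarrow> nat \<Rightarrow> 'a \<Rightarrow> real \<times> real" where
  "chain h i \<omega> \<equiv> euler v N \<epsilon> h (\<lambda>s. \<sigma> * B s \<omega>) r \<theta> i"

abbreviation chain_gap :: "real \<Rightarrow> real \<Rightarrow> real \<Rightarrow> real \<Rightarrow> nat \<Rightarrow> 'a \<Rightarrow> real" where
  "chain_gap \<kappa> L h \<eta> i \<omega> \<equiv> gap \<kappa> L h \<eta> (\<lambda>j. snd (chain h j \<omega>)) i"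

lemma chain_measurable:
  assumes "0 \<le> h"
  shows "(\<lambda>\<omega>. fst (chain h i \<omega>)) \<in> borel_measurable (F (h * real i))"
    "(\<lambda>\<omega>. snd (chain h i \<omega>)) \<in> borel_measurable (F (h * real i))"
  using euler_measurable[of h i B "F (h * real i)"] assms measurable_F_mono[OF _ _ adapted] by auto

text \<open>The gap is predictable: its value at index i + 1 depends on the angles up to index i
  only. In the next step estimate it can therefore be treated as a known factor while the weight is
  expanded over the following increment.\<close>

lemma chain_gap_measurable:
  assumes h: "0 \<le> h"
  shows "chain_gap \<kappa> L h \<eta> i \<in> borel_measurable (F (h * real i))"
    "chain_gap \<kappa> L h \<eta> (Suc i) \<in> borel_measurable (F (h * real i))"
proof -
  have "(\<lambda>\<omega>. snd (chain h j \<omega>)) \<in> borel_measurable (F (h * real i))" if "j \<le> i" for j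
    using h that by (intro measurable_F_mono[OF _ _ chain_measurable(2)[OF h]] mult_left_mono) auto
  then show "chain_gap \<kappa> L h \<eta> i \<in> borel_measurable (F (h * real i))"
    "chain_gap \<kappa> L h \<eta> (Suc i) \<in> borel_measurable (F (h * real i))"
    by (intro gap_measurable; auto)+
qed

lemma chain_step:
  assumes "0 \<le> h"
  shows "snd (chain h (Suc i) \<omega>) = snd (chain h i \<omega>)
     + (h * pn_mu2 v N (max (fst (chain h i \<omega>)) \<epsilon>) (snd (chain h i \<omega>))
        + \<sigma> * (B (h * real i + h) \<omega> - B (h * real i) \<omega>))"
    "fst (chain h (Suc i) \<omega>) = fst (chain h i \<omega>) + h * pn_mu1 v (fst (chain h i \<omega>)) (snd (chain h i \<omega>))"
  by (simp_all add: case_prod_beta Let_def algebra_simps)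

lemma chain_drift_le:
  "\<bar>pn_mu2 v N (max (fst (chain h i \<omega>)) \<epsilon>) (snd (chain h i \<omega>))\<bar> \<le> (N - 1) * v / \<epsilon>"
  using par by (intro abs_pn_mu2_le) auto

text \<open>The weight is expanded in the angle with its scale frozen at the old gap, while the
  factor in front is already the new gap. The product of the two first-order changes is of order
  \<open>h * h\<close> and joins the error; the remaining first-order terms are what
  \<open>gap_weight_drift\<close> controls.\<close>

lemma gap_step_expectation:
  fixes \<kappa> L T D \<alpha> \<eta> h :: real and i :: nat
  defines "K \<equiv> (N - 1) * v / \<epsilon>" and "Q \<equiv> (\<alpha> + 13)^3 / \<eta>\<^sup>2"
  assumes kL: "0 \<le> \<kappa>" "0 \<le> L" and \<alpha>: "0 \<le> \<alpha>" "32 * \<kappa> \<le> \<alpha> * \<sigma>\<^sup>2"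
    and \<eta>: "0 < \<eta>" "\<eta> \<le> 1" and h: "0 < h" "h \<le> 1"
    and D: "\<And>\<omega>. chain_gap \<kappa> L h \<eta> (Suc i) \<omega> \<le> D"
  shows "(\<integral>\<omega>. chain_gap \<kappa> L h \<eta> (Suc i) \<omega> * gap_weight \<alpha> (chain_gap \<kappa> L h \<eta> (Suc i) \<omega>) (snd (chain h (Suc i) \<omega>)) \<partial>M)
    \<le> (1 + (4 * \<kappa> + \<sigma>\<^sup>2 / 2 * (\<alpha>\<^sup>2 + \<alpha>) + L + \<alpha> * K) * h)
        * (\<integral>\<omega>. chain_gap \<kappa> L h \<eta> i \<omega> * gap_weight \<alpha> (chain_gap \<kappa> L h \<eta> i \<omega>) (snd (chain h i \<omega>)) \<partial>M)
      + (D * Q * (K * \<sigma> + K\<^sup>2 + 4 * K^3 + 8 * \<sigma>^3) + (\<kappa> + L * D) * (Q * K + \<sigma>\<^sup>2 / 2 * Q)) * (h * sqrt h)"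
proof -
  define C where "C = 4 * \<kappa> + \<sigma>\<^sup>2 / 2 * (\<alpha>\<^sup>2 + \<alpha>) + L + \<alpha> * K"
  define d where "d = chain_gap \<kappa> L h \<eta> i"
  define d' where "d' = chain_gap \<kappa> L h \<eta> (Suc i)"
  define X where "X = (\<lambda>\<omega>. snd (chain h i \<omega>))"
  define X' where "X' = (\<lambda>\<omega>. snd (chain h (Suc i) \<omega>))"
  define g where "g = (\<lambda>\<omega>. pn_mu2 v N (max (fst (chain h i \<omega>)) \<epsilon>) (X \<omega>))"
  let ?t = "h * real i"
  have t: "0 \<le> ?t" using h by simp
  have h0: "0 \<le> h" using h by simp
  have K: "0 \<le> K" unfolding K_def using par by simp
  have gK: "\<bar>g \<omega>\<bar> \<le> K" for \<omega> unfolding g_def X_def K_def by (rule chain_drift_le)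
  have d0: "0 < d \<omega>" "\<eta> \<le> d \<omega>" "0 < d' \<omega>" "d \<omega> \<le> d' \<omega>" "d' \<omega> \<le> D" for \<omega>
    unfolding d_def d'_def using gap_pos gap_ge gap_mono kL h0 \<eta>(1) D
    by (auto intro!: gap_mono simp del: gap.simps)
  have dD: "d \<omega> \<le> D" for \<omega> using d0[of \<omega>] by linarith
  have D0: "0 \<le> D" using d0(1)[of undefined] dD[of undefined] by linarith
  define \<zeta> where "\<zeta> = (\<lambda>\<omega>. (if \<bar>cos (X \<omega>)\<bar> \<le> d \<omega> then \<kappa> else 0) + L * d \<omega>)"
  have d': "d' \<omega> = d \<omega> + h * \<zeta> \<omega>" for \<omega> unfolding d'_def d_def X_def \<zeta>_def by simp
  have \<zeta>: "0 \<le> \<zeta> \<omega>" "\<zeta> \<omega> \<le> \<kappa> + L * D" for \<omega>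
  proof -
    have "L * d \<omega> \<le> L * D" using dD kL by (intro mult_left_mono)
    moreover have "0 \<le> L * d \<omega>" using d0(1)[of \<omega>] kL by simp
    ultimately show "0 \<le> \<zeta> \<omega>" "\<zeta> \<omega> \<le> \<kappa> + L * D" unfolding \<zeta>_def using kL by auto
  qed
  have X': "X' \<omega> = X \<omega> + (h * g \<omega> + \<sigma> * (B (?t + h) \<omega> - B ?t \<omega>))" for \<omega>
    unfolding X'_def X_def g_def by (rule chain_step(1)[OF h0])
  have Q13: "13 + \<alpha> \<le> Q"
  proof -
    have "13 + \<alpha> \<le> (\<alpha> + 13)^3" using power_increasing[of 1 3 "\<alpha> + 13"] \<alpha> by simp
    also have "\<dots> = (\<alpha> + 13)^3 / 1" by simp
    also have "\<dots> \<le> Q" unfolding Q_def using \<eta> \<alpha> by (intro divide_left_mono) (auto simp: power_le_one)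
    finally show ?thesis .
  qed
  have f: "0 < gap_weight \<alpha> (d \<omega>) y" "gap_weight \<alpha> (d \<omega>) y \<le> 1" for \<omega> y
    using gap_weight_bounds[OF d0(1) \<alpha>(1)] by auto
  have f1: "\<bar>gap_weight1 \<alpha> (d \<omega>) y\<bar> \<le> \<alpha> * gap_weight \<alpha> (d \<omega>) y" for \<omega> y
    using abs_gap_weight1_le[OF d0(1) \<alpha>(1)] .
  have f1': "\<bar>gap_weight1 \<alpha> (d \<omega>) y\<bar> \<le> Q" for \<omega> y
  proof -
    have "\<alpha> * gap_weight \<alpha> (d \<omega>) y \<le> \<alpha> * 1" using f[of \<omega> y] \<alpha> by (intro mult_left_mono) auto
    then show ?thesis using f1[of \<omega> y] Q13 by linarith
  qed
  have f23: "\<bar>gap_weight2 \<alpha> (d \<omega>) y\<bar> \<le> Q" "\<bar>gap_weight3 \<alpha> (d \<omega>) y\<bar> \<le> Q" for \<omega> y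
    unfolding Q_def using gap_weight_taylor_bounds[OF d0(1) \<alpha>(1) d0(2) \<eta>] by auto
  have mF: "d \<in> borel_measurable (F ?t)" "d' \<in> borel_measurable (F ?t)" "X \<in> borel_measurable (F ?t)"
    unfolding d_def d'_def X_def using chain_gap_measurable[OF h0] chain_measurable[OF h0] by auto
  have gF: "g \<in> borel_measurable (F ?t)"
    unfolding g_def X_def using chain_measurable[OF h0, of i] by measurable
  have mX': "X' \<in> borel_measurable M"
    unfolding X'_def by (rule measurable_F_M[OF _ chain_measurable(2)[OF h0]]) (use h0 in simp)
  have mM: "d \<in> borel_measurable M" "d' \<in> borel_measurable M" "X \<in> borel_measurable M" "g \<in> borel_measurable M"
    using mF gF measurable_F_M[OF t] by auto
  note [measurable] = mX' mM
  have main: "(\<integral>\<omega>. d' \<omega> * gap_weight \<alpha> (d \<omega>) (X' \<omega>) \<partial>M)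
    \<le> (\<integral>\<omega>. d' \<omega> * (gap_weight \<alpha> (d \<omega>) (X \<omega>) + h * (gap_weight1 \<alpha> (d \<omega>) (X \<omega>) * g \<omega> + \<sigma>\<^sup>2 / 2 * gap_weight2 \<alpha> (d \<omega>) (X \<omega>))) \<partial>M)
    + D * Q * (K * \<sigma> + K\<^sup>2 + 4 * K^3 + 8 * \<sigma>^3) * (h * sqrt h)"
  proof (rule one_step[OF t h par(3)])
    show "(\<lambda>\<omega>. gap_weight \<alpha> (d \<omega>) (X \<omega>)) \<in> borel_measurable (F ?t)"
      "(\<lambda>\<omega>. gap_weight1 \<alpha> (d \<omega>) (X \<omega>)) \<in> borel_measurable (F ?t)"
      "(\<lambda>\<omega>. gap_weight2 \<alpha> (d \<omega>) (X \<omega>)) \<in> borel_measurable (F ?t)"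
      using mF(1,3) by measurable
    show "(\<lambda>\<omega>. gap_weight \<alpha> (d \<omega>) (X' \<omega>)) \<in> borel_measurable M" by measurable
    fix \<omega> assume "\<omega> \<in> space M"
    have one: "\<bar>gap_weight \<alpha> (d \<omega>) y\<bar> \<le> Q" for y using f[of \<omega> y] Q13 \<alpha>(1) by linarith
    show "0 \<le> d' \<omega> \<and> d' \<omega> \<le> D \<and> \<bar>gap_weight \<alpha> (d \<omega>) (X \<omega>)\<bar> \<le> Q \<and>
         \<bar>gap_weight1 \<alpha> (d \<omega>) (X \<omega>)\<bar> \<le> Q \<and> \<bar>gap_weight2 \<alpha> (d \<omega>) (X \<omega>)\<bar> \<le> Q \<and>
         \<bar>gap_weight \<alpha> (d \<omega>) (X' \<omega>)\<bar> \<le> Q \<and> \<bar>g \<omega>\<bar> \<le> K"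
      using d0[of \<omega>] one f1' f23 gK by (auto intro: less_imp_le)
    show "gap_weight \<alpha> (d \<omega>) (X' \<omega>)
         \<le> gap_weight \<alpha> (d \<omega>) (X \<omega>)
          + gap_weight1 \<alpha> (d \<omega>) (X \<omega>) * (h * g \<omega> + \<sigma> * (B (?t + h) \<omega> - B ?t \<omega>))
          + gap_weight2 \<alpha> (d \<omega>) (X \<omega>) * (h * g \<omega> + \<sigma> * (B (?t + h) \<omega> - B ?t \<omega>))\<^sup>2 / 2
          + Q * \<bar>h * g \<omega> + \<sigma> * (B (?t + h) \<omega> - B ?t \<omega>)\<bar>^3"
      unfolding X'
      by (rule taylor2_bound[OF DERIV_gap_weight[OF d0(1) \<alpha>(1)] DERIV_gap_weight1[OF d0(1) \<alpha>(1)]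
          DERIV_gap_weight2[OF d0(1) \<alpha>(1)] f23(2)])
  qed (use mF gF in auto)
  define U where "U = (\<lambda>\<omega>. d \<omega> * gap_weight \<alpha> (d \<omega>) (X \<omega>))"
  have U1: "0 \<le> U \<omega>" "U \<omega> \<le> D" for \<omega>
  proof -
    have "d \<omega> * gap_weight \<alpha> (d \<omega>) (X \<omega>) \<le> D * 1"
      by (rule mult_mono) (use f[of \<omega> "X \<omega>"] dD[of \<omega>] D0 in auto)
    then show "0 \<le> U \<omega>" "U \<omega> \<le> D" unfolding U_def using f[of \<omega> "X \<omega>"] d0[of \<omega>] by auto
  qed
  have iU: "integrable M U"
    using U1 by (intro integrable_const_bound[where B = D] AE_I2) (auto simp: U_def)
  define b where "b = (\<kappa> + L * D) * (Q * K + \<sigma>\<^sup>2 / 2 * Q)"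
  have Q0: "0 \<le> Q" using Q13 \<alpha> by linarith
  have b0: "0 \<le> b" unfolding b_def using kL D0 Q0 K by simp
  have hh: "h * h \<le> h * sqrt h"
    using h by (intro mult_left_mono) (auto simp: real_le_rsqrt power2_eq_square mult_left_le)
  define q where "q = (\<lambda>\<omega>. gap_weight1 \<alpha> (d \<omega>) (X \<omega>) * g \<omega> + \<sigma>\<^sup>2 / 2 * gap_weight2 \<alpha> (d \<omega>) (X \<omega>))"
  have qle: "\<bar>q \<omega>\<bar> \<le> Q * K + \<sigma>\<^sup>2 / 2 * Q" for \<omega>
  proof -
    have "\<bar>gap_weight1 \<alpha> (d \<omega>) (X \<omega>) * g \<omega>\<bar> \<le> Q * K"
      unfolding abs_mult using f1' gK Q0 by (intro mult_mono) auto
    moreover have "\<bar>\<sigma>\<^sup>2 / 2 * gap_weight2 \<alpha> (d \<omega>) (X \<omega>)\<bar> \<le> \<sigma>\<^sup>2 / 2 * Q"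
      unfolding abs_mult using f23(1) Q0 by (intro mult_mono) auto
    ultimately show ?thesis unfolding q_def by linarith
  qed
  \<comment> \<open>Multiplying out \<open>(d + h * \<zeta>) * (f + h * q)\<close>: the coefficient
    of h is bounded by \<open>C * U\<close>, where the kink term inside q cancels the jump inside
    \<zeta>, and the coefficient of \<open>h * h\<close> is bounded by b.\<close>
  have pt: "d' \<omega> * (gap_weight \<alpha> (d \<omega>) (X \<omega>) + h * q \<omega>) \<le> (1 + C * h) * U \<omega> + b * (h * sqrt h)" for \<omega>
  proof -
    let ?f = "gap_weight \<alpha> (d \<omega>) (X \<omega>)"
    have "\<zeta> \<omega> * ?f + d \<omega> * q \<omega> \<le> C * U \<omega>"
    proof -
      have "d \<omega> * (gap_weight1 \<alpha> (d \<omega>) (X \<omega>) * g \<omega>) \<le> d \<omega> * ((\<alpha> * ?f) * K)"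
      proof (intro mult_left_mono)
        have "gap_weight1 \<alpha> (d \<omega>) (X \<omega>) * g \<omega> \<le> \<bar>gap_weight1 \<alpha> (d \<omega>) (X \<omega>)\<bar> * \<bar>g \<omega>\<bar>"
          by (metis abs_ge_self abs_mult)
        also have "\<dots> \<le> (\<alpha> * ?f) * K" using f1 gK \<alpha> f(1)[of \<omega> "X \<omega>"] by (intro mult_mono) auto
        finally show "gap_weight1 \<alpha> (d \<omega>) (X \<omega>) * g \<omega> \<le> (\<alpha> * ?f) * K" .
      qed (use d0[of \<omega>] in auto)
      moreover have "(if \<bar>cos (X \<omega>)\<bar> \<le> d \<omega> then \<kappa> else 0) * ?f + \<sigma>\<^sup>2 / 2 * (d \<omega> * gap_weight2 \<alpha> (d \<omega>) (X \<omega>))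
        \<le> (4 * \<kappa> + \<sigma>\<^sup>2 / 2 * (\<alpha>\<^sup>2 + \<alpha>)) * (d \<omega> * ?f)"
        by (rule gap_weight_drift[OF d0(1) \<alpha>(1) kL(1) par(3) \<alpha>(2)])
      moreover have "\<zeta> \<omega> * ?f + d \<omega> * q \<omega> = ((if \<bar>cos (X \<omega>)\<bar> \<le> d \<omega> then \<kappa> else 0) * ?f
          + \<sigma>\<^sup>2 / 2 * (d \<omega> * gap_weight2 \<alpha> (d \<omega>) (X \<omega>))) + L * (d \<omega> * ?f)
          + d \<omega> * (gap_weight1 \<alpha> (d \<omega>) (X \<omega>) * g \<omega>)"
        unfolding \<zeta>_def q_def by (simp only: ring_distribs mult_ac)
      moreover have "C * U \<omega> = (4 * \<kappa> + \<sigma>\<^sup>2 / 2 * (\<alpha>\<^sup>2 + \<alpha>)) * (d \<omega> * ?f) + L * (d \<omega> * ?f)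
          + d \<omega> * ((\<alpha> * ?f) * K)"
        unfolding C_def U_def by (simp only: ring_distribs mult_ac)
      ultimately show ?thesis by linarith
    qed
    then have 1: "h * (\<zeta> \<omega> * ?f + d \<omega> * q \<omega>) \<le> h * (C * U \<omega>)" using h by (intro mult_left_mono) auto
    have "\<zeta> \<omega> * q \<omega> \<le> \<zeta> \<omega> * (Q * K + \<sigma>\<^sup>2 / 2 * Q)"
      using \<zeta>(1)[of \<omega>] qle[of \<omega>] by (intro mult_left_mono) auto
    also have "\<dots> \<le> b" unfolding b_def using \<zeta>(2)[of \<omega>] Q0 K by (intro mult_right_mono) auto
    finally have "(h * h) * (\<zeta> \<omega> * q \<omega>) \<le> (h * h) * b" using h by (intro mult_left_mono) auto
    also have "\<dots> \<le> (h * sqrt h) * b" using hh b0 by (intro mult_right_mono)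
    finally have 2: "(h * h) * (\<zeta> \<omega> * q \<omega>) \<le> (h * sqrt h) * b" .
    have "d' \<omega> * (?f + h * q \<omega>) = U \<omega> + h * (\<zeta> \<omega> * ?f + d \<omega> * q \<omega>) + (h * h) * (\<zeta> \<omega> * q \<omega>)"
      unfolding d' U_def by (simp add: algebra_simps)
    then show ?thesis using 1 2 by (simp add: algebra_simps)
  qed
  have bd: "\<bar>d' \<omega> * (gap_weight \<alpha> (d \<omega>) (X \<omega>) + h * q \<omega>)\<bar> \<le> D * (1 + h * (Q * K + \<sigma>\<^sup>2 / 2 * Q))" for \<omega>
  proof -
    have "\<bar>h * q \<omega>\<bar> \<le> h * (Q * K + \<sigma>\<^sup>2 / 2 * Q)" using h qle by (simp add: abs_mult)
    then have "\<bar>gap_weight \<alpha> (d \<omega>) (X \<omega>) + h * q \<omega>\<bar> \<le> 1 + h * (Q * K + \<sigma>\<^sup>2 / 2 * Q)"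
      using f[of \<omega> "X \<omega>"] by linarith
    moreover have "\<bar>d' \<omega>\<bar> \<le> D" using d0[of \<omega>] by simp
    ultimately show ?thesis unfolding abs_mult using D0 by (intro mult_mono) auto
  qed
  have iq: "integrable M (\<lambda>\<omega>. d' \<omega> * (gap_weight \<alpha> (d \<omega>) (X \<omega>) + h * q \<omega>))"
    using bd by (intro integrable_const_bound[where B = "D * (1 + h * (Q * K + \<sigma>\<^sup>2 / 2 * Q))"] AE_I2)
      (auto simp: q_def)
  have "(\<integral>\<omega>. d' \<omega> * (gap_weight \<alpha> (d \<omega>) (X \<omega>) + h * q \<omega>) \<partial>M) \<le> (\<integral>\<omega>. (1 + C * h) * U \<omega> + b * (h * sqrt h) \<partial>M)"
    using pt iU by (intro integral_mono iq) auto
  also have "\<dots> = (1 + C * h) * (\<integral>\<omega>. U \<omega> \<partial>M) + b * (h * sqrt h)"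
    using iU by (simp add: prob_space)
  finally have fin: "(\<integral>\<omega>. d' \<omega> * gap_weight \<alpha> (d \<omega>) (X' \<omega>) \<partial>M) \<le> (1 + C * h) * (\<integral>\<omega>. U \<omega> \<partial>M)
    + (D * Q * (K * \<sigma> + K\<^sup>2 + 4 * K^3 + 8 * \<sigma>^3) + b) * (h * sqrt h)"
    using main unfolding q_def by (simp add: algebra_simps)
  have anti: "d' \<omega> * gap_weight \<alpha> (d' \<omega>) (X' \<omega>) \<le> d' \<omega> * gap_weight \<alpha> (d \<omega>) (X' \<omega>)" for \<omega>
  proof (intro mult_left_mono)
    have "smooth_cos (d \<omega>) (X' \<omega>) \<le> smooth_cos (d' \<omega>) (X' \<omega>)"
      unfolding smooth_cos_def using d0[of \<omega>] by (intro real_sqrt_le_mono add_left_mono power_mono) auto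
    then show "gap_weight \<alpha> (d' \<omega>) (X' \<omega>) \<le> gap_weight \<alpha> (d \<omega>) (X' \<omega>)"
      unfolding gap_weight_def using \<alpha>(1) by (simp add: mult_left_mono)
  qed (use d0[of \<omega>] in auto)
  have b1: "\<bar>d' \<omega> * gap_weight \<alpha> (d \<omega>) (X' \<omega>)\<bar> \<le> D" for \<omega>
  proof -
    have "d' \<omega> * gap_weight \<alpha> (d \<omega>) (X' \<omega>) \<le> D * 1"
      by (rule mult_mono) (use f[of \<omega> "X' \<omega>"] d0[of \<omega>] D0 in auto)
    then show ?thesis using f[of \<omega> "X' \<omega>"] d0[of \<omega>] by simp
  qed
  have b2: "\<bar>d' \<omega> * gap_weight \<alpha> (d' \<omega>) (X' \<omega>)\<bar> \<le> D" for \<omega>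
  proof -
    have "0 < d' \<omega> * gap_weight \<alpha> (d' \<omega>) (X' \<omega>)"
      using gap_weight_bounds(1)[OF d0(3) \<alpha>(1)] d0(3) by (intro mult_pos_pos) auto
    then show ?thesis using anti[of \<omega>] b1[of \<omega>] by linarith
  qed
  have "(\<integral>\<omega>. d' \<omega> * gap_weight \<alpha> (d' \<omega>) (X' \<omega>) \<partial>M) \<le> (\<integral>\<omega>. d' \<omega> * gap_weight \<alpha> (d \<omega>) (X' \<omega>) \<partial>M)"
    using anti b1 b2 by (intro integral_mono integrable_const_bound[where B = D] AE_I2) auto
  also note fin
  finally show ?thesis
    unfolding C_def b_def U_def d_def X_def d'_def X'_def .
qed

lemma chain_gap_le:
  assumes "0 \<le> \<kappa>" "0 \<le> L" "0 < \<eta>" "\<eta> \<le> 1" "0 \<le> h" "h * real n \<le> T"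
  shows "chain_gap \<kappa> L h \<eta> n \<omega> \<le> (1 + \<kappa> * T) * exp (L * T)"
proof -
  have "0 \<le> T" using assms(5,6) mult_nonneg_nonneg[of h "real n"] by linarith
  then have "(\<eta> + \<kappa> * (h * real n)) * exp (L * (h * real n)) \<le> (1 + \<kappa> * T) * exp (L * T)"
    using assms
    by (intro mult_mono add_mono mult_left_mono) (auto intro!: mult_left_mono add_nonneg_nonneg mult_nonneg_nonneg)
  then show ?thesis using gap_le[OF assms(1,2,5,3), of "\<lambda>j. snd (chain h j \<omega>)" n] by linarith
qed

lemma chain_gap_integrable:
  assumes "0 \<le> \<kappa>" "0 \<le> L" "0 < \<eta>" "\<eta> \<le> 1" "0 \<le> h"
  shows "integrable M (chain_gap \<kappa> L h \<eta> n)"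
proof (rule integrable_const_bound[where B = "(1 + \<kappa> * (h * real n)) * exp (L * (h * real n))"])
  show "chain_gap \<kappa> L h \<eta> n \<in> borel_measurable M"
    by (rule measurable_F_M[OF _ chain_gap_measurable(1)]) (use assms in auto)
qed (use chain_gap_le[OF assms order_refl] gap_pos[OF assms(1,2,5,3)] in \<open>auto intro!: AE_I2 simp: less_imp_le\<close>)

text \<open>The order of the quantifiers is the point: A is independent of \<eta>, whereas C
  contains the Taylor constants and may explode as \<eta> tends to 0. One can thus choose \<eta>
  small in terms of A and afterwards h so small that \<open>C * sqrt h\<close> is below
  \<eta>.\<close>

lemma gap_expectation:
  fixes \<kappa> L T :: real
  assumes kL: "0 \<le> \<kappa>" "0 \<le> L" and T: "0 \<le> T"
  shows "\<exists>A\<ge>0. \<forall>\<eta>. 0 < \<eta> \<and> \<eta> \<le> 1 \<longrightarrow> (\<exists>C\<ge>0. \<forall>h n. 0 < h \<and> h \<le> 1 \<and> h * real n \<le> T \<longrightarrow>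
    (\<integral>\<omega>. chain_gap \<kappa> L h \<eta> n \<omega> \<partial>M) \<le> A * (\<eta> + C * sqrt h))"
proof -
  define K where "K = (N - 1) * v / \<epsilon>"
  \<comment> \<open>The least value for which the kink outweighs the jump.\<close>
  define \<alpha> where "\<alpha> = 32 * \<kappa> / \<sigma>\<^sup>2"
  have \<alpha>: "0 \<le> \<alpha>" "32 * \<kappa> \<le> \<alpha> * \<sigma>\<^sup>2" unfolding \<alpha>_def using kL par by auto
  define D where "D = (1 + \<kappa> * T) * exp (L * T)"
  define C where "C = 4 * \<kappa> + \<sigma>\<^sup>2 / 2 * (\<alpha>\<^sup>2 + \<alpha>) + L + \<alpha> * K"
  define G where "G = exp (\<alpha> * sqrt (1 + D\<^sup>2))"
  have K: "0 \<le> K" unfolding K_def using par by simp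
  have D0: "0 \<le> D" unfolding D_def using kL T by simp
  have C0: "0 \<le> C" unfolding C_def using kL \<alpha> K by simp
  show ?thesis
  proof (rule exI[of _ "G * exp (C * T)"], intro conjI allI impI)
    fix \<eta> :: real assume \<eta>: "0 < \<eta> \<and> \<eta> \<le> 1"
    define Q where "Q = (\<alpha> + 13)^3 / \<eta>\<^sup>2"
    define b where "b = D * Q * (K * \<sigma> + K\<^sup>2 + 4 * K^3 + 8 * \<sigma>^3) + (\<kappa> + L * D) * (Q * K + \<sigma>\<^sup>2 / 2 * Q)"
    have Q0: "0 \<le> Q" unfolding Q_def using \<alpha> by simp
    have b0: "0 \<le> b" unfolding b_def using D0 Q0 K kL par by simp
    show "\<exists>C'\<ge>0. \<forall>h n. 0 < h \<and> h \<le> 1 \<and> h * real n \<le> T \<longrightarrow>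
      (\<integral>\<omega>. chain_gap \<kappa> L h \<eta> n \<omega> \<partial>M) \<le> G * exp (C * T) * (\<eta> + C' * sqrt h)"
    proof (intro exI[of _ "T * b"] conjI allI impI)
      fix h :: real and n :: nat assume h: "0 < h \<and> h \<le> 1 \<and> h * real n \<le> T"
      have hn: "h * real i \<le> T" if "i \<le> n" for i
        using h that by (meson mult_left_mono of_nat_le_iff order_trans less_imp_le)
      define d where "d = (\<lambda>i \<omega>. chain_gap \<kappa> L h \<eta> i \<omega>)"
      define U where "U = (\<lambda>i \<omega>. d i \<omega> * gap_weight \<alpha> (d i \<omega>) (snd (chain h i \<omega>)))"
      define m where "m = (\<lambda>i. \<integral>\<omega>. U i \<omega> \<partial>M)"
      have d: "0 < d i \<omega>" "\<eta> \<le> d i \<omega>" for i \<omega>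
        unfolding d_def using gap_pos gap_ge kL h \<eta> by auto
      have dD: "d i \<omega> \<le> D" if "i \<le> n" for i \<omega>
        unfolding d_def D_def using chain_gap_le[OF kL _ _ _ hn[OF that]] \<eta> h by auto
      have gw: "0 < gap_weight \<alpha> (d i \<omega>) y" "gap_weight \<alpha> (d i \<omega>) y \<le> 1" for i \<omega> y
        using gap_weight_bounds[OF d(1) \<alpha>(1)] by auto
      have step: "m (Suc i) \<le> (1 + C * h) * m i + b * (h * sqrt h)" if "i < n" for i
      proof -
        have "chain_gap \<kappa> L h \<eta> (Suc i) \<omega> \<le> D" for \<omega> using dD[of "Suc i"] that unfolding d_def by simp
        then show ?thesis
          unfolding m_def U_def d_def C_def b_def Q_def K_def
          by (intro gap_step_expectation kL \<alpha>) (use \<eta> h in auto)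
      qed
      have U: "0 \<le> U i \<omega>" "U i \<omega> \<le> d i \<omega>" for i \<omega>
      proof -
        show "0 \<le> U i \<omega>" unfolding U_def using d[of i \<omega>] gw(1)[of i \<omega>] by (simp add: less_imp_le)
        have "d i \<omega> * gap_weight \<alpha> (d i \<omega>) (snd (chain h i \<omega>)) \<le> d i \<omega> * 1"
          by (rule mult_left_mono) (use d[of i \<omega>] gw in auto)
        then show "U i \<omega> \<le> d i \<omega>" unfolding U_def by simp
      qed
      have id: "integrable M (d i)" for i
        unfolding d_def using chain_gap_integrable kL \<eta> h by auto
      have mU: "U i \<in> borel_measurable M" for i
      proof -
        have [measurable]: "(\<lambda>\<omega>. snd (chain h i \<omega>)) \<in> borel_measurable M" "d i \<in> borel_measurable M"
          using measurable_F_M[OF _ chain_measurable(2)] id h by auto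
        show ?thesis unfolding U_def by measurable
      qed
      have iU: "integrable M (U i)" for i
        by (rule Bochner_Integration.integrable_bound[OF id[of i] mU]) (use U d in \<open>auto intro!: AE_I2 simp: less_imp_le\<close>)
      have "m n \<le> (m 0 + real n * (b * (h * sqrt h))) * exp (C * (h * real n))"
      proof (rule discrete_gronwall[where m = m])
        show "m (Suc i) \<le> (1 + C * h) * m i + b * (h * sqrt h)" if "i < n" for i
          by (rule step[OF that])
        show "0 \<le> m 0" unfolding m_def by (rule integral_nonneg_AE) (use U in auto)
      qed (use C0 h b0 in auto)
      also have "\<dots> \<le> (\<eta> + T * b * sqrt h) * exp (C * T)"
      proof (rule mult_mono)
        have "m 0 \<le> (\<integral>\<omega>. \<eta> \<partial>M)"
          unfolding m_def using U(2)[of 0] by (intro integral_mono iU) (auto simp: d_def)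
        moreover have "(h * real n) * (b * sqrt h) \<le> T * (b * sqrt h)"
          using h b0 by (intro mult_right_mono) auto
        ultimately show "m 0 + real n * (b * (h * sqrt h)) \<le> \<eta> + T * b * sqrt h"
          by (simp add: mult_ac prob_space)
        show "exp (C * (h * real n)) \<le> exp (C * T)" using C0 h by (simp add: mult_left_mono)
      qed (use \<eta> T b0 h in auto)
      finally have mn: "m n \<le> (\<eta> + T * b * sqrt h) * exp (C * T)" .
      \<comment> \<open>The weight is removed again: the deterministic bound D keeps
        \<open>smooth_cos\<close> below \<open>sqrt (1 + D\<^sup>2)\<close>, hence the weight above
        1 / G.\<close>
      have "(\<integral>\<omega>. d n \<omega> \<partial>M) \<le> (\<integral>\<omega>. G * U n \<omega> \<partial>M)"
      proof (intro integral_mono id integrable_mult_right iU)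
        fix \<omega>
        have "(cos (snd (chain h n \<omega>)))\<^sup>2 + (d n \<omega>)\<^sup>2 \<le> 1 + D\<^sup>2"
          using dD[OF order_refl, of \<omega>] d(1)[of n \<omega>] by (intro add_mono power_mono) (auto simp: abs_square_le_1)
        then have "\<alpha> * smooth_cos (d n \<omega>) (snd (chain h n \<omega>)) \<le> \<alpha> * sqrt (1 + D\<^sup>2)"
          unfolding smooth_cos_def using \<alpha> by (intro mult_left_mono real_sqrt_le_mono)
        then have "1 \<le> G * gap_weight \<alpha> (d n \<omega>) (snd (chain h n \<omega>))"
          unfolding G_def gap_weight_def exp_add[symmetric] by simp
        then have "d n \<omega> * 1 \<le> d n \<omega> * (G * gap_weight \<alpha> (d n \<omega>) (snd (chain h n \<omega>)))"
          using d(1)[of n \<omega>] by (intro mult_left_mono) auto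
        then show "d n \<omega> \<le> G * U n \<omega>" unfolding U_def by (simp add: mult_ac)
      qed
      also have "\<dots> = G * m n" unfolding m_def by simp
      also have "\<dots> \<le> G * ((\<eta> + T * b * sqrt h) * exp (C * T))"
        using mn unfolding G_def by (intro mult_left_mono) auto
      finally show "(\<integral>\<omega>. chain_gap \<kappa> L h \<eta> n \<omega> \<partial>M) \<le> G * exp (C * T) * (\<eta> + T * b * sqrt h)"
        unfolding d_def by (simp add: mult_ac)
    qed (use T b0 in simp)
  qed (simp add: G_def)
qed

text \<open>The discrete Ito inequality for minus the square of \<open>cos\<close>. The drift points
  away from the walls, so it can only increase the square of \<open>cos\<close> and is dropped; the
  second-order term is the left-hand side. The weight \<psi> will be the indicator of the radius
  being above the cut-off.\<close>

lemma cos_sq_step_expectation: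
  fixes h :: real and \<psi> :: "'a \<Rightarrow> real"
  defines "K \<equiv> (N - 1) * v / \<epsilon>"
  assumes h: "0 < h" "h \<le> 1"
    and \<psi>: "\<psi> \<in> borel_measurable (F (h * real i))" "\<And>\<omega>. 0 \<le> \<psi> \<omega> \<and> \<psi> \<omega> \<le> 1"
  shows "\<sigma>\<^sup>2 * h * (\<integral>\<omega>. \<psi> \<omega> * (1 - 2 * (cos (snd (chain h i \<omega>)))\<^sup>2) \<partial>M)
    \<le> (\<integral>\<omega>. \<psi> \<omega> * ((cos (snd (chain h (Suc i) \<omega>)))\<^sup>2 - (cos (snd (chain h i \<omega>)))\<^sup>2) \<partial>M)
      + 8 * (K * \<sigma> + K\<^sup>2 + 4 * K^3 + 8 * \<sigma>^3) * (h * sqrt h)"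
proof -
  define X where "X = (\<lambda>\<omega>. snd (chain h i \<omega>))"
  define X' where "X' = (\<lambda>\<omega>. snd (chain h (Suc i) \<omega>))"
  define g where "g = (\<lambda>\<omega>. pn_mu2 v N (max (fst (chain h i \<omega>)) \<epsilon>) (X \<omega>))"
  let ?t = "h * real i"
  have t: "0 \<le> ?t" and h0: "0 \<le> h" using h by auto
  have gK: "\<bar>g \<omega>\<bar> \<le> K" for \<omega> unfolding g_def X_def K_def by (rule chain_drift_le)
  have X': "X' \<omega> = X \<omega> + (h * g \<omega> + \<sigma> * (B (?t + h) \<omega> - B ?t \<omega>))" for \<omega>
    unfolding X'_def X_def g_def by (rule chain_step(1)[OF h0])
  have mF: "X \<in> borel_measurable (F ?t)" unfolding X_def by (rule chain_measurable(2)[OF h0])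
  have gF: "g \<in> borel_measurable (F ?t)"
    unfolding g_def X_def using chain_measurable[OF h0, of i] by measurable
  have mX': "X' \<in> borel_measurable M"
    unfolding X'_def by (rule measurable_F_M[OF _ chain_measurable(2)[OF h0]]) (use h0 in simp)
  have mM: "X \<in> borel_measurable M" "\<psi> \<in> borel_measurable M" "g \<in> borel_measurable M"
    using mF gF \<psi>(1) measurable_F_M[OF t] by auto
  note [measurable] = mX' mM
  define f where "f = (\<lambda>x::real. - ((cos x)\<^sup>2))"
  define f1 where "f1 = (\<lambda>x::real. 2 * (sin x * cos x))"
  define f2 where "f2 = (\<lambda>x::real. 2 * ((cos x)\<^sup>2 - (sin x)\<^sup>2))"
  define f3 where "f3 = (\<lambda>x::real. - 8 * (sin x * cos x))"
  have sc: "\<bar>sin x * cos x\<bar> \<le> 1" for x :: real by (simp add: abs_mult mult_le_one)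
  have D: "(f has_real_derivative f1 x) (at x)" "(f1 has_real_derivative f2 x) (at x)"
    "(f2 has_real_derivative f3 x) (at x)" "\<bar>f3 x\<bar> \<le> 8" for x
    unfolding f_def f1_def f2_def f3_def using sc[of x]
    by (auto intro!: derivative_eq_intros simp: power2_eq_square abs_mult)
  have f2': "f2 x = 2 * (2 * (cos x)\<^sup>2 - 1)" for x
    unfolding f2_def by (simp add: sin_squared_eq)
  have main: "(\<integral>\<omega>. \<psi> \<omega> * f (X' \<omega>) \<partial>M)
    \<le> (\<integral>\<omega>. \<psi> \<omega> * (f (X \<omega>) + h * (f1 (X \<omega>) * g \<omega> + \<sigma>\<^sup>2 / 2 * f2 (X \<omega>))) \<partial>M)
    + 1 * 8 * (K * \<sigma> + K\<^sup>2 + 4 * K^3 + 8 * \<sigma>^3) * (h * sqrt h)"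
  proof (rule one_step[OF t h par(3) \<psi>(1)])
    show "(\<lambda>\<omega>. f (X \<omega>)) \<in> borel_measurable (F ?t)" "(\<lambda>\<omega>. f1 (X \<omega>)) \<in> borel_measurable (F ?t)"
      "(\<lambda>\<omega>. f2 (X \<omega>)) \<in> borel_measurable (F ?t)"
      unfolding f_def f1_def f2_def using mF by measurable
    show "(\<lambda>\<omega>. f (X' \<omega>)) \<in> borel_measurable M" unfolding f_def by measurable
    fix \<omega>
    have c: "0 \<le> (cos x)\<^sup>2 \<and> (cos x)\<^sup>2 \<le> 1" for x :: real by (simp add: abs_square_le_1)
    have "\<bar>f x\<bar> \<le> 8" "\<bar>f1 x\<bar> \<le> 8" "\<bar>f2 x\<bar> \<le> 8" for x
    proof -
      show "\<bar>f x\<bar> \<le> 8" using c[of x] unfolding f_def abs_le_iff by linarith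
      have "\<bar>f1 x\<bar> = 2 * \<bar>sin x * cos x\<bar>" by (simp add: f1_def abs_mult)
      then show "\<bar>f1 x\<bar> \<le> 8" using sc[of x] by linarith
      have "f2 x = 2 * cos (2 * x)" unfolding f2_def by (simp add: cos_double)
      then have "\<bar>f2 x\<bar> = 2 * \<bar>cos (2 * x)\<bar>" by (simp add: abs_mult)
      also have "\<dots> \<le> 2 * 4" by (rule mult_left_mono) (auto intro: order_trans[OF abs_cos_le_one])
      finally show "\<bar>f2 x\<bar> \<le> 8" by simp
    qed
    then show "0 \<le> \<psi> \<omega> \<and> \<psi> \<omega> \<le> 1 \<and> \<bar>f (X \<omega>)\<bar> \<le> 8 \<and> \<bar>f1 (X \<omega>)\<bar> \<le> 8 \<and> \<bar>f2 (X \<omega>)\<bar> \<le> 8 \<and>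
      \<bar>f (X' \<omega>)\<bar> \<le> 8 \<and> \<bar>g \<omega>\<bar> \<le> K" using \<psi>(2) gK by auto
    show "f (X' \<omega>) \<le> f (X \<omega>) + f1 (X \<omega>) * (h * g \<omega> + \<sigma> * (B (?t + h) \<omega> - B ?t \<omega>))
      + f2 (X \<omega>) * (h * g \<omega> + \<sigma> * (B (?t + h) \<omega> - B ?t \<omega>))\<^sup>2 / 2
      + 8 * \<bar>h * g \<omega> + \<sigma> * (B (?t + h) \<omega> - B ?t \<omega>)\<bar>^3"
      unfolding X' by (rule taylor2_bound[OF D])
  qed (use gF in auto)
  have drift: "f1 (X \<omega>) * g \<omega> \<le> 0" for \<omega>
  proof -
    have m: "0 < max (fst (chain h i \<omega>)) \<epsilon>" using par by auto
    have "f1 (X \<omega>) * g \<omega>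
        = - (2 * ((N - 1) * v) * ((sin (X \<omega>))\<^sup>2 * (wall_sgn (X \<omega>) * cos (X \<omega>))) / max (fst (chain h i \<omega>)) \<epsilon>)"
      unfolding f1_def g_def pn_mu2_eq by (simp add: power2_eq_square minus_divide_left algebra_simps)
    also have "wall_sgn (X \<omega>) * cos (X \<omega>) = \<bar>cos (X \<omega>)\<bar>" by (simp add: wall_sgn_def)
    also have "- (2 * ((N - 1) * v) * ((sin (X \<omega>))\<^sup>2 * \<bar>cos (X \<omega>)\<bar>) / max (fst (chain h i \<omega>)) \<epsilon>) \<le> 0"
      using m par by (simp add: divide_nonneg_pos)
    finally show ?thesis .
  qed
  have ib: "integrable M u" if "u \<in> borel_measurable M" "\<And>\<omega>. \<bar>u \<omega>\<bar> \<le> b" for u :: "'a \<Rightarrow> real" and b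
    using that by (intro integrable_const_bound[where B = b] AE_I2) auto
  have c1: "\<bar>\<psi> \<omega> * y\<bar> \<le> b" if "\<bar>y\<bar> \<le> b" for \<omega> y b
    using mult_mono[of "\<psi> \<omega>" 1 "\<bar>y\<bar>" b] \<psi>(2)[of \<omega>] that by (simp add: abs_mult)
  have cc: "0 \<le> (cos x)\<^sup>2" "(cos x)\<^sup>2 \<le> 1" for x :: real by (auto simp: abs_square_le_1)
  have cb: "\<bar>1 - 2 * (cos x)\<^sup>2\<bar> \<le> 1" for x :: real
  proof -
    have "1 - 2 * (cos x)\<^sup>2 = - cos (2 * x)" by (simp add: cos_double_cos)
    then show ?thesis by simp
  qed
  have i1: "integrable M (\<lambda>\<omega>. \<psi> \<omega> * (cos (X \<omega>))\<^sup>2)" "integrable M (\<lambda>\<omega>. \<psi> \<omega> * (cos (X' \<omega>))\<^sup>2)"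
    "integrable M \<psi>"
    using cc \<psi>(2) by (auto intro!: ib[of _ 1] c1)
  have i2: "integrable M (\<lambda>\<omega>. \<psi> \<omega> * (f (X \<omega>) + h * (f1 (X \<omega>) * g \<omega> + \<sigma>\<^sup>2 / 2 * f2 (X \<omega>))))"
  proof (rule ib[of _ "1 + h * (2 * K + \<sigma>\<^sup>2)"])
    show "(\<lambda>\<omega>. \<psi> \<omega> * (f (X \<omega>) + h * (f1 (X \<omega>) * g \<omega> + \<sigma>\<^sup>2 / 2 * f2 (X \<omega>)))) \<in> borel_measurable M"
      unfolding f_def f1_def f2_def by measurable
    fix \<omega>
    have "\<bar>f1 (X \<omega>) * g \<omega>\<bar> \<le> 2 * K" unfolding abs_mult
      using sc[of "X \<omega>"] gK[of \<omega>] by (intro mult_mono) (auto simp: f1_def abs_mult)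
    moreover have "\<bar>\<sigma>\<^sup>2 / 2 * f2 (X \<omega>)\<bar> \<le> \<sigma>\<^sup>2 / 2 * 2"
    proof -
      have "f2 (X \<omega>) = - 2 * (1 - 2 * (cos (X \<omega>))\<^sup>2)" unfolding f2' by simp
      then have "\<bar>f2 (X \<omega>)\<bar> = 2 * \<bar>1 - 2 * (cos (X \<omega>))\<^sup>2\<bar>" by (simp only: abs_mult)
      also have "\<dots> \<le> 2 * 1" by (rule mult_left_mono[OF cb]) simp
      finally have "\<bar>f2 (X \<omega>)\<bar> \<le> 2" by simp
      then show ?thesis unfolding abs_mult by (intro mult_mono) auto
    qed
    ultimately have "\<bar>f1 (X \<omega>) * g \<omega> + \<sigma>\<^sup>2 / 2 * f2 (X \<omega>)\<bar> \<le> 2 * K + \<sigma>\<^sup>2" by (simp add: abs_le_iff)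
    then have "\<bar>h * (f1 (X \<omega>) * g \<omega> + \<sigma>\<^sup>2 / 2 * f2 (X \<omega>))\<bar> \<le> h * (2 * K + \<sigma>\<^sup>2)"
      using h by (simp add: abs_mult mult_left_mono)
    moreover have "\<bar>f (X \<omega>)\<bar> \<le> 1" unfolding f_def using cc[of "X \<omega>"] by simp
    ultimately show "\<bar>\<psi> \<omega> * (f (X \<omega>) + h * (f1 (X \<omega>) * g \<omega> + \<sigma>\<^sup>2 / 2 * f2 (X \<omega>)))\<bar> \<le> 1 + h * (2 * K + \<sigma>\<^sup>2)"
      by (intro c1) linarith
  qed
  have i3: "integrable M (\<lambda>\<omega>. \<psi> \<omega> * (1 - 2 * (cos (X \<omega>))\<^sup>2))"
    using cb by (intro ib[of _ 1] c1) auto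
  have "(\<integral>\<omega>. \<psi> \<omega> * (f (X \<omega>) + h * (f1 (X \<omega>) * g \<omega> + \<sigma>\<^sup>2 / 2 * f2 (X \<omega>))) \<partial>M)
    \<le> (\<integral>\<omega>. - (\<psi> \<omega> * (cos (X \<omega>))\<^sup>2) - \<sigma>\<^sup>2 * h * (\<psi> \<omega> * (1 - 2 * (cos (X \<omega>))\<^sup>2)) \<partial>M)"
  proof (intro integral_mono i2)
    fix \<omega>
    have "f (X \<omega>) + h * (f1 (X \<omega>) * g \<omega> + \<sigma>\<^sup>2 / 2 * f2 (X \<omega>)) \<le> f (X \<omega>) + h * (0 + \<sigma>\<^sup>2 / 2 * f2 (X \<omega>))"
      using h drift[of \<omega>] by (intro add_left_mono mult_left_mono add_right_mono) auto
    then have "\<psi> \<omega> * (f (X \<omega>) + h * (f1 (X \<omega>) * g \<omega> + \<sigma>\<^sup>2 / 2 * f2 (X \<omega>)))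
       \<le> \<psi> \<omega> * (f (X \<omega>) + h * (0 + \<sigma>\<^sup>2 / 2 * f2 (X \<omega>)))"
      using \<psi>(2) by (intro mult_left_mono) auto
    also have "\<dots> = - (\<psi> \<omega> * (cos (X \<omega>))\<^sup>2) - \<sigma>\<^sup>2 * h * (\<psi> \<omega> * (1 - 2 * (cos (X \<omega>))\<^sup>2))"
      unfolding f_def f2' by (simp add: algebra_simps)
    finally show "\<psi> \<omega> * (f (X \<omega>) + h * (f1 (X \<omega>) * g \<omega> + \<sigma>\<^sup>2 / 2 * f2 (X \<omega>)))
      \<le> - (\<psi> \<omega> * (cos (X \<omega>))\<^sup>2) - \<sigma>\<^sup>2 * h * (\<psi> \<omega> * (1 - 2 * (cos (X \<omega>))\<^sup>2))" .
  qed (use i1 i3 in auto)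
  also have "\<dots> = - (\<integral>\<omega>. \<psi> \<omega> * (cos (X \<omega>))\<^sup>2 \<partial>M) - \<sigma>\<^sup>2 * h * (\<integral>\<omega>. \<psi> \<omega> * (1 - 2 * (cos (X \<omega>))\<^sup>2) \<partial>M)"
  proof -
    have "integrable M (\<lambda>\<omega>. - (\<psi> \<omega> * (cos (X \<omega>))\<^sup>2))" using i1 by simp
    from Bochner_Integration.integral_diff[OF this integrable_mult_right[OF i3, of "\<sigma>\<^sup>2 * h"]]
    show ?thesis by (simp only: integral_minus integral_mult_right_zero)
  qed
  finally have "(\<integral>\<omega>. \<psi> \<omega> * f (X' \<omega>) \<partial>M) \<le> - (\<integral>\<omega>. \<psi> \<omega> * (cos (X \<omega>))\<^sup>2 \<partial>M)
    - \<sigma>\<^sup>2 * h * (\<integral>\<omega>. \<psi> \<omega> * (1 - 2 * (cos (X \<omega>))\<^sup>2) \<partial>M)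
    + 8 * (K * \<sigma> + K\<^sup>2 + 4 * K^3 + 8 * \<sigma>^3) * (h * sqrt h)"
    using main by simp
  moreover have "(\<integral>\<omega>. \<psi> \<omega> * f (X' \<omega>) \<partial>M) = - (\<integral>\<omega>. \<psi> \<omega> * (cos (X' \<omega>))\<^sup>2 \<partial>M)"
    unfolding f_def by simp
  moreover have "(\<integral>\<omega>. \<psi> \<omega> * ((cos (X' \<omega>))\<^sup>2 - (cos (X \<omega>))\<^sup>2) \<partial>M)
    = (\<integral>\<omega>. \<psi> \<omega> * (cos (X' \<omega>))\<^sup>2 \<partial>M) - (\<integral>\<omega>. \<psi> \<omega> * (cos (X \<omega>))\<^sup>2 \<partial>M)"
    unfolding right_diff_distrib using i1 by (intro Bochner_Integration.integral_diff) auto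
  ultimately show ?thesis unfolding X_def X'_def by linarith
qed

text \<open>As long as the radius exceeds the cut-off, the accumulated \<open>1 - 2 * cos\<^sup>2\<close> is bounded through the Ito
  expansion of \<open>cos\<^sup>2\<close>, and the accumulated \<open>cos\<^sup>2 \<le> \<bar>cos\<bar>\<close> through the total decrease of the radius.\<close>

lemma chain_far_probability:
  assumes h: "0 < h" "h \<le> 1" and r: "0 \<le> r"
  defines "K \<equiv> (N - 1) * v / \<epsilon>"
  shows "\<sigma>\<^sup>2 * (h * real n) * prob {\<omega>\<in>space M. \<epsilon> < fst (chain h n \<omega>)}
    \<le> 1 + real n * (8 * (K * \<sigma> + K\<^sup>2 + 4 * K^3 + 8 * \<sigma>^3) * (h * sqrt h)) + 2 * \<sigma>\<^sup>2 * ((r + v) / v)"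
proof -
  define X where "X = (\<lambda>i \<omega>. snd (chain h i \<omega>))"
  define R where "R = (\<lambda>i \<omega>. fst (chain h i \<omega>))"
  define \<psi> where "\<psi> = (\<lambda>i \<omega>. if \<epsilon> < R i \<omega> then 1 else 0 :: real)"
  define E where "E = 8 * (K * \<sigma> + K\<^sup>2 + 4 * K^3 + 8 * \<sigma>^3) * (h * sqrt h)"
  have h0: "0 \<le> h" using h by simp
  have RS: "R (Suc i) \<omega> = R i \<omega> - h * (v * \<bar>cos (X i \<omega>)\<bar>)" for i \<omega>
    unfolding R_def X_def chain_step(2)[OF h0] pn_mu1_eq by simp
  have vc: "0 \<le> v * \<bar>cos (X i \<omega>)\<bar>" "v * \<bar>cos (X i \<omega>)\<bar> \<le> v" for i \<omega>
    using par mult_left_mono[OF abs_cos_le_one, of v "X i \<omega>"] by auto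
  have Rdec: "R (Suc i) \<omega> \<le> R i \<omega>" for i \<omega> unfolding RS using vc[of i \<omega>] h by simp
  have hv: "h * (v * \<bar>cos (X i \<omega>)\<bar>) \<le> v" for i \<omega>
    using mult_mono[OF h(2) vc(2), of i \<omega>] vc[of i \<omega>] par by simp
  have \<psi>: "0 \<le> \<psi> i \<omega> \<and> \<psi> i \<omega> \<le> 1" "\<psi> (Suc i) \<omega> \<le> \<psi> i \<omega>" for i \<omega>
    unfolding \<psi>_def using Rdec[of i \<omega>] by auto
  have \<psi>anti: "\<psi> n \<omega> \<le> \<psi> i \<omega>" if "i \<le> n" for i \<omega>
    using lift_Suc_antimono_le[of "\<lambda>i. \<psi> i \<omega>", OF \<psi>(2) that] .
  have cc: "0 \<le> (cos x)\<^sup>2" "(cos x)\<^sup>2 \<le> 1" for x :: real by (auto simp: abs_square_le_1)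
  have cb: "\<bar>1 - 2 * (cos x)\<^sup>2\<bar> \<le> 1" for x :: real
  proof -
    have "1 - 2 * (cos x)\<^sup>2 = - cos (2 * x)" by (simp add: cos_double_cos)
    then show ?thesis by simp
  qed
  have cd: "\<bar>(cos x)\<^sup>2 - (cos y)\<^sup>2\<bar> \<le> 1" for x y :: real
    using cc(1)[of x] cc(2)[of x] cc(1)[of y] cc(2)[of y] by linarith
  \<comment> \<open>Summation by parts with a decreasing \<psi>. The extra boundary term,
    non-negative because the square of \<open>cos\<close> is at most 1, is what lets the induction
    pass.\<close>
  have S1: "(\<Sum>i<k. \<psi> i \<omega> * ((cos (X (Suc i) \<omega>))\<^sup>2 - (cos (X i \<omega>))\<^sup>2)) + \<psi> k \<omega> * (1 - (cos (X k \<omega>))\<^sup>2) \<le> 1" for k \<omega>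
  proof (induction k)
    case 0
    have "\<psi> 0 \<omega> * (1 - (cos (X 0 \<omega>))\<^sup>2) \<le> 1 * 1" using \<psi>(1)[of 0 \<omega>] cc by (intro mult_mono) auto
    then show ?case by simp
  next
    case (Suc k)
    have "\<psi> (Suc k) \<omega> * (1 - (cos (X (Suc k) \<omega>))\<^sup>2) \<le> \<psi> k \<omega> * (1 - (cos (X (Suc k) \<omega>))\<^sup>2)"
      using \<psi>(2)[of k \<omega>] cc by (intro mult_right_mono) auto
    then show ?case using Suc.IH by (simp add: algebra_simps)
  qed
  \<comment> \<open>The added v keeps the boundary term non-negative: in the step that carries the
    radius below the cut-off it may become negative, but by at most v because h \<le> 1.\<close>
  have S2: "(\<Sum>i<k. \<psi> i \<omega> * (h * (v * \<bar>cos (X i \<omega>)\<bar>))) + \<psi> k \<omega> * (R k \<omega> + v) \<le> r + v" for k \<omega>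
  proof (induction k)
    case 0
    have "R 0 \<omega> = r" unfolding R_def by simp
    then show ?case using \<psi>(1)[of 0 \<omega>] r par mult_right_mono[of "\<psi> 0 \<omega>" 1 "r + v"] by auto
  next
    case (Suc k)
    have "\<psi> (Suc k) \<omega> * (R (Suc k) \<omega> + v) \<le> \<psi> k \<omega> * (R (Suc k) \<omega> + v)"
    proof (cases "\<psi> k \<omega> = 0")
      case True then show ?thesis using \<psi>(1)[of "Suc k" \<omega>] \<psi>(2)[of k \<omega>] by auto
    next
      case False
      then have "0 < R k \<omega>" unfolding \<psi>_def using par by (auto split: if_splits)
      then have "0 \<le> R (Suc k) \<omega> + v" unfolding RS using hv[of k \<omega>] by linarith
      then show ?thesis using \<psi>(2)[of k \<omega>] by (intro mult_right_mono) auto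
    qed
    then show ?case using Suc.IH unfolding RS by (simp add: algebra_simps)
  qed
  \<comment> \<open>Write 1 as 1 - 2 * \<open>(cos x)\<^sup>2\<close> plus 2 *
    \<open>(cos x)\<^sup>2\<close>. The second part is at most twice \<bar>cos x\<bar>, which is
    paid for by the loss of radius in that step.\<close>
  have pt: "\<sigma>\<^sup>2 * (\<Sum>i<n. h * \<psi> i \<omega>) \<le> \<sigma>\<^sup>2 * h * (\<Sum>i<n. \<psi> i \<omega> * (1 - 2 * (cos (X i \<omega>))\<^sup>2)) + 2 * \<sigma>\<^sup>2 * ((r + v) / v)" for \<omega>
  proof -
    have "(\<Sum>i<n. h * (\<psi> i \<omega> * (cos (X i \<omega>))\<^sup>2)) \<le> (\<Sum>i<n. \<psi> i \<omega> * (h * (v * \<bar>cos (X i \<omega>)\<bar>)) / v)"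
    proof (rule sum_mono)
      fix i
      have "(cos (X i \<omega>))\<^sup>2 \<le> \<bar>cos (X i \<omega>)\<bar>"
      proof -
        have "\<bar>cos (X i \<omega>)\<bar> * \<bar>cos (X i \<omega>)\<bar> \<le> 1 * \<bar>cos (X i \<omega>)\<bar>" by (rule mult_right_mono) auto
        then show ?thesis by (simp add: power2_eq_square)
      qed
      then have "h * (\<psi> i \<omega> * (cos (X i \<omega>))\<^sup>2) \<le> h * (\<psi> i \<omega> * \<bar>cos (X i \<omega>)\<bar>)"
        using h \<psi>(1)[of i \<omega>] by (intro mult_left_mono) auto
      also have "\<dots> = \<psi> i \<omega> * (h * (v * \<bar>cos (X i \<omega>)\<bar>)) / v" using par by simp
      finally show "h * (\<psi> i \<omega> * (cos (X i \<omega>))\<^sup>2) \<le> \<psi> i \<omega> * (h * (v * \<bar>cos (X i \<omega>)\<bar>)) / v" .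
    qed
    also have "\<dots> = (\<Sum>i<n. \<psi> i \<omega> * (h * (v * \<bar>cos (X i \<omega>)\<bar>))) / v" by (simp add: sum_divide_distrib)
    also have "\<dots> \<le> (r + v) / v"
    proof (intro divide_right_mono)
      have "0 \<le> \<psi> n \<omega> * (R n \<omega> + v)" unfolding \<psi>_def using par by auto
      then show "(\<Sum>i<n. \<psi> i \<omega> * (h * (v * \<bar>cos (X i \<omega>)\<bar>))) \<le> r + v" using S2[of \<omega> n] by linarith
    qed (use par in auto)
    finally have "\<sigma>\<^sup>2 * (\<Sum>i<n. h * (\<psi> i \<omega> * (cos (X i \<omega>))\<^sup>2)) \<le> \<sigma>\<^sup>2 * ((r + v) / v)"
      by (intro mult_left_mono) auto
    moreover have "\<sigma>\<^sup>2 * (\<Sum>i<n. h * \<psi> i \<omega>) = \<sigma>\<^sup>2 * h * (\<Sum>i<n. \<psi> i \<omega> * (1 - 2 * (cos (X i \<omega>))\<^sup>2))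
      + 2 * (\<sigma>\<^sup>2 * (\<Sum>i<n. h * (\<psi> i \<omega> * (cos (X i \<omega>))\<^sup>2)))"
      by (simp add: sum_distrib_left sum.distrib[symmetric] algebra_simps)
    ultimately show ?thesis by linarith
  qed
  have mF: "X i \<in> borel_measurable (F (h * real i))" "R i \<in> borel_measurable (F (h * real i))" for i
    unfolding X_def R_def using chain_measurable[OF h0] by auto
  have \<psi>F: "\<psi> i \<in> borel_measurable (F (h * real i))" for i
    unfolding \<psi>_def using mF(2)[of i] by measurable
  have mM: "X i \<in> borel_measurable M" "R i \<in> borel_measurable M" "\<psi> i \<in> borel_measurable M" for i
    using mF \<psi>F h0 by (auto intro!: measurable_F_M[of "h * real i"])
  note [measurable] = mM
  have ib: "integrable M u" if "u \<in> borel_measurable M" "\<And>\<omega>. \<bar>u \<omega>\<bar> \<le> b" for u :: "'a \<Rightarrow> real" and b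
    using that by (intro integrable_const_bound[where B = b] AE_I2) auto
  have c1: "\<bar>\<psi> i \<omega> * y\<bar> \<le> b" if "\<bar>y\<bar> \<le> b" for i \<omega> y b
    using mult_mono[of "\<psi> i \<omega>" 1 "\<bar>y\<bar>" b] \<psi>(1)[of i \<omega>] that by (simp add: abs_mult)
  have i\<psi>: "integrable M (\<psi> i)" for i using \<psi>(1) by (intro ib[of _ 1]) auto
  have ia: "integrable M (\<lambda>\<omega>. \<psi> i \<omega> * (1 - 2 * (cos (X i \<omega>))\<^sup>2))" for i
    using cb by (intro ib[of _ 1] c1) auto
  have ibb: "integrable M (\<lambda>\<omega>. \<psi> i \<omega> * ((cos (X (Suc i) \<omega>))\<^sup>2 - (cos (X i \<omega>))\<^sup>2))" for i
    using cd by (intro ib[of _ 1] c1) auto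
  have step: "\<sigma>\<^sup>2 * h * (\<integral>\<omega>. \<psi> i \<omega> * (1 - 2 * (cos (X i \<omega>))\<^sup>2) \<partial>M)
    \<le> (\<integral>\<omega>. \<psi> i \<omega> * ((cos (X (Suc i) \<omega>))\<^sup>2 - (cos (X i \<omega>))\<^sup>2) \<partial>M) + E" for i
    unfolding E_def K_def X_def by (rule cos_sq_step_expectation[OF h \<psi>F \<psi>(1)])
  have "\<sigma>\<^sup>2 * (\<Sum>i<n. h * (\<integral>\<omega>. \<psi> i \<omega> \<partial>M)) = (\<integral>\<omega>. \<sigma>\<^sup>2 * (\<Sum>i<n. h * \<psi> i \<omega>) \<partial>M)"
    using i\<psi> by simp
  also have "\<dots> \<le> (\<integral>\<omega>. \<sigma>\<^sup>2 * h * (\<Sum>i<n. \<psi> i \<omega> * (1 - 2 * (cos (X i \<omega>))\<^sup>2)) + 2 * \<sigma>\<^sup>2 * ((r + v) / v) \<partial>M)"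
    using i\<psi> ia pt by (intro integral_mono) auto
  also have "\<dots> = \<sigma>\<^sup>2 * h * (\<Sum>i<n. \<integral>\<omega>. \<psi> i \<omega> * (1 - 2 * (cos (X i \<omega>))\<^sup>2) \<partial>M) + 2 * \<sigma>\<^sup>2 * ((r + v) / v)"
    using ia by (simp add: prob_space Bochner_Integration.integral_sum del: right_diff_distrib)
  also have "\<sigma>\<^sup>2 * h * (\<Sum>i<n. \<integral>\<omega>. \<psi> i \<omega> * (1 - 2 * (cos (X i \<omega>))\<^sup>2) \<partial>M)
    \<le> (\<Sum>i<n. (\<integral>\<omega>. \<psi> i \<omega> * ((cos (X (Suc i) \<omega>))\<^sup>2 - (cos (X i \<omega>))\<^sup>2) \<partial>M) + E)"
    unfolding sum_distrib_left by (intro sum_mono step)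
  also have "\<dots> = (\<integral>\<omega>. (\<Sum>i<n. \<psi> i \<omega> * ((cos (X (Suc i) \<omega>))\<^sup>2 - (cos (X i \<omega>))\<^sup>2)) \<partial>M) + real n * E"
    using ibb by (simp add: sum.distrib Bochner_Integration.integral_sum del: right_diff_distrib)
  also have "(\<integral>\<omega>. (\<Sum>i<n. \<psi> i \<omega> * ((cos (X (Suc i) \<omega>))\<^sup>2 - (cos (X i \<omega>))\<^sup>2)) \<partial>M) \<le> (\<integral>\<omega>. 1 \<partial>M)"
  proof (intro integral_mono Bochner_Integration.integrable_sum ibb)
    fix \<omega>
    have "0 \<le> \<psi> n \<omega> * (1 - (cos (X n \<omega>))\<^sup>2)" using \<psi>(1)[of n \<omega>] cc by (intro mult_nonneg_nonneg) auto
    then show "(\<Sum>i<n. \<psi> i \<omega> * ((cos (X (Suc i) \<omega>))\<^sup>2 - (cos (X i \<omega>))\<^sup>2)) \<le> 1" using S1[of \<omega> n] by linarith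
  qed auto
  finally have fin: "\<sigma>\<^sup>2 * (\<Sum>i<n. h * (\<integral>\<omega>. \<psi> i \<omega> \<partial>M)) \<le> 1 + real n * E + 2 * \<sigma>\<^sup>2 * ((r + v) / v)"
    by (simp add: prob_space)
  have "(\<integral>\<omega>. \<psi> n \<omega> \<partial>M) = prob {\<omega>\<in>space M. \<epsilon> < R n \<omega>}"
  proof -
    have "(\<integral>\<omega>. \<psi> n \<omega> \<partial>M) = (\<integral>\<omega>. indicator {\<omega>\<in>space M. \<epsilon> < R n \<omega>} \<omega> \<partial>M)"
      by (intro Bochner_Integration.integral_cong) (auto simp: \<psi>_def indicator_def)
    then show ?thesis by simp
  qed
  moreover have "h * real n * (\<integral>\<omega>. \<psi> n \<omega> \<partial>M) \<le> (\<Sum>i<n. h * (\<integral>\<omega>. \<psi> i \<omega> \<partial>M))"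
  proof -
    have "(\<Sum>i<n. h * (\<integral>\<omega>. \<psi> n \<omega> \<partial>M)) \<le> (\<Sum>i<n. h * (\<integral>\<omega>. \<psi> i \<omega> \<partial>M))"
      using h \<psi>anti by (intro sum_mono mult_left_mono integral_mono i\<psi>) auto
    then show ?thesis by (simp add: mult_ac)
  qed
  then have "\<sigma>\<^sup>2 * (h * real n * (\<integral>\<omega>. \<psi> n \<omega> \<partial>M)) \<le> \<sigma>\<^sup>2 * (\<Sum>i<n. h * (\<integral>\<omega>. \<psi> i \<omega> \<partial>M))"
    by (intro mult_left_mono) auto
  ultimately show ?thesis using fin unfolding E_def R_def by (simp add: mult.assoc)
qed

end

end

section \<open>Levels of approximation\<close>

definition level_eps :: "nat \<Rightarrow> real" where
  "level_eps k = 1 / real (Suc k)"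

definition level_K :: "real \<Rightarrow> real \<Rightarrow> nat \<Rightarrow> real" where
  "level_K v N k = (N - 1) * v / level_eps k"

text \<open>The sum of the Lipschitz constants above the cut-off: \<open>level_K\<close> for the
  angle in the angular drift, \<open>level_K / level_eps\<close> for the radius in the angular
  drift, and v for the angle in the radial drift.\<close>

definition level_L :: "real \<Rightarrow> real \<Rightarrow> nat \<Rightarrow> real" where
  "level_L v N k = level_K v N k + level_K v N k / level_eps k + v"

text \<open>Dyadic, so that the grids of different levels are nested and a finer scheme can be
  compared with a coarser one at the grid points of the latter.\<close>

definition mesh :: "nat \<Rightarrow> real" where
  "mesh p = 1 / 2^p"

definition level_end :: "nat \<Rightarrow> nat \<Rightarrow> nat" where
  "level_end k p = Suc k * 2^p"

definition level_euler :: "real \<Rightarrow> real \<Rightarrow> real \<Rightarrow> real \<Rightarrow> nat \<Rightarrow> nat \<Rightarrow> (real \<Rightarrow> real) \<Rightarrow> nat \<Rightarrow> real \<times> real" where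
  "level_euler v N r \<theta> k p w = euler v N (level_eps k) (mesh p) w r \<theta>"

definition level_gap :: "real \<Rightarrow> real \<Rightarrow> real \<Rightarrow> real \<Rightarrow> nat \<Rightarrow> nat \<Rightarrow> real \<Rightarrow> (real \<Rightarrow> real) \<Rightarrow> nat \<Rightarrow> real" where
  "level_gap v N r \<theta> k p \<eta> w = gap (2 * level_K v N k) (level_L v N k) (mesh p) \<eta>
     (\<lambda>j. snd (level_euler v N r \<theta> k p w j))"

text \<open>The noise w already contains the factor \<sigma>. Its allowance \<eta> / 4 over one mesh
  is one share of the slack \<eta> with which the gap starts; the two drifts take a share each.
  Since the gap is nondecreasing, a bound at the last index covers all times up to k + 1.\<close>

definition good_level :: "real \<Rightarrow> real \<Rightarrow> real \<Rightarrow> real \<Rightarrow> nat \<Rightarrow> nat \<Rightarrow> real \<Rightarrow> (real \<Rightarrow> real) \<Rightarrow> bool" where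
  "good_level v N r \<theta> k p \<eta> w \<longleftrightarrow>
     (\<forall>s\<in>{0..real (Suc k)}. \<forall>t\<in>{0..real (Suc k)}. \<bar>s - t\<bar> \<le> mesh p \<longrightarrow> \<bar>w s - w t\<bar> \<le> \<eta> / 4) \<and>
     level_gap v N r \<theta> k p \<eta> w (level_end k p) \<le> (1 / 2)^k"

lemma level_eps_pos: "0 < level_eps k" and level_eps_le_1: "level_eps k \<le> 1"
  by (simp_all add: level_eps_def)

lemma mesh_pos: "0 < mesh p" and mesh_le_1: "mesh p \<le> 1"
  by (simp_all add: mesh_def)

lemma mesh_antimono: "p \<le> q \<Longrightarrow> mesh q \<le> mesh p"
  by (simp add: mesh_def frac_le)

lemma mesh_tendsto_0: "mesh \<longlonglongrightarrow> 0"
proof -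
  have "mesh = (\<lambda>p. (1 / 2)^p)" by (simp add: mesh_def fun_eq_iff power_one_over)
  then show ?thesis using LIMSEQ_realpow_zero[of "1 / 2 :: real"] by simp
qed

lemma mesh_mult_level_end: "mesh p * real (level_end k p) = real (Suc k)"
  by (simp add: mesh_def level_end_def field_simps)

lemma level_K_nonneg: "0 \<le> v \<Longrightarrow> 1 \<le> N \<Longrightarrow> 0 \<le> level_K v N k"
  using level_eps_pos[of k] by (simp add: level_K_def)

lemma level_L_nonneg: "0 \<le> v \<Longrightarrow> 1 \<le> N \<Longrightarrow> 0 \<le> level_L v N k"
  using level_eps_pos[of k] level_K_nonneg[of v N k] by (simp add: level_L_def)

text \<open>Approximation from below keeps the rationals inside the interval {0..T} whenever s is
  inside it, including the endpoint.\<close>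

lemma rational_approximation_below:
  fixes s :: real
  assumes "0 \<le> s"
  obtains f :: "nat \<Rightarrow> real" where "\<And>n. f n \<in> \<rat>" "\<And>n. 0 \<le> f n" "\<And>n. f n \<le> s" "f \<longlonglongrightarrow> s"
proof
  define f where "f = (\<lambda>n. real_of_int \<lfloor>s * real (Suc n)\<rfloor> / real (Suc n))"
  show "f n \<in> \<rat>" for n unfolding f_def by (intro Rats_divide) auto
  show "0 \<le> f n" for n unfolding f_def using assms by simp
  show le: "f n \<le> s" for n unfolding f_def by (simp add: divide_le_eq)
  have ge: "s - 1 / real (Suc n) \<le> f n" for n
  proof -
    have "s * real (Suc n) - 1 \<le> real_of_int \<lfloor>s * real (Suc n)\<rfloor>" by linarith
    then have "(s * real (Suc n) - 1) / real (Suc n) \<le> f n"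
      unfolding f_def by (rule divide_right_mono) simp
    then show ?thesis by (simp add: diff_divide_distrib)
  qed
  have "(\<lambda>n. s - 1 / real (Suc n)) \<longlonglongrightarrow> s - 0"
    by (intro tendsto_intros LIMSEQ_Suc lim_1_over_n)
  then have "(\<lambda>n. s - 1 / real (Suc n)) \<longlonglongrightarrow> s" by simp
  then show "f \<longlonglongrightarrow> s"
    by (rule tendsto_sandwich[OF _ _ _ tendsto_const, rotated 2]) (use le ge in auto)
qed

section \<open>The modulus of continuity of the noise as a measurable event\<close>

context standard_brownian_motion
begin

text \<open>Rational times make the union countable and hence measurable. The factor 2 leaves room
  for rationals that approximate two arbitrary times at distance at most one mesh.\<close>

definition rough_set :: "nat \<Rightarrow> real \<Rightarrow> real \<Rightarrow> 'a set" where
  "rough_set p T c = (\<Union>s\<in>\<rat> \<inter> {0..T}. \<Union>t\<in>\<rat> \<inter> {0..T}.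
     {\<omega>\<in>space M. \<bar>s - t\<bar> \<le> 2 * mesh p \<and> c < \<bar>B s \<omega> - B t \<omega>\<bar>})"

lemma rough_set_measurable: "rough_set p T c \<in> sets M"
  unfolding rough_set_def
proof (intro sets.countable_UN'')
  fix s t assume "s \<in> \<rat> \<inter> {0..T}" "t \<in> \<rat> \<inter> {0..T}"
  then have [measurable]: "B s \<in> borel_measurable M" "B t \<in> borel_measurable M"
    by (auto intro!: B_borel_measurable)
  show "{\<omega>\<in>space M. \<bar>s - t\<bar> \<le> 2 * mesh p \<and> c < \<bar>B s \<omega> - B t \<omega>\<bar>} \<in> sets M" by measurable
qed (auto intro: countable_rat countable_Int1)

text \<open>The sets decrease in p, and a continuous path, being uniformly continuous on {0..T},
  lies in only finitely many of them. Continuity of the measure from above gives the limit without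
  any rate, which suffices since p is free.\<close>

lemma rough_set_prob_tendsto_0:
  assumes "0 < c"
  shows "(\<lambda>p. prob (rough_set p T c)) \<longlonglongrightarrow> 0"
proof -
  have "(\<lambda>p. prob (rough_set p T c)) \<longlonglongrightarrow> prob (\<Inter>p. rough_set p T c)"
  proof (rule finite_Lim_measure_decseq)
    show "decseq (\<lambda>p. rough_set p T c)"
    proof (rule antimonoI)
      fix p q :: nat assume "p \<le> q"
      then show "rough_set q T c \<le> rough_set p T c"
        unfolding rough_set_def using mesh_antimono[of p q] by fastforce
    qed
  qed (use rough_set_measurable in auto)
  moreover have "prob (\<Inter>p. rough_set p T c) = 0"
  proof -
    have m: "(\<Inter>p. rough_set p T c) \<in> sets M" using rough_set_measurable by auto
    have "AE \<omega> in M. \<omega> \<notin> (\<Inter>p. rough_set p T c)"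
      using continuous_paths
    proof (rule AE_mp, intro AE_I2 impI)
      fix \<omega> assume cont: "continuous_on {0..} (\<lambda>t. B t \<omega>)"
      have "uniformly_continuous_on {0..T} (\<lambda>t. B t \<omega>)"
        by (rule compact_uniformly_continuous[OF continuous_on_subset[OF cont]]) auto
      then obtain d where d: "0 < d" "\<And>s t. s \<in> {0..T} \<Longrightarrow> t \<in> {0..T} \<Longrightarrow> dist s t < d \<Longrightarrow> dist (B s \<omega>) (B t \<omega>) < c"
        using assms unfolding uniformly_continuous_on_def by metis
      have "eventually (\<lambda>p. mesh p < d / 2) sequentially"
        using order_tendstoD(2)[OF mesh_tendsto_0, of "d / 2"] d(1) by simp
      then obtain p where p: "mesh p < d / 2" by (auto simp: eventually_sequentially)
      have "\<omega> \<notin> rough_set p T c"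
      proof
        assume "\<omega> \<in> rough_set p T c"
        then obtain s t where st: "s \<in> {0..T}" "t \<in> {0..T}" "\<bar>s - t\<bar> \<le> 2 * mesh p" "c < \<bar>B s \<omega> - B t \<omega>\<bar>"
          unfolding rough_set_def by auto
        then have "dist s t < d" using p by (simp add: dist_real_def)
        then show False using d(2)[OF st(1,2)] st(4) by (simp add: dist_real_def)
      qed
      then show "\<omega> \<notin> (\<Inter>p. rough_set p T c)" by blast
    qed
    then show ?thesis using m by (simp add: AE_iff_null_sets measure_eq_0_null_sets)
  qed
  ultimately show ?thesis by simp
qed

lemma modulus_outside_rough_set:
  assumes \<omega>: "\<omega> \<in> space M" "\<omega> \<notin> rough_set p T c" and cont: "continuous_on {0..} (\<lambda>t. B t \<omega>)"
    and st: "s \<in> {0..T}" "t \<in> {0..T}" "\<bar>s - t\<bar> \<le> mesh p"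
  shows "\<bar>B s \<omega> - B t \<omega>\<bar> \<le> c"
proof -
  obtain f where f: "\<And>n. f n \<in> \<rat>" "\<And>n. 0 \<le> f n" "\<And>n. f n \<le> s" "f \<longlonglongrightarrow> s"
    by (rule rational_approximation_below[of s]) (use st in auto)
  obtain g where g: "\<And>n. g n \<in> \<rat>" "\<And>n. 0 \<le> g n" "\<And>n. g n \<le> t" "g \<longlonglongrightarrow> t"
    by (rule rational_approximation_below[of t]) (use st in auto)
  have Bf: "(\<lambda>n. B (f n) \<omega>) \<longlonglongrightarrow> B s \<omega>"
    by (rule continuous_on_tendsto_compose[OF cont f(4)]) (use f st in auto)
  have Bg: "(\<lambda>n. B (g n) \<omega>) \<longlonglongrightarrow> B t \<omega>"
    by (rule continuous_on_tendsto_compose[OF cont g(4)]) (use g st in auto)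
  have "(\<lambda>n. \<bar>f n - g n\<bar>) \<longlonglongrightarrow> \<bar>s - t\<bar>" by (intro tendsto_intros f g)
  then have "eventually (\<lambda>n. \<bar>f n - g n\<bar> < 2 * mesh p) sequentially"
    by (rule order_tendstoD(2)) (use st mesh_pos[of p] in linarith)
  then have "eventually (\<lambda>n. \<bar>B (f n) \<omega> - B (g n) \<omega>\<bar> \<le> c) sequentially"
  proof eventually_elim
    case (elim n)
    have "f n \<in> \<rat> \<inter> {0..T}" "g n \<in> \<rat> \<inter> {0..T}"
      using f(1,2,3)[of n] g(1,2,3)[of n] st by auto
    then show ?case using \<omega> elim unfolding rough_set_def by (auto simp: not_less)
  qed
  then show ?thesis
    by (rule tendsto_upperbound[OF tendsto_rabs[OF tendsto_diff[OF Bf Bg]]]) simp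
qed

section \<open>Choice of the starting gap and of the mesh for each level\<close>

context
  fixes v N \<sigma> r \<theta> :: real
  assumes par: "0 < v" "1 \<le> N" "0 < \<sigma>" "0 < r"
begin

text \<open>The right-hand side of \<open>chain_far_probability\<close> divided by
  \<open>\<sigma>\<^sup>2\<close>, with its discretisation error replaced by 1. It depends neither
  on the level nor on the cut-off, which makes the hitting time almost surely finite.\<close>

definition far_bound :: real where
  "far_bound = (2 + 2 * \<sigma>\<^sup>2 * ((r + v) / v)) / \<sigma>\<^sup>2"

text \<open>Each condition holds for all sufficiently fine meshes once \<eta> is fixed, so finitely
  many of them can be met together. Asking for all p from some p0 on leaves the freedom to make p
  monotone in the level.\<close>

lemma level_parameters:
  fixes k :: nat
  defines "noise \<equiv> \<lambda>\<omega> t. \<sigma> * B t \<omega>"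
  shows "\<exists>\<eta>>0. \<exists>p0. \<forall>p\<ge>p0. level_K v N k * mesh p \<le> \<eta> / 4 \<and> v * mesh p \<le> \<eta> / 4
    \<and> prob (rough_set p (real (Suc k)) (\<eta> / 4 / \<sigma>)) \<le> (1 / 2)^k
    \<and> prob {\<omega>\<in>space M. (1 / 2)^k < level_gap v N r \<theta> k p \<eta> (noise \<omega>) (level_end k p)} \<le> (1 / 2)^k
    \<and> (\<forall>m\<le>Suc k. real m * prob {\<omega>\<in>space M. level_eps k < fst (level_euler v N r \<theta> k p (noise \<omega>) (m * 2^p))} \<le> far_bound)"
proof -
  note e = level_eps_pos[of k]
  define \<kappa> where "\<kappa> = 2 * level_K v N k"
  define L where "L = level_L v N k"
  have K0: "0 \<le> level_K v N k" and kL: "0 \<le> \<kappa>" "0 \<le> L"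
    unfolding \<kappa>_def L_def using level_K_nonneg[of v N k] level_L_nonneg[of v N k] par by auto
  have par': "0 < v" "1 \<le> N" "0 < \<sigma>" "0 < level_eps k" using par e by auto
  define E where "E = (\<lambda>\<eta> h n. \<integral>\<omega>. gap \<kappa> L h \<eta> (\<lambda>j. snd (euler v N (level_eps k) h (noise \<omega>) r \<theta> j)) n \<partial>M)"
  obtain A where A: "0 \<le> A" "\<And>\<eta>. 0 < \<eta> \<and> \<eta> \<le> 1 \<Longrightarrow> \<exists>C\<ge>0. \<forall>h n. 0 < h \<and> h \<le> 1 \<and> h * real n \<le> real (Suc k) \<longrightarrow>
    E \<eta> h n \<le> A * (\<eta> + C * sqrt h)"
    using gap_expectation[OF par' kL, of "real (Suc k)" r \<theta>] unfolding noise_def E_def by auto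
  \<comment> \<open>Chosen so that \<open>A * (2 * \<eta>)\<close> is at most
    \<open>(1/4)^k\<close>; Markov's inequality at the threshold \<open>(1/2)^k\<close> then leaves
    a probability of at most \<open>(1/2)^k\<close>, which is summable.\<close>
  define \<eta> where "\<eta> = (1 / 4)^k / (2 * (A + 1))"
  have \<eta>: "0 < \<eta>" "\<eta> \<le> 1" "A * (2 * \<eta>) \<le> (1 / 4)^k"
  proof -
    have q: "0 < (1 / 4 :: real)^k" "(1 / 4 :: real)^k \<le> 1" by (auto intro: power_le_one)
    show "0 < \<eta>" unfolding \<eta>_def using A(1) by simp
    show "\<eta> \<le> 1" unfolding \<eta>_def using A(1) q by (simp add: divide_le_eq)
    have "A / (A + 1) \<le> 1" using A(1) by simp
    then have "A / (A + 1) * (1 / 4)^k \<le> 1 * (1 / 4)^k" using q by (intro mult_right_mono) auto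
    moreover have "A * (2 * (q / (2 * (A + 1)))) = A / (A + 1) * q" for q :: real using A(1) by (simp add: field_simps)
    ultimately show "A * (2 * \<eta>) \<le> (1 / 4)^k" unfolding \<eta>_def by simp
  qed
  obtain C where C: "0 \<le> C" "\<And>h n. 0 < h \<and> h \<le> 1 \<and> h * real n \<le> real (Suc k) \<Longrightarrow> E \<eta> h n \<le> A * (\<eta> + C * sqrt h)"
    using A(2)[OF conjI[OF \<eta>(1,2)]] by blast
  define D where "D = 8 * (level_K v N k * \<sigma> + (level_K v N k)\<^sup>2 + 4 * (level_K v N k)^3 + 8 * \<sigma>^3)"
  have D0: "0 \<le> D" unfolding D_def using K0 par by simp
  have sq: "(\<lambda>p. sqrt (mesh p)) \<longlonglongrightarrow> 0"
    using tendsto_real_sqrt[OF mesh_tendsto_0] by simp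
  have "eventually (\<lambda>p. level_K v N k * mesh p < \<eta> / 4) sequentially"
    using order_tendstoD(2)[OF tendsto_mult_right_zero[OF mesh_tendsto_0], of "\<eta> / 4" "level_K v N k"] \<eta> by simp
  moreover have "eventually (\<lambda>p. v * mesh p < \<eta> / 4) sequentially"
    using order_tendstoD(2)[OF tendsto_mult_right_zero[OF mesh_tendsto_0], of "\<eta> / 4" v] \<eta> by simp
  moreover have "eventually (\<lambda>p. C * sqrt (mesh p) < \<eta>) sequentially"
    using order_tendstoD(2)[OF tendsto_mult_right_zero[OF sq], of \<eta> C] \<eta> by simp
  moreover have "eventually (\<lambda>p. (real (Suc k) * D) * sqrt (mesh p) < 1) sequentially"
    using order_tendstoD(2)[OF tendsto_mult_right_zero[OF sq], of 1 "real (Suc k) * D"] by simp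
  moreover have "eventually (\<lambda>p. prob (rough_set p (real (Suc k)) (\<eta> / 4 / \<sigma>)) < (1 / 2)^k) sequentially"
    using order_tendstoD(2)[OF rough_set_prob_tendsto_0[of "\<eta> / 4 / \<sigma>" "real (Suc k)"], of "(1 / 2)^k"] \<eta> par by simp
  ultimately have "eventually (\<lambda>p. level_K v N k * mesh p \<le> \<eta> / 4 \<and> v * mesh p \<le> \<eta> / 4
    \<and> prob (rough_set p (real (Suc k)) (\<eta> / 4 / \<sigma>)) \<le> (1 / 2)^k
    \<and> prob {\<omega>\<in>space M. (1 / 2)^k < level_gap v N r \<theta> k p \<eta> (noise \<omega>) (level_end k p)} \<le> (1 / 2)^k
    \<and> (\<forall>m\<le>Suc k. real m * prob {\<omega>\<in>space M. level_eps k < fst (level_euler v N r \<theta> k p (noise \<omega>) (m * 2^p))} \<le> far_bound)) sequentially"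
  proof eventually_elim
    case (elim p)
    let ?g = "\<lambda>\<omega>. level_gap v N r \<theta> k p \<eta> (noise \<omega>) (level_end k p)"
    have g: "level_gap v N r \<theta> k p \<eta> w n = gap \<kappa> L (mesh p) \<eta> (\<lambda>j. snd (euler v N (level_eps k) (mesh p) w r \<theta> j)) n" for w n
      unfolding level_gap_def level_euler_def \<kappa>_def L_def by simp
    have ig: "integrable M ?g"
      unfolding g unfolding noise_def using \<eta> mesh_pos[of p] by (intro chain_gap_integrable[OF par'] kL) auto
    have "(\<integral>\<omega>. ?g \<omega> \<partial>M) = E \<eta> (mesh p) (level_end k p)" unfolding g E_def ..
    also have "\<dots> \<le> A * (\<eta> + C * sqrt (mesh p))"
      by (rule C(2)) (use mesh_pos mesh_le_1 in \<open>simp add: mesh_mult_level_end\<close>)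
    also have "\<dots> \<le> A * (2 * \<eta>)" using elim A(1) by (intro mult_left_mono) auto
    finally have Eg: "(\<integral>\<omega>. ?g \<omega> \<partial>M) \<le> (1 / 4)^k" using \<eta>(3) by linarith
    have g0: "0 \<le> ?g \<omega>" for \<omega>
      unfolding g using gap_pos[of \<kappa> L "mesh p" \<eta>] kL mesh_pos[of p] \<eta> by (simp add: less_imp_le)
    have "prob {\<omega>\<in>space M. (1 / 2)^k < ?g \<omega>} \<le> prob {\<omega>\<in>space M. ?g \<omega> \<ge> (1 / 2)^k}"
      using ig by (intro finite_measure_mono) auto
    also have "\<dots> \<le> (\<integral>\<omega>. ?g \<omega> \<partial>M) / (1 / 2)^k"
      using integral_Markov_inequality_measure[OF ig, of "{}" "(1 / 2)^k"] g0 by simp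
    also have "\<dots> \<le> (1 / 4)^k / (1 / 2)^k" using Eg by (intro divide_right_mono) auto
    also have "\<dots> = (1 / 2)^k" by (simp flip: power_divide)
    finally have 1: "prob {\<omega>\<in>space M. (1 / 2)^k < ?g \<omega>} \<le> (1 / 2)^k" .
    have 2: "real m * prob {\<omega>\<in>space M. level_eps k < fst (level_euler v N r \<theta> k p (noise \<omega>) (m * 2^p))} \<le> far_bound"
      if m: "m \<le> Suc k" for m
    proof -
      let ?P = "prob {\<omega>\<in>space M. level_eps k < fst (level_euler v N r \<theta> k p (noise \<omega>) (m * 2^p))}"
      have hn: "mesh p * real (m * 2^p) = real m" by (simp add: mesh_def)
      have "\<sigma>\<^sup>2 * (mesh p * real (m * 2^p)) * ?P
        \<le> 1 + real (m * 2^p) * (D * (mesh p * sqrt (mesh p))) + 2 * \<sigma>\<^sup>2 * ((r + v) / v)"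
        using chain_far_probability[OF par' mesh_pos[of p] mesh_le_1[of p], of r "m * 2^p" \<theta>] par(4)
        unfolding level_euler_def noise_def D_def level_K_def by (simp only: less_imp_le)
      moreover have "real (m * 2^p) * (D * (mesh p * sqrt (mesh p))) = (mesh p * real (m * 2^p)) * (D * sqrt (mesh p))"
        by (simp only: mult_ac)
      ultimately have "\<sigma>\<^sup>2 * real m * ?P \<le> 1 + real m * (D * sqrt (mesh p)) + 2 * \<sigma>\<^sup>2 * ((r + v) / v)"
        unfolding hn by linarith
      moreover have "real m * (D * sqrt (mesh p)) \<le> real (Suc k) * (D * sqrt (mesh p))"
        using m D0 mesh_pos[of p] by (intro mult_right_mono) auto
      moreover have "real (Suc k) * (D * sqrt (mesh p)) < 1" using elim by (simp only: mult.assoc)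
      ultimately have "\<sigma>\<^sup>2 * (real m * ?P) \<le> 2 + 2 * \<sigma>\<^sup>2 * ((r + v) / v)"
        unfolding mult.assoc by linarith
      then show ?thesis unfolding far_bound_def using par by (simp add: field_simps)
    qed
    show ?case using elim 1 2 by auto
  qed
  then show ?thesis using \<eta>(1) unfolding eventually_sequentially by blast
qed

lemma scheme_exists:
  defines "noise \<equiv> \<lambda>\<omega> t. \<sigma> * B t \<omega>"
  obtains \<eta> :: "nat \<Rightarrow> real" and p :: "nat \<Rightarrow> nat" where
    "\<And>k. 0 < \<eta> k" "mono p" "\<And>k. level_K v N k * mesh (p k) \<le> \<eta> k / 4" "\<And>k. v * mesh (p k) \<le> \<eta> k / 4"
    "AE \<omega> in M. eventually (\<lambda>k. good_level v N r \<theta> k (p k) (\<eta> k) (noise \<omega>)) sequentially"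
    "\<And>k m. m \<le> Suc k \<Longrightarrow> real m *
       prob {\<omega>\<in>space M. level_eps k < fst (level_euler v N r \<theta> k (p k) (noise \<omega>) (m * 2^p k))} \<le> far_bound"
proof -
  define Q where "Q = (\<lambda>k \<eta> p. level_K v N k * mesh p \<le> \<eta> / 4 \<and> v * mesh p \<le> \<eta> / 4
    \<and> prob (rough_set p (real (Suc k)) (\<eta> / 4 / \<sigma>)) \<le> (1 / 2)^k
    \<and> prob {\<omega>\<in>space M. (1 / 2)^k < level_gap v N r \<theta> k p \<eta> (noise \<omega>) (level_end k p)} \<le> (1 / 2)^k
    \<and> (\<forall>m\<le>Suc k. real m * prob {\<omega>\<in>space M. level_eps k < fst (level_euler v N r \<theta> k p (noise \<omega>) (m * 2^p))} \<le> far_bound))"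
  have "\<exists>\<eta>>0. \<exists>p0. \<forall>p\<ge>p0. Q k \<eta> p" for k
    unfolding Q_def noise_def by (rule level_parameters)
  then obtain \<eta> p0 where \<eta>: "\<And>k. 0 < \<eta> k" and P: "\<And>k p. p0 k \<le> p \<Longrightarrow> Q k (\<eta> k) p"
    by metis
  \<comment> \<open>Partial sums dominate every \<open>p0 k\<close> and are monotone in k, so the
    grids become nested.\<close>
  define p where "p = (\<lambda>k. \<Sum>j\<le>k. p0 j)"
  have pp: "p0 k \<le> p k" for k unfolding p_def by (rule member_le_sum) auto
  note P' = P[OF pp, unfolded Q_def]
  have mono: "mono p" unfolding p_def by (intro monoI sum_mono2) auto
  have meas: "(\<lambda>\<omega>. level_gap v N r \<theta> k (p k) (\<eta> k) (noise \<omega>) n) \<in> borel_measurable M" for k n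
    unfolding level_gap_def level_euler_def noise_def
    by (rule measurable_F_M[OF _ chain_gap_measurable(1)[OF par(1,2,3) level_eps_pos]])
      (use mesh_pos[of "p k"] in auto)
  define A1 where "A1 = (\<lambda>k. rough_set (p k) (real (Suc k)) (\<eta> k / 4 / \<sigma>))"
  define A2 where "A2 = (\<lambda>k. {\<omega>\<in>space M. (1 / 2)^k < level_gap v N r \<theta> k (p k) (\<eta> k) (noise \<omega>) (level_end k (p k))})"
  have geo: "summable (\<lambda>k. (1 / 2 :: real)^k)" by (rule summable_geometric) simp
  have s1: "summable (\<lambda>k. prob (A1 k))"
    by (rule summable_comparison_test'[OF geo]) (use P' in \<open>auto simp: A1_def\<close>)
  have s2: "summable (\<lambda>k. prob (A2 k))"
    by (rule summable_comparison_test'[OF geo]) (use P' in \<open>auto simp: A2_def\<close>)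
  have m1: "A1 k \<in> sets M" for k unfolding A1_def by (rule rough_set_measurable)
  have m2: "A2 k \<in> sets M" for k unfolding A2_def using meas by measurable
  have "AE \<omega> in M. eventually (\<lambda>k. \<omega> \<in> space M - A1 k) sequentially"
    by (rule borel_cantelli_AE1[OF m1 _ s1]) (simp add: emeasure_eq_measure)
  moreover have "AE \<omega> in M. eventually (\<lambda>k. \<omega> \<in> space M - A2 k) sequentially"
    by (rule borel_cantelli_AE1[OF m2 _ s2]) (simp add: emeasure_eq_measure)
  ultimately have "AE \<omega> in M. eventually (\<lambda>k. good_level v N r \<theta> k (p k) (\<eta> k) (noise \<omega>)) sequentially"
    using continuous_paths
  proof eventually_elim
    case (elim \<omega>)
    note cont = elim(3)
    from elim(1,2) show ?case
    proof eventually_elim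
      case (elim k)
      have "\<bar>noise \<omega> s - noise \<omega> t\<bar> \<le> \<eta> k / 4"
        if "s \<in> {0..real (Suc k)}" "t \<in> {0..real (Suc k)}" "\<bar>s - t\<bar> \<le> mesh (p k)" for s t
      proof -
        have "\<bar>B s \<omega> - B t \<omega>\<bar> \<le> \<eta> k / 4 / \<sigma>"
          by (rule modulus_outside_rough_set[OF _ _ cont that]) (use elim in \<open>auto simp: A1_def\<close>)
        then have "\<sigma> * \<bar>B s \<omega> - B t \<omega>\<bar> \<le> \<eta> k / 4" using par by (simp add: field_simps)
        moreover have "\<bar>noise \<omega> s - noise \<omega> t\<bar> = \<sigma> * \<bar>B s \<omega> - B t \<omega>\<bar>"
          unfolding noise_def using par by (simp add: abs_mult flip: right_diff_distrib)
        ultimately show ?thesis by simp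
      qed
      moreover have "level_gap v N r \<theta> k (p k) (\<eta> k) (noise \<omega>) (level_end k (p k)) \<le> (1 / 2)^k"
        using elim unfolding A2_def by auto
      ultimately show ?case unfolding good_level_def by blast
    qed
  qed
  then show thesis using that[of \<eta> p] \<eta> mono P' by auto
qed

end

end

section \<open>Comparison with the scheme\<close>

lemma set_integrable_bounded:
  fixes f :: "real \<Rightarrow> real"
  assumes "f \<in> borel_measurable borel" "\<And>s. \<bar>f s\<bar> \<le> C"
  shows "set_integrable lborel {a..b} f"
  unfolding set_integrable_def
proof (rule integrableI_bounded_set[where A = "{a..b}" and B = "\<bar>C\<bar>"])
  show "emeasure lborel {a..b} < \<infinity>" by (cases "a \<le> b") auto
  show "AE x in lborel. x \<in> {a..b} \<longrightarrow> norm (indicator {a..b} x *\<^sub>R f x) \<le> \<bar>C\<bar>"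
    using order_trans[OF assms(2) abs_ge_self] by (intro AE_I2) (auto simp: indicator_def)
qed (use assms in auto)

lemma set_integral_singleton: "(LBINT s:{a}. f s) = 0" for f :: "real \<Rightarrow> real"
proof -
  have "AE s in lborel. indicator {a} s *\<^sub>R f s = 0"
    using AE_lborel_singleton[of a] by eventually_elim simp
  then show ?thesis unfolding set_lebesgue_integral_def by (rule integral_eq_zero_AE)
qed

text \<open>The bound is asked for on the half-open interval only, because a step process already
  takes its next value at the right endpoint; that single point is null.\<close>

lemma integral_increment_approx:
  fixes f :: "real \<Rightarrow> real"
  assumes f: "set_integrable lborel {0..S} f" and ab: "0 \<le> a" "a \<le> b" "b \<le> S"
    and bound: "\<And>u. a \<le> u \<Longrightarrow> u < b \<Longrightarrow> \<bar>f u - c\<bar> \<le> q"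
  shows "\<bar>(LBINT s:{0..b}. f s) - (LBINT s:{0..a}. f s) - c * (b - a)\<bar> \<le> q * (b - a)"
proof -
  have fi: "set_integrable lborel {0..a} f" "set_integrable lborel {a<..b} f"
    using ab by (auto intro: set_integrable_subset[OF f])
  have "{0..b} = {0..a} \<union> {a<..b}" using ab by auto
  then have e: "(LBINT s:{0..b}. f s) = (LBINT s:{0..a}. f s) + (LBINT s:{a<..b}. f s)"
    using set_integral_Un[OF _ fi] by (simp add: disjoint_iff)
  have ci: "set_integrable lborel {a<..b} (\<lambda>_. x)" for x :: real
    unfolding set_integrable_def
    by (intro integrable_scaleR_left integrable_real_indicator) (use ab in auto)
  have cv: "(LBINT s:{a<..b}. x) = x * (b - a)" for x :: real
    using ab by (simp add: set_lebesgue_integral_def mult.commute)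
  have fc: "set_integrable lborel {a<..b} (\<lambda>s. f s - c)"
    by (rule set_integral_diff(1)[OF fi(2) ci])
  have "(LBINT s:{a<..b}. f s) - c * (b - a) = (LBINT s:{a<..b}. f s - c)"
    using set_integral_diff(2)[OF fi(2) ci[of c]] cv[of c] by simp
  also have "\<bar>\<dots>\<bar> \<le> (LBINT s:{a<..b}. \<bar>f s - c\<bar>)"
    using set_integral_norm_bound[OF fc] by simp
  also have "\<dots> \<le> (LBINT s:{a<..b}. q)"
  proof (rule set_integral_mono_AE)
    show "set_integrable lborel {a<..b} (\<lambda>s. \<bar>f s - c\<bar>)" by (rule set_integrable_abs[OF fc])
    have "AE u in lborel. u \<noteq> b" by (rule AE_lborel_singleton)
    then show "AE u\<in>{a<..b} in lborel. \<bar>f u - c\<bar> \<le> q"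
      by (rule AE_mp) (use bound in \<open>auto intro!: AE_I2\<close>)
  qed (rule ci)
  also have "\<dots> = q * (b - a)" by (rule cv)
  finally show ?thesis unfolding e by simp
qed

section \<open>The scheme as a step process and its grid indices\<close>

definition step_euler :: "real \<Rightarrow> real \<Rightarrow> real \<Rightarrow> real \<Rightarrow> nat \<Rightarrow> nat \<Rightarrow> (real \<Rightarrow> real) \<Rightarrow> real \<Rightarrow> real \<times> real" where
  "step_euler v N r \<theta> k p w t = level_euler v N r \<theta> k p w (nat \<lfloor>t * 2^p\<rfloor>)"

lemma grid_index:
  assumes "0 \<le> t"
  shows "mesh p * real (nat \<lfloor>t * 2^p\<rfloor>) \<le> t" "t < mesh p * real (Suc (nat \<lfloor>t * 2^p\<rfloor>))"
proof -
  have f: "real (nat \<lfloor>t * 2^p\<rfloor>) = real_of_int \<lfloor>t * 2^p\<rfloor>" using assms by simp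
  have "real (nat \<lfloor>t * 2^p\<rfloor>) \<le> t * 2^p" "t * 2^p < real (nat \<lfloor>t * 2^p\<rfloor>) + 1"
    unfolding f by (rule of_int_floor_le, linarith)
  then show "mesh p * real (nat \<lfloor>t * 2^p\<rfloor>) \<le> t" "t < mesh p * real (Suc (nat \<lfloor>t * 2^p\<rfloor>))"
    by (auto simp: mesh_def field_simps)
qed

lemma grid_index_mult: "nat \<lfloor>mesh p * real i * 2^p\<rfloor> = i"
proof -
  have "mesh p * real i * 2^p = real i" by (simp add: mesh_def)
  then show ?thesis by (simp only: floor_of_nat nat_int)
qed

lemma grid_index_unique:
  assumes "mesh p * real i \<le> t" "t < mesh p * real (Suc i)"
  shows "nat \<lfloor>t * 2^p\<rfloor> = i"
proof -
  have "real i \<le> t * 2^p" "t * 2^p < real i + 1" using assms by (auto simp: mesh_def field_simps)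
  then have "\<lfloor>t * 2^p\<rfloor> = int i" by linarith
  then show ?thesis by simp
qed

lemma level_euler_fst_Suc:
  "fst (level_euler v N r \<theta> k p w (Suc i)) = fst (level_euler v N r \<theta> k p w i)
     + mesh p * pn_mu1 v (fst (level_euler v N r \<theta> k p w i)) (snd (level_euler v N r \<theta> k p w i))"
  by (simp add: level_euler_def Let_def case_prod_beta)

lemma level_euler_snd_Suc:
  "snd (level_euler v N r \<theta> k p w (Suc i)) = snd (level_euler v N r \<theta> k p w i)
     + mesh p * pn_mu2 v N (max (fst (level_euler v N r \<theta> k p w i)) (level_eps k)) (snd (level_euler v N r \<theta> k p w i))
     + (w (mesh p * real (Suc i)) - w (mesh p * real i))"
  by (simp add: level_euler_def Let_def case_prod_beta)

lemma level_gap_Suc: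
  "level_gap v N r \<theta> k p \<eta> w (Suc i) = level_gap v N r \<theta> k p \<eta> w i
     + mesh p * ((if \<bar>cos (snd (level_euler v N r \<theta> k p w i))\<bar> \<le> level_gap v N r \<theta> k p \<eta> w i then 2 * level_K v N k else 0)
        + level_L v N k * level_gap v N r \<theta> k p \<eta> w i)"
  by (simp add: level_gap_def)

lemma euler_fst_antimono:
  assumes "0 \<le> v" "i \<le> j"
  shows "fst (level_euler v N r \<theta> k p w j) \<le> fst (level_euler v N r \<theta> k p w i)"
proof (rule lift_Suc_antimono_le[OF _ assms(2)])
  show "fst (level_euler v N r \<theta> k p w (Suc n)) \<le> fst (level_euler v N r \<theta> k p w n)" for n
    unfolding level_euler_fst_Suc pn_mu1_eq using assms(1) mesh_pos[of p] by simp
qed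

lemma euler_fst_lower:
  assumes "0 \<le> v" "i \<le> j"
  shows "fst (level_euler v N r \<theta> k p w i) - v * (mesh p * (real j - real i)) \<le> fst (level_euler v N r \<theta> k p w j)"
  using assms(2)
proof (induction j rule: dec_induct)
  case (step j)
  have "- v \<le> pn_mu1 v (fst (level_euler v N r \<theta> k p w j)) (snd (level_euler v N r \<theta> k p w j))"
    using abs_pn_mu1_le[OF assms(1), of "fst (level_euler v N r \<theta> k p w j)" "snd (level_euler v N r \<theta> k p w j)"]
    by linarith
  then have "mesh p * - v \<le> mesh p * pn_mu1 v (fst (level_euler v N r \<theta> k p w j)) (snd (level_euler v N r \<theta> k p w j))"
    using mesh_pos[of p] by (intro mult_left_mono) auto
  then show ?case using step.IH unfolding level_euler_fst_Suc by (simp add: algebra_simps)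
qed simp

section \<open>Comparison of one level with a solution or a finer level along a single path\<close>

locale level_path =
  fixes v N r \<theta> :: real and k p :: nat and \<eta> :: real and w :: "real \<Rightarrow> real"
  assumes v_pos: "0 < v" and N_ge: "1 \<le> N" and \<eta>_pos: "0 < \<eta>"
    and K_mesh: "level_K v N k * mesh p \<le> \<eta> / 4" and v_mesh: "v * mesh p \<le> \<eta> / 4"
    and good: "good_level v N r \<theta> k p \<eta> w"
begin

lemma gap_bounds:
  shows "\<eta> \<le> level_gap v N r \<theta> k p \<eta> w i"
    and "i \<le> j \<Longrightarrow> level_gap v N r \<theta> k p \<eta> w i \<le> level_gap v N r \<theta> k p \<eta> w j"
proof -
  have p: "0 \<le> 2 * level_K v N k" "0 \<le> level_L v N k" "0 \<le> mesh p"
    using level_K_nonneg[of v N k] level_L_nonneg[of v N k] v_pos N_ge mesh_pos[of p] by auto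
  show "\<eta> \<le> level_gap v N r \<theta> k p \<eta> w i"
    unfolding level_gap_def by (rule gap_ge[OF p \<eta>_pos])
  show "i \<le> j \<Longrightarrow> level_gap v N r \<theta> k p \<eta> w i \<le> level_gap v N r \<theta> k p \<eta> w j"
    unfolding level_gap_def by (rule gap_mono[OF p \<eta>_pos])
qed

lemma gap_index_le:
  assumes "0 \<le> u" "u \<le> real (Suc k)"
  shows "level_gap v N r \<theta> k p \<eta> w (nat \<lfloor>u * 2^p\<rfloor>) \<le> (1 / 2)^k"
proof -
  have "mesh p * real (nat \<lfloor>u * 2^p\<rfloor>) \<le> mesh p * real (level_end k p)"
    using grid_index(1)[OF assms(1), of p] assms(2) by (simp add: mesh_mult_level_end)
  then have "nat \<lfloor>u * 2^p\<rfloor> \<le> level_end k p" using mesh_pos[of p] by simp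
  then have "level_gap v N r \<theta> k p \<eta> w (nat \<lfloor>u * 2^p\<rfloor>) \<le> level_gap v N r \<theta> k p \<eta> w (level_end k p)"
    by (rule gap_bounds(2))
  then show ?thesis using good unfolding good_level_def by linarith
qed

text \<open>The round-down map \<open>\<rho>\<close> is the identity for an exact solution and the grid projection for the
  step process of a finer level, so that one comparison serves uniqueness and convergence.\<close>

context
  fixes R' X' \<rho> :: "real \<Rightarrow> real" and S :: real
  assumes S: "0 \<le> S" "S \<le> real (Suc k)"
    and \<rho>: "\<And>t. 0 \<le> t \<Longrightarrow> t \<le> S \<Longrightarrow> \<rho> t \<le> t"
    and \<rho>_mono: "\<And>s t. 0 \<le> s \<Longrightarrow> s \<le> t \<Longrightarrow> t \<le> S \<Longrightarrow> \<rho> s \<le> \<rho> t"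
    and \<rho>_grid: "\<And>i. mesh p * real i \<le> S \<Longrightarrow> \<rho> (mesh p * real i) = mesh p * real i"
    and R'_ge: "\<And>t. 0 \<le> t \<Longrightarrow> t \<le> S \<Longrightarrow> level_eps k \<le> R' t"
    and int1: "set_integrable lborel {0..S} (\<lambda>s. pn_mu1 v (R' s) (X' s))"
    and int2: "set_integrable lborel {0..S} (\<lambda>s. pn_mu2 v N (R' s) (X' s))"
    and R'_eq: "\<And>t. 0 \<le> t \<Longrightarrow> t \<le> S \<Longrightarrow> R' t = r + (LBINT s:{0..\<rho> t}. pn_mu1 v (R' s) (X' s))"
    and X'_eq: "\<And>t. 0 \<le> t \<Longrightarrow> t \<le> S \<Longrightarrow> X' t = \<theta> + (LBINT s:{0..\<rho> t}. pn_mu2 v N (R' s) (X' s)) + (w (\<rho> t) - w 0)"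
begin

text \<open>Within one grid interval the angular drift, the noise and the radial drift each
  contribute at most \<eta> / 4.\<close>

lemma comparison_lag:
  assumes u: "mesh p * real i \<le> u" "u < mesh p * real (Suc i)" "u \<le> S"
  shows "\<bar>X' u - X' (mesh p * real i)\<bar> + \<bar>R' u - R' (mesh p * real i)\<bar> \<le> \<eta>"
proof -
  let ?t = "mesh p * real i" and ?K = "level_K v N k"
  have t: "0 \<le> ?t" "?t \<le> S" "0 \<le> u"
  proof -
    show "0 \<le> ?t" using mesh_pos[of p] by simp
    then show "?t \<le> S" "0 \<le> u" using u by linarith+
  qed
  have rt: "\<rho> ?t = ?t" by (rule \<rho>_grid[OF t(2)])
  have ru: "?t \<le> \<rho> u" "\<rho> u \<le> u" using \<rho>_mono[OF t(1) u(1,3)] rt \<rho>[OF t(3) u(3)] by auto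
  have len: "\<rho> u - ?t \<le> mesh p" using ru u by (simp add: algebra_simps)
  have K0: "0 \<le> ?K" using level_K_nonneg v_pos N_ge by simp
  have "\<bar>(LBINT s:{0..\<rho> u}. pn_mu2 v N (R' s) (X' s)) - (LBINT s:{0..?t}. pn_mu2 v N (R' s) (X' s)) - 0 * (\<rho> u - ?t)\<bar>
      \<le> ?K * (\<rho> u - ?t)"
  proof (rule integral_increment_approx[OF int2 t(1) ru(1)])
    fix s assume s: "?t \<le> s" "s < \<rho> u"
    then have s': "0 \<le> s" "s \<le> S" using t ru u by auto
    show "\<bar>pn_mu2 v N (R' s) (X' s) - 0\<bar> \<le> ?K" unfolding level_K_def
      using abs_pn_mu2_le[of v N "level_eps k" "R' s" "X' s"] R'_ge[OF s'] v_pos N_ge level_eps_pos by simp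
  qed (use ru u in simp)
  moreover have "?K * (\<rho> u - ?t) \<le> ?K * mesh p" using len K0 by (intro mult_left_mono)
  ultimately have 1: "\<bar>(LBINT s:{0..\<rho> u}. pn_mu2 v N (R' s) (X' s)) - (LBINT s:{0..?t}. pn_mu2 v N (R' s) (X' s))\<bar> \<le> \<eta> / 4"
    using K_mesh by simp
  have "\<bar>(LBINT s:{0..\<rho> u}. pn_mu1 v (R' s) (X' s)) - (LBINT s:{0..?t}. pn_mu1 v (R' s) (X' s)) - 0 * (\<rho> u - ?t)\<bar>
      \<le> v * (\<rho> u - ?t)"
  proof (rule integral_increment_approx[OF int1 t(1) ru(1)])
    show "\<bar>pn_mu1 v (R' s) (X' s) - 0\<bar> \<le> v" for s using abs_pn_mu1_le[of v] v_pos by simp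
  qed (use ru u in simp)
  moreover have "v * (\<rho> u - ?t) \<le> v * mesh p" using len v_pos by (intro mult_left_mono) auto
  ultimately have 2: "\<bar>R' u - R' ?t\<bar> \<le> \<eta> / 4"
    using v_mesh R'_eq[OF t(3) u(3)] R'_eq[OF t(1,2)] unfolding rt by simp
  have "\<bar>w (\<rho> u) - w ?t\<bar> \<le> \<eta> / 4"
    using good[unfolded good_level_def, THEN conjunct1, rule_format, of "\<rho> u" ?t] t ru u len S by auto
  then have "\<bar>X' u - X' ?t\<bar> \<le> \<eta> / 2"
    using 1 X'_eq[OF t(3) u(3)] X'_eq[OF t(1,2)] unfolding rt by linarith
  then show ?thesis using 2 \<eta>_pos by linarith
qed

text \<open>At grid points the distance stays below the gap by \<eta>, and this slack is consumed by
  \<open>comparison_lag\<close> inside the next interval. So the distance is below the gap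
  throughout the interval, and a process on the other side of a wall forces the scheme into the
  strip for which the recursion charges the jump.\<close>

lemma comparison_grid:
  assumes "mesh p * real i \<le> S"
  shows "\<bar>X' (mesh p * real i) - snd (level_euler v N r \<theta> k p w i)\<bar>
    + \<bar>R' (mesh p * real i) - fst (level_euler v N r \<theta> k p w i)\<bar> \<le> level_gap v N r \<theta> k p \<eta> w i - \<eta>"
  using assms
proof (induction i)
  case 0
  have "\<rho> 0 = 0" using \<rho>_grid[of 0] S by simp
  then have "R' 0 = r" "X' 0 = \<theta>" using R'_eq[of 0] X'_eq[of 0] S by (auto simp: set_integral_singleton)
  then show ?case by (simp add: level_euler_def level_gap_def)
next
  case (Suc i)
  let ?h = "mesh p" and ?K = "level_K v N k" and ?\<epsilon> = "level_eps k"
  let ?t = "?h * real i" and ?t' = "?h * real (Suc i)"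
  let ?R = "fst (level_euler v N r \<theta> k p w i)" and ?X = "snd (level_euler v N r \<theta> k p w i)"
  let ?d = "level_gap v N r \<theta> k p \<eta> w i"
  define q where "q = (if \<bar>cos ?X\<bar> \<le> ?d then 2 * ?K else 0)"
  have h: "0 < ?h" by (rule mesh_pos)
  have t: "0 \<le> ?t" "?t \<le> ?t'" "?t' \<le> S" "?t \<le> S" "0 \<le> ?t'" "?t' - ?t = ?h" using h Suc.prems by (auto simp: algebra_simps)
  note IH = Suc.IH[OF t(4)]
  have rt: "\<rho> ?t = ?t" "\<rho> ?t' = ?t'" by (rule \<rho>_grid[OF t(4)], rule \<rho>_grid[OF t(3)])
  have K0: "0 \<le> ?K" using level_K_nonneg v_pos N_ge by simp
  have d: "\<bar>X' u - ?X\<bar> + \<bar>R' u - ?R\<bar> \<le> ?d" if "?t \<le> u" "u < ?t'" for u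
    using comparison_lag[OF that] that t(3) IH by linarith
  have "\<bar>(LBINT s:{0..?t'}. pn_mu2 v N (R' s) (X' s)) - (LBINT s:{0..?t}. pn_mu2 v N (R' s) (X' s))
      - pn_mu2 v N (max ?R ?\<epsilon>) ?X * (?t' - ?t)\<bar> \<le> (q + ?K * ?d + ?K / ?\<epsilon> * ?d) * (?t' - ?t)"
  proof (rule integral_increment_approx[OF int2 t(1,2,3)])
    fix u assume u: "?t \<le> u" "u < ?t'"
    have u0: "0 \<le> u" "u \<le> S" using u t(1,3) by linarith+
    have X: "\<bar>X' u - ?X\<bar> \<le> ?d" using d[OF u] by linarith
    \<comment> \<open>The radius R' is above the cut-off, so raising the radius of the scheme to the
      cut-off does not increase the distance.\<close>
    have R: "\<bar>R' u - max ?R ?\<epsilon>\<bar> \<le> ?d" using d[OF u] R'_ge[OF u0] by linarith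
    have "\<bar>pn_mu2 v N (R' u) (X' u) - pn_mu2 v N (max ?R ?\<epsilon>) ?X\<bar>
      \<le> (if \<bar>cos ?X\<bar> \<le> \<bar>X' u - ?X\<bar> then 2 * ?K else 0) + ?K * \<bar>X' u - ?X\<bar> + ?K / ?\<epsilon> * \<bar>R' u - max ?R ?\<epsilon>\<bar>"
      unfolding level_K_def
      by (rule pn_mu2_diff_le) (use v_pos N_ge level_eps_pos R'_ge[OF u0] in auto)
    also have "\<dots> \<le> q + ?K * ?d + ?K / ?\<epsilon> * ?d"
      using X R K0 level_eps_pos[of k] unfolding q_def
      by (intro add_mono mult_left_mono) auto
    finally show "\<bar>pn_mu2 v N (R' u) (X' u) - pn_mu2 v N (max ?R ?\<epsilon>) ?X\<bar> \<le> q + ?K * ?d + ?K / ?\<epsilon> * ?d" .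
  qed
  then have 1: "\<bar>X' ?t' - snd (level_euler v N r \<theta> k p w (Suc i))\<bar> \<le> \<bar>X' ?t - ?X\<bar> + (q + ?K * ?d + ?K / ?\<epsilon> * ?d) * ?h"
    using X'_eq[OF t(5,3)] X'_eq[OF t(1,4)] unfolding rt t(6) level_euler_snd_Suc by (simp add: mult.commute)
  have "\<bar>(LBINT s:{0..?t'}. pn_mu1 v (R' s) (X' s)) - (LBINT s:{0..?t}. pn_mu1 v (R' s) (X' s))
      - pn_mu1 v ?R ?X * (?t' - ?t)\<bar> \<le> (v * ?d) * (?t' - ?t)"
  proof (rule integral_increment_approx[OF int1 t(1,2,3)])
    fix u assume u: "?t \<le> u" "u < ?t'"
    have "\<bar>pn_mu1 v (R' u) (X' u) - pn_mu1 v ?R ?X\<bar> \<le> v * \<bar>X' u - ?X\<bar>"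
      using v_pos by (intro pn_mu1_diff_le) auto
    also have "\<dots> \<le> v * ?d" using d[OF u] v_pos by (intro mult_left_mono) auto
    finally show "\<bar>pn_mu1 v (R' u) (X' u) - pn_mu1 v ?R ?X\<bar> \<le> v * ?d" .
  qed
  then have 2: "\<bar>R' ?t' - fst (level_euler v N r \<theta> k p w (Suc i))\<bar> \<le> \<bar>R' ?t - ?R\<bar> + (v * ?d) * ?h"
    using R'_eq[OF t(5,3)] R'_eq[OF t(1,4)] unfolding rt t(6) level_euler_fst_Suc by (simp add: mult.commute)
  have "level_gap v N r \<theta> k p \<eta> w (Suc i) = ?d + (q + ?K * ?d + ?K / ?\<epsilon> * ?d) * ?h + (v * ?d) * ?h"
    unfolding level_gap_Suc q_def[symmetric] level_L_def by (simp add: algebra_simps)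
  then show ?case using 1 2 IH by linarith
qed

theorem comparison:
  assumes "0 \<le> u" "u \<le> S"
  shows "\<bar>X' u - snd (step_euler v N r \<theta> k p w u)\<bar> + \<bar>R' u - fst (step_euler v N r \<theta> k p w u)\<bar>
    \<le> level_gap v N r \<theta> k p \<eta> w (nat \<lfloor>u * 2^p\<rfloor>)"
proof -
  note g = grid_index[OF assms(1), of p]
  have "mesh p * real (nat \<lfloor>u * 2^p\<rfloor>) \<le> S" using g(1) assms(2) by linarith
  from comparison_grid[OF this] comparison_lag[OF g assms(2)]
  show ?thesis unfolding step_euler_def by linarith
qed

end

end

section \<open>The angle at the hitting time\<close>

lemma integral_increment_upper:
  fixes f :: "real \<Rightarrow> real"
  assumes f: "set_integrable lborel {0..S} f" and ab: "0 \<le> a" "a \<le> b" "b \<le> S"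
    and bound: "\<And>u. a \<le> u \<Longrightarrow> u \<le> b \<Longrightarrow> f u \<le> c"
  shows "(LBINT s:{0..b}. f s) - (LBINT s:{0..a}. f s) \<le> c * (b - a)"
proof -
  have fi: "set_integrable lborel {0..a} f" "set_integrable lborel {a<..b} f"
    using ab by (auto intro: set_integrable_subset[OF f])
  have "{0..b} = {0..a} \<union> {a<..b}" using ab by auto
  then have e: "(LBINT s:{0..b}. f s) = (LBINT s:{0..a}. f s) + (LBINT s:{a<..b}. f s)"
    using set_integral_Un[OF _ fi] by (simp add: disjoint_iff)
  have "(LBINT s:{a<..b}. f s) \<le> (LBINT s:{a<..b}. c)"
  proof (rule set_integral_mono[OF fi(2)])
    show "set_integrable lborel {a<..b} (\<lambda>_. c)" unfolding set_integrable_def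
      by (intro integrable_scaleR_left integrable_real_indicator) (use ab in auto)
  qed (use bound in auto)
  also have "\<dots> = c * (b - a)" using ab by (simp add: set_lebesgue_integral_def mult.commute)
  finally show ?thesis unfolding e by simp
qed

lemma last_time_below:
  fixes u :: "real \<Rightarrow> real"
  assumes cont: "continuous_on {t0..t1} u" and le: "t0 \<le> t1" and "u t0 \<le> \<alpha>" and "\<alpha> < u t1"
  obtains s where "t0 \<le> s" "s < t1" "u s = \<alpha>" "\<And>x. s < x \<Longrightarrow> x \<le> t1 \<Longrightarrow> \<alpha> < u x"
proof -
  let ?S = "{t0..t1} \<inter> u -` {..\<alpha>}"
  have "closed ?S" by (rule continuous_closed_preimage[OF cont]) auto
  then have "compact ?S" using compact_Int_closed[of "{t0..t1}" ?S] by (simp add: Int_assoc)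
  moreover have "?S \<noteq> {}" using assms by auto
  ultimately obtain s where s: "s \<in> ?S" "\<And>x. x \<in> ?S \<Longrightarrow> x \<le> s" using compact_attains_sup by metis
  have st: "s < t1" using s(1) assms(4) by (cases "s = t1") auto
  have above: "\<alpha> < u x" if "s < x" "x \<le> t1" for x
  proof (rule ccontr)
    assume "\<not> \<alpha> < u x"
    then have "x \<in> ?S" using that s(1) by auto
    then show False using s(2) that by fastforce
  qed
  have "\<exists>x\<ge>s. x \<le> t1 \<and> u x = \<alpha>"
    by (rule IVT') (use s(1) assms(4) st in \<open>auto intro: continuous_on_subset[OF cont]\<close>)
  then obtain x where x: "s \<le> x" "x \<le> t1" "u x = \<alpha>" by auto
  then have "u s = \<alpha>" using above[of x] by (cases "x = s") auto
  then show thesis using that[of s] s(1) st above by auto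
qed

text \<open>Here \<open>u\<close> is the signed distance of the angle from the centre of a well and \<open>a\<close> its drift part. The rate
  \<open>\<kappa> / (T - s)\<close> in the last assumption is not integrable up to \<open>T\<close>, so \<open>u\<close> cannot stay above \<open>e\<close>.\<close>

context
  fixes u a :: "real \<Rightarrow> real" and t0 T e \<kappa> :: real
  assumes T: "t0 < T" and e: "0 < e" and \<kappa>: "0 < \<kappa>"
    and cont: "continuous_on {t0..<T} u"
    and osc: "\<And>s t. t0 \<le> s \<Longrightarrow> s \<le> t \<Longrightarrow> t < T \<Longrightarrow> \<bar>(u t - a t) - (u s - a s)\<bar> \<le> e"
    and dec: "\<And>s t. t0 \<le> s \<Longrightarrow> s \<le> t \<Longrightarrow> t < T \<Longrightarrow> (\<And>x. s \<le> x \<Longrightarrow> x \<le> t \<Longrightarrow> 0 < u x \<and> u x < pi / 2) \<Longrightarrow> a t \<le> a s"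
    and dec': "\<And>s t. t0 \<le> s \<Longrightarrow> s \<le> t \<Longrightarrow> t < T \<Longrightarrow> (\<And>x. s \<le> x \<Longrightarrow> x \<le> t \<Longrightarrow> e \<le> u x \<and> u x < pi / 2) \<Longrightarrow>
       a t \<le> a s - \<kappa> * ((t - s) / (T - s))"
begin

text \<open>To climb from \<alpha> to \<alpha> + 2 * e the path has to travel from its last visit of
  the lower level to its first visit of the upper one while strictly between 0 and pi / 2. There the
  drift part does not increase, so the noise alone would have to supply 2 * e, but it oscillates by
  at most e.\<close>

lemma well_barrier:
  assumes s: "t0 \<le> s" "s \<le> t" "t < T" and \<alpha>: "0 < \<alpha>" "\<alpha> + 2 * e < pi / 2" and us: "u s \<le> \<alpha>"
  shows "u t < \<alpha> + 2 * e"
proof (rule ccontr)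
  assume "\<not> u t < \<alpha> + 2 * e"
  then have ut: "\<alpha> + 2 * e \<le> u t" by simp
  have c: "continuous_on {s..t} u" by (rule continuous_on_subset[OF cont]) (use s in auto)
  let ?S = "{s..t} \<inter> u -` {\<alpha> + 2 * e..}"
  have "closed ?S" by (rule continuous_closed_preimage[OF c]) auto
  then have "compact ?S" using compact_Int_closed[of "{s..t}" ?S] by (simp add: Int_assoc)
  moreover have "?S \<noteq> {}" using ut s by auto
  ultimately obtain t2 where t2: "t2 \<in> ?S" "\<And>x. x \<in> ?S \<Longrightarrow> t2 \<le> x" using compact_attains_inf by metis
  have below: "u x < \<alpha> + 2 * e" if "s \<le> x" "x < t2" for x
    using t2(1) t2(2)[of x] that by force
  have c2: "continuous_on {s..t2} u" by (rule continuous_on_subset[OF c]) (use t2 in auto)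
  have "\<exists>x\<ge>s. x \<le> t2 \<and> u x = \<alpha> + 2 * e"
    by (rule IVT') (use t2(1) us e c2 in auto)
  then obtain x where x: "s \<le> x" "x \<le> t2" "u x = \<alpha> + 2 * e" by auto
  then have ut2: "u t2 = \<alpha> + 2 * e" using below[of x] by (cases "x = t2") auto
  have st2: "s \<le> t2" using t2 by auto
  obtain s' where s': "s \<le> s'" "s' < t2" "u s' = \<alpha>" "\<And>x. s' < x \<Longrightarrow> x \<le> t2 \<Longrightarrow> \<alpha> < u x"
    by (rule last_time_below[OF c2 st2 us]) (use ut2 e in auto)
  have b: "t0 \<le> s'" "s' \<le> t2" "t2 < T" using s s' t2 by auto
  have "a t2 \<le> a s'"
  proof (rule dec[OF b])
    fix x assume x: "s' \<le> x" "x \<le> t2"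
    have "\<alpha> \<le> u x" using s'(3) s'(4)[of x] x by (cases "x = s'") auto
    moreover have "u x < pi / 2" using below[of x] ut2 \<alpha> x s'(1) by (cases "x = t2") auto
    ultimately show "0 < u x \<and> u x < pi / 2" using \<alpha> by simp
  qed
  then show False using osc[OF b] ut2 s'(3) e by linarith
qed

text \<open>As long as u stays above e the drift part falls by a fixed amount on each of infinitely
  many intervals, whereas u and the noise are bounded; so u falls below e at some time. From then on
  the barrier with \<alpha> = e keeps it below 3 * e.\<close>

lemma well_capture:
  assumes \<alpha>: "0 < \<alpha>" "\<alpha> + 2 * e < pi / 2" and e3: "3 * e < pi / 2" and u0: "u t0 \<le> \<alpha>"
  shows "\<exists>t1. t0 \<le> t1 \<and> t1 < T \<and> (\<forall>t. t1 \<le> t \<and> t < T \<longrightarrow> u t \<le> 3 * e)"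
proof -
  have upi: "u t < pi / 2" if "t0 \<le> t" "t < T" for t
    using well_barrier[OF order_refl that \<alpha> u0] \<alpha> by linarith
  have "\<exists>t1. t0 \<le> t1 \<and> t1 < T \<and> u t1 < e"
  proof (rule ccontr)
    assume "\<not> (\<exists>t1. t0 \<le> t1 \<and> t1 < T \<and> u t1 < e)"
    then have big: "e \<le> u t" if "t0 \<le> t" "t < T" for t using that by force
    \<comment> \<open>Each interval consumes half of the remaining time, so (t - s) / (T - s) equals
      1/2 on each and every interval lowers the drift part by \<kappa> / 2.\<close>
    define \<tau> where "\<tau> = (\<lambda>m::nat. T - (T - t0) / 2^m)"
    have \<tau>: "t0 \<le> \<tau> m" "\<tau> m < T" "\<tau> m \<le> \<tau> (Suc m)" for m
    proof -
      have "(T - t0) / 2^m \<le> (T - t0) / 1" using T by (intro divide_left_mono) auto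
      then show "t0 \<le> \<tau> m" unfolding \<tau>_def by simp
      show "\<tau> m < T" unfolding \<tau>_def using T by simp
      have "(T - t0) / 2^Suc m \<le> (T - t0) / 2^m" using T by (intro divide_left_mono) auto
      then show "\<tau> m \<le> \<tau> (Suc m)" unfolding \<tau>_def by simp
    qed
    have step: "a (\<tau> (Suc m)) \<le> a (\<tau> m) - \<kappa> / 2" for m
    proof -
      have "a (\<tau> (Suc m)) \<le> a (\<tau> m) - \<kappa> * ((\<tau> (Suc m) - \<tau> m) / (T - \<tau> m))"
      proof (rule dec'[OF \<tau>(1,3,2)])
        fix x assume "\<tau> m \<le> x" "x \<le> \<tau> (Suc m)"
        then have "t0 \<le> x" "x < T" using \<tau>(1)[of m] \<tau>(2)[of "Suc m"] by auto
        then show "e \<le> u x \<and> u x < pi / 2" using big upi by simp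
      qed
      also have "(\<tau> (Suc m) - \<tau> m) / (T - \<tau> m) = 1 / 2"
      proof -
        define y where "y = (T - t0) / 2^m"
        have "\<tau> (Suc m) - \<tau> m = y / 2" "T - \<tau> m = y" "0 < y" unfolding \<tau>_def y_def using T by auto
        then show ?thesis by simp
      qed
      finally show ?thesis by simp
    qed
    have "a (\<tau> m) \<le> a (\<tau> 0) - real m * (\<kappa> / 2)" for m
    proof (induction m)
      case (Suc m)
      have "real (Suc m) * (\<kappa> / 2) = real m * (\<kappa> / 2) + \<kappa> / 2" by (simp add: field_simps)
      then show ?case using step[of m] Suc.IH by linarith
    qed simp
    moreover have "a (\<tau> m) \<ge> a (\<tau> 0) - pi / 2 - e" for m
    proof -
      have "\<tau> 0 = t0" unfolding \<tau>_def by simp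
      then show ?thesis
        using osc[of t0 "\<tau> m"] \<tau>[of m] big[of "\<tau> m"] upi[of t0] T e by auto
    qed
    moreover obtain m where "pi / 2 + e < real m * (\<kappa> / 2)"
      using reals_Archimedean3[of "\<kappa> / 2", rule_format, of "pi / 2 + e"] \<kappa> by auto
    ultimately show False by (smt (verit))
  qed
  then obtain t1 where t1: "t0 \<le> t1" "t1 < T" "u t1 \<le> e" by auto
  have "u t \<le> 3 * e" if "t1 \<le> t" "t < T" for t
    using well_barrier[OF t1(1) that e _ t1(3)] e3 by simp
  then show ?thesis using t1 by auto
qed

end

section \<open>Convergence of the angle in the wells of the drift\<close>

lemma limit_at_left_if_Cauchy:
  fixes X :: "real \<Rightarrow> real"
  assumes "\<And>e. 0 < e \<Longrightarrow> \<exists>t1<T. \<forall>s t. t1 \<le> s \<and> s < T \<and> t1 \<le> t \<and> t < T \<longrightarrow> \<bar>X s - X t\<bar> \<le> e"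
  shows "\<exists>l. (X \<longlongrightarrow> l) (at_left T)"
proof -
  have "cauchy_filter (filtermap X (at_left T))"
    unfolding cauchy_filter_metric_filtermap
  proof (intro allI impI)
    fix e :: real assume "0 < e"
    then obtain t1 where t1: "t1 < T" "\<forall>s t. t1 \<le> s \<and> s < T \<and> t1 \<le> t \<and> t < T \<longrightarrow> \<bar>X s - X t\<bar> \<le> e / 2"
      using assms[of "e / 2"] by auto
    show "\<exists>P. eventually P (at_left T) \<and> (\<forall>x y. P x \<and> P y \<longrightarrow> dist (X x) (X y) < e)"
    proof (intro exI[of _ "\<lambda>t. t1 < t \<and> t < T"] conjI allI impI)
      show "eventually (\<lambda>t. t1 < t \<and> t < T) (at_left T)"
        using eventually_at_left_real[OF t1(1)] by simp
      fix x y assume "(t1 < x \<and> x < T) \<and> (t1 < y \<and> y < T)"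
      then have "\<bar>X x - X y\<bar> \<le> e / 2" using t1(2) by simp
      then show "dist (X x) (X y) < e" using \<open>0 < e\<close> by (simp add: dist_real_def)
    qed
  qed
  then obtain l where "filtermap X (at_left T) \<le> nhds l"
    using cauchy_filter_complete_converges[of "filtermap X (at_left T)" UNIV] complete_UNIV
    by (auto simp: filtermap_bot_iff)
  then show ?thesis unfolding filterlim_def by blast
qed

text \<open>Between two neighbouring walls \<open>cos\<close> has the sign of
  \<open>cos (pi * n)\<close>, the value at the centre, and the same sign appears in
  \<open>sin\<close>. The two cancel in the product of \<open>sin\<close> and
  \<open>wall_sgn\<close>, leaving a drift that pulls towards the centre
  \<open>pi * n\<close>.\<close>

lemma integrand_sign_in_well:
  fixes X :: real and n :: int
  assumes "\<bar>X - pi * n\<bar> < pi / 2"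
  shows "pn_mu2 v N \<rho> X = - ((N - 1) * v * sin (X - pi * n) / \<rho>)"
proof -
  let ?u = "X - pi * n"
  have cu: "0 < cos ?u" using assms by (intro cos_gt_zero_pi) linarith+
  have pn: "sin (pi * n) = 0" "\<bar>cos (pi * n)\<bar> = 1"
    by (auto simp: sin_npi_int mult.commute cos_npi_int)
  have X: "X = ?u + pi * n" by simp
  have s: "sin X = sin ?u * cos (pi * n)" by (subst X, subst sin_add) (simp add: pn)
  have c: "cos X = cos ?u * cos (pi * n)" by (subst X, subst cos_add) (simp add: pn)
  have "cos (pi * n) = 1 \<or> cos (pi * n) = - 1" using pn(2) by linarith
  then have "sin X * wall_sgn X = sin ?u"
    unfolding wall_sgn_def c s using cu by auto
  moreover have "pn_mu2 v N \<rho> X = - ((N - 1) * v * (sin X * wall_sgn X) / \<rho>)"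
    unfolding pn_mu2_eq by (simp only: mult_minus_left minus_divide_left mult.assoc)
  ultimately show ?thesis by simp
qed

text \<open>The bound R t \<le> v * (T - t) turns the pull towards the centre into a rate of at
  least (N - 1) * sin e / (T - s) outside the e-neighbourhood of the centre. This gives \<kappa> =
  (N - 1) * sin e, positive because N > 1; v cancels.\<close>

lemma well_capture_solution:
  fixes R X w :: "real \<Rightarrow> real" and T e c :: real and n :: int
  assumes v: "0 < v" "1 < N" and t0: "0 \<le> t0" "t0 < T"
    and R_pos: "\<And>t. 0 \<le> t \<Longrightarrow> t < T \<Longrightarrow> 0 < R t" and R_le: "\<And>t. 0 \<le> t \<Longrightarrow> t < T \<Longrightarrow> R t \<le> v * (T - t)"
    and cont: "continuous_on {0..<T} X"
    and int: "\<And>t. 0 \<le> t \<Longrightarrow> t < T \<Longrightarrow> set_integrable lborel {0..t} (\<lambda>s. pn_mu2 v N (R s) (X s))"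
    and eq: "\<And>t. 0 \<le> t \<Longrightarrow> t < T \<Longrightarrow> X t = \<theta> + (LBINT s:{0..t}. pn_mu2 v N (R s) (X s)) + w t"
    and osc: "\<And>s t. t0 \<le> s \<Longrightarrow> s \<le> t \<Longrightarrow> t < T \<Longrightarrow> \<bar>w t - w s\<bar> \<le> e"
    and e: "0 < e" "3 * e < pi / 2" and u0: "\<bar>X t0 - pi * n\<bar> \<le> \<alpha>" and \<alpha>: "0 < \<alpha>" "\<alpha> + 2 * e < pi / 2"
  shows "\<exists>t1. t0 \<le> t1 \<and> t1 < T \<and> (\<forall>t. t1 \<le> t \<and> t < T \<longrightarrow> \<bar>X t - pi * n\<bar> \<le> 3 * e)"
proof -
  have pos: "0 < (N - 1) * v" using v by simp
  have e2: "e < pi / 2" using e by linarith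
  \<comment> \<open>The well is symmetric, so the bounds from above and from below are the same
    argument for \<delta> = 1 and \<delta> = - 1.\<close>
  have up: "\<exists>t1. t0 \<le> t1 \<and> t1 < T \<and> (\<forall>t. t1 \<le> t \<and> t < T \<longrightarrow> \<delta> * (X t - pi * n) \<le> 3 * e)"
    if \<delta>: "\<delta> = 1 \<or> \<delta> = - 1" for \<delta> :: real
  proof -
    define u where "u = (\<lambda>t. \<delta> * (X t - pi * n))"
    define A where "A = (\<lambda>t. \<delta> * (LBINT s:{0..t}. pn_mu2 v N (R s) (X s)))"
    have drift: "\<delta> * pn_mu2 v N (R x) (X x) = - ((N - 1) * v * sin (u x) / R x)"
      if "0 < u x" "u x < pi / 2" for x
    proof -
      have "\<bar>X x - pi * n\<bar> < pi / 2" using that \<delta> unfolding u_def by auto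
      note p = integrand_sign_in_well[OF this, of v N "R x"]
      have "sin (u x) = \<delta> * sin (X x - pi * n)"
        using \<delta> unfolding u_def by (elim disjE) (simp_all only: mult_1 mult_minus1 sin_minus)
      then show ?thesis unfolding p by simp
    qed
    have A_le: "A t - A s \<le> c * (t - s)"
      if st: "t0 \<le> s" "s \<le> t" "t < T" and "\<And>x. s \<le> x \<Longrightarrow> x \<le> t \<Longrightarrow> \<delta> * pn_mu2 v N (R x) (X x) \<le> c" for s t c
    proof -
      have "set_integrable lborel {0..t} (\<lambda>s. \<delta> * pn_mu2 v N (R s) (X s))"
        using int[of t] st t0 by (intro set_integrable_mult_right) auto
      from integral_increment_upper[OF this _ st(2) order_refl that(4)] st t0
      show ?thesis unfolding A_def by simp
    qed
    have "\<exists>t1. t0 \<le> t1 \<and> t1 < T \<and> (\<forall>t. t1 \<le> t \<and> t < T \<longrightarrow> u t \<le> 3 * e)"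
    proof (rule well_capture[where a = A and \<kappa> = "(N - 1) * sin e" and \<alpha> = \<alpha>])
      show "0 < (N - 1) * sin e" using v e e2 sin_gt_zero[of e] by (intro mult_pos_pos) auto
      show "continuous_on {t0..<T} u" unfolding u_def
        using t0 by (intro continuous_intros continuous_on_subset[OF cont]) auto
      show "\<bar>(u t - A t) - (u s - A s)\<bar> \<le> e" if "t0 \<le> s" "s \<le> t" "t < T" for s t
      proof -
        have "(u t - A t) - (u s - A s) = \<delta> * (w t - w s)"
          using eq[of s] eq[of t] that t0 unfolding u_def A_def by (simp add: algebra_simps)
        then show ?thesis using osc[OF that] \<delta> by auto
      qed
      show "A t \<le> A s" if st: "t0 \<le> s" "s \<le> t" "t < T" and b: "\<And>x. s \<le> x \<Longrightarrow> x \<le> t \<Longrightarrow> 0 < u x \<and> u x < pi / 2" for s t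
      proof -
        have "\<delta> * pn_mu2 v N (R x) (X x) \<le> 0" if x: "s \<le> x" "x \<le> t" for x
        proof -
          have "0 \<le> sin (u x)" using b[OF x] by (intro sin_ge_zero) auto
          then show ?thesis using drift[of x] b[OF x] R_pos[of x] pos st x t0 by simp
        qed
        from A_le[OF st this] show ?thesis by simp
      qed
      show "A t \<le> A s - (N - 1) * sin e * ((t - s) / (T - s))"
        if st: "t0 \<le> s" "s \<le> t" "t < T" and b: "\<And>x. s \<le> x \<Longrightarrow> x \<le> t \<Longrightarrow> e \<le> u x \<and> u x < pi / 2" for s t
      proof -
        have "\<delta> * pn_mu2 v N (R x) (X x) \<le> - ((N - 1) * sin e / (T - s))" if x: "s \<le> x" "x \<le> t" for x
        proof -
          have x0: "0 \<le> x" "x < T" using st x t0 by auto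
          have "sin e \<le> sin (u x)" using b[OF x] e by (intro sin_monotone_2pi_le) auto
          moreover have "R x \<le> v * (T - s)"
          proof -
            have "v * (T - x) \<le> v * (T - s)" by (rule mult_left_mono) (use x v in auto)
            then show ?thesis using R_le[OF x0] by linarith
          qed
          ultimately have "(N - 1) * v * sin e / (v * (T - s)) \<le> (N - 1) * v * sin (u x) / R x"
            using R_pos[OF x0] pos sin_gt_zero[of e] e e2 v
            by (intro frac_le mult_left_mono mult_nonneg_nonneg) auto
          moreover have "(N - 1) * v * sin e / (v * (T - s)) = (N - 1) * sin e / (T - s)" using v by simp
          ultimately show ?thesis using drift[of x] b[OF x] e by simp
        qed
        from A_le[OF st this] show ?thesis by (simp add: field_simps)
      qed
      show "u t0 \<le> \<alpha>" using u0 \<delta> unfolding u_def by auto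
    qed (use t0 e \<alpha> in auto)
    then show ?thesis unfolding u_def .
  qed
  obtain t1 where t1: "t0 \<le> t1" "t1 < T" "\<And>t. t1 \<le> t \<Longrightarrow> t < T \<Longrightarrow> X t - pi * n \<le> 3 * e"
    using up[of 1] by auto
  obtain t2 where t2: "t0 \<le> t2" "t2 < T" "\<And>t. t2 \<le> t \<Longrightarrow> t < T \<Longrightarrow> - (X t - pi * n) \<le> 3 * e"
    using up[of "- 1"] by auto
  show ?thesis
  proof (intro exI[of _ "max t1 t2"] conjI allI impI)
    fix t assume "max t1 t2 \<le> t \<and> t < T"
    then show "\<bar>X t - pi * n\<bar> \<le> 3 * e" using t1(3)[of t] t2(3)[of t] by auto
  qed (use t1 t2 in auto)
qed

text \<open>Either \<open>cos\<close> tends to 0 along the path, and a continuous angle cannot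
  oscillate without crossing points away from the walls. Or the angle is at least some fixed c away
  from the walls at times arbitrarily close to T; then it is captured in a well, with any precision
  if the capture starts late enough for the remaining oscillation of the noise to be small.\<close>

lemma angle_limit_exists:
  fixes R X w :: "real \<Rightarrow> real" and T :: real
  assumes v: "0 < v" "1 < N" and T: "0 < T"
    and R_pos: "\<And>t. 0 \<le> t \<Longrightarrow> t < T \<Longrightarrow> 0 < R t" and R_le: "\<And>t. 0 \<le> t \<Longrightarrow> t < T \<Longrightarrow> R t \<le> v * (T - t)"
    and cont: "continuous_on {0..<T} X" and wcont: "continuous_on {0..T} w"
    and int: "\<And>t. 0 \<le> t \<Longrightarrow> t < T \<Longrightarrow> set_integrable lborel {0..t} (\<lambda>s. pn_mu2 v N (R s) (X s))"
    and eq: "\<And>t. 0 \<le> t \<Longrightarrow> t < T \<Longrightarrow> X t = \<theta> + (LBINT s:{0..t}. pn_mu2 v N (R s) (X s)) + w t"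
  shows "\<exists>l. (X \<longlongrightarrow> l) (at_left T)"
proof (cases "\<forall>c>0. \<exists>t1<T. \<forall>t. t1 \<le> t \<and> t < T \<longrightarrow> \<bar>cos (X t)\<bar> < c")
  case True
  show ?thesis
  proof (rule limit_at_left_if_Cauchy)
    fix e :: real assume "0 < e"
    define d where "d = min e 1"
    have d: "0 < d" "d \<le> e" "d \<le> 1" "0 < sin d" unfolding d_def using \<open>0 < e\<close> pi_gt3 by (auto intro!: sin_gt_zero)
    obtain t1 where t1: "t1 < T" "\<And>t. t1 \<le> t \<Longrightarrow> t < T \<Longrightarrow> \<bar>cos (X t)\<bar> < sin d / 2"
      using True[rule_format, of "sin d / 2"] d by auto
    define t2 where "t2 = max t1 0"
    have t2: "t2 < T" "0 \<le> t2" "t1 \<le> t2" unfolding t2_def using t1 T by auto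
    \<comment> \<open>An oscillation by d makes the angle take both values b and b + d near walls.
      But sin d, expanded as the sine of (b + d) - b, is at most \<bar>cos b\<bar> + \<bar>cos (b +
      d)\<bar>, which is less than sin d.\<close>
    have no: "\<not> (X x \<le> b \<and> b + d \<le> X y)" if xy: "t2 \<le> x" "x < T" "t2 \<le> y" "y < T" for x y b
    proof
      assume b: "X x \<le> b \<and> b + d \<le> X y"
      have "connected (X ` {t2..<T})"
        using t2 by (intro connected_continuous_image continuous_on_subset[OF cont]) auto
      moreover have "X x \<in> X ` {t2..<T}" "X y \<in> X ` {t2..<T}" using xy by auto
      ultimately have "{X x..X y} \<subseteq> X ` {t2..<T}" by (rule connected_contains_Icc)
      then have "b \<in> X ` {t2..<T}" "b + d \<in> X ` {t2..<T}" using b d by auto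
      then have "\<bar>cos b\<bar> < sin d / 2" "\<bar>cos (b + d)\<bar> < sin d / 2" using t1(2) t2 by auto
      moreover have "sin d = sin (b + d) * cos b - cos (b + d) * sin b"
        using sin_diff[of "b + d" b] by simp
      moreover have "sin (b + d) * cos b \<le> \<bar>cos b\<bar>"
        using mult_mono[of "\<bar>sin (b + d)\<bar>" 1 "\<bar>cos b\<bar>" "\<bar>cos b\<bar>"] abs_ge_self[of "sin (b + d) * cos b"]
        by (simp add: abs_mult)
      moreover have "- (cos (b + d) * sin b) \<le> \<bar>cos (b + d)\<bar>"
        using mult_mono[of "\<bar>cos (b + d)\<bar>" "\<bar>cos (b + d)\<bar>" "\<bar>sin b\<bar>" 1] abs_ge_minus_self[of "cos (b + d) * sin b"]
        by (simp add: abs_mult)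
      ultimately show False by linarith
    qed
    show "\<exists>t1<T. \<forall>s t. t1 \<le> s \<and> s < T \<and> t1 \<le> t \<and> t < T \<longrightarrow> \<bar>X s - X t\<bar> \<le> e"
    proof (intro exI[of _ t2] conjI allI impI t2(1))
      fix s t assume "t2 \<le> s \<and> s < T \<and> t2 \<le> t \<and> t < T"
      then show "\<bar>X s - X t\<bar> \<le> e" using no[of s t "X s"] no[of t s "X t"] d by auto
    qed
  qed
next
  case False
  then obtain c where c: "0 < c" "\<And>t1. t1 < T \<Longrightarrow> \<exists>t. t1 \<le> t \<and> t < T \<and> c \<le> \<bar>cos (X t)\<bar>"
    by (force simp: not_less)
  show ?thesis
  proof (rule limit_at_left_if_Cauchy)
    fix e0 :: real assume "0 < e0"
    have c1: "c \<le> 1" using c(2)[of 0] T abs_cos_le_one order_trans by blast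
    \<comment> \<open>The bound e0 / 6 serves two times within 3 * e of the centre; c / 4 makes pi /
      2 - c an admissible starting level, since adding 2 * e to it stays below pi / 2.\<close>
    define e where "e = min (e0 / 6) (c / 4)"
    have e: "0 < e" "6 * e \<le> e0" "4 * e \<le> c" unfolding e_def using \<open>0 < e0\<close> c by auto
    have "uniformly_continuous_on {0..T} w" by (rule compact_uniformly_continuous[OF wcont]) simp
    then obtain d where d: "0 < d" "\<And>s t. s \<in> {0..T} \<Longrightarrow> t \<in> {0..T} \<Longrightarrow> dist s t < d \<Longrightarrow> dist (w s) (w t) < e"
      using e(1) unfolding uniformly_continuous_on_def by metis
    obtain t0 where t0: "max 0 (T - d / 2) \<le> t0" "t0 < T" "c \<le> \<bar>cos (X t0)\<bar>"
      using c(2)[of "max 0 (T - d / 2)"] T d by auto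
    \<comment> \<open>The nearest centre. Its distance y from the angle satisfies c \<le> cos y =
      sin (pi / 2 - y) \<le> pi / 2 - y, which is the starting level required for the
      capture.\<close>
    define n where "n = round (X t0 / pi)"
    define y where "y = \<bar>X t0 - pi * n\<bar>"
    have "\<bar>real_of_int n - X t0 / pi\<bar> \<le> 1 / 2" unfolding n_def by (rule of_int_round_abs_le)
    then have "pi * \<bar>real_of_int n - X t0 / pi\<bar> \<le> pi * (1 / 2)" by (intro mult_left_mono) auto
    moreover have "pi * \<bar>real_of_int n - X t0 / pi\<bar> = y"
    proof -
      have "pi * \<bar>real_of_int n - X t0 / pi\<bar> = \<bar>pi * (real_of_int n - X t0 / pi)\<bar>" by (simp add: abs_mult)
      also have "pi * (real_of_int n - X t0 / pi) = pi * n - X t0" by (simp add: field_simps)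
      finally show ?thesis unfolding y_def by (simp add: abs_minus_commute)
    qed
    ultimately have y: "y \<le> pi / 2" by simp
    have "\<bar>cos (X t0)\<bar> = cos y"
    proof -
      have X: "X t0 = (X t0 - pi * n) + pi * n" by simp
      have pn: "sin (pi * n) = 0" "\<bar>cos (pi * n)\<bar> = 1"
        by (auto simp: sin_npi_int mult.commute cos_npi_int)
      have "cos (X t0) = cos (X t0 - pi * n) * cos (pi * n)" by (subst X, subst cos_add) (simp add: pn)
      then have "\<bar>cos (X t0)\<bar> = \<bar>cos (X t0 - pi * n)\<bar>" by (simp add: abs_mult pn)
      also have "\<dots> = \<bar>cos y\<bar>" unfolding y_def by simp
      also have "\<dots> = cos y"
      proof -
        have "0 \<le> y" unfolding y_def by simp
        then have "0 \<le> cos y" using y by (intro cos_ge_zero) linarith+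
        then show ?thesis by simp
      qed
      finally show ?thesis .
    qed
    also have "cos y = sin (pi / 2 - y)" by (simp add: cos_sin_eq)
    also have "\<dots> \<le> pi / 2 - y" using y by (intro sin_x_le_x) auto
    finally have yc: "y \<le> pi / 2 - c" using t0(3) by linarith
    have "\<exists>t1. t0 \<le> t1 \<and> t1 < T \<and> (\<forall>t. t1 \<le> t \<and> t < T \<longrightarrow> \<bar>X t - pi * n\<bar> \<le> 3 * e)"
    proof (rule well_capture_solution[OF v _ t0(2) R_pos R_le cont int eq _ e(1), where \<alpha> = "pi / 2 - c"])
      show "\<bar>w t - w s\<bar> \<le> e" if "t0 \<le> s" "s \<le> t" "t < T" for s t
      proof -
        have "dist (w t) (w s) < e" using that t0(1) d(1) by (intro d(2)) (auto simp: dist_real_def)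
        then show ?thesis by (simp add: dist_real_def)
      qed
    qed (use t0 e c1 c(1) yc pi_gt3 in \<open>auto simp: y_def\<close>)
    then obtain t1 where t1: "t0 \<le> t1" "t1 < T" "\<And>t. t1 \<le> t \<Longrightarrow> t < T \<Longrightarrow> \<bar>X t - pi * n\<bar> \<le> 3 * e" by auto
    show "\<exists>t1<T. \<forall>s t. t1 \<le> s \<and> s < T \<and> t1 \<le> t \<and> t < T \<longrightarrow> \<bar>X s - X t\<bar> \<le> e0"
    proof (intro exI[of _ t1] conjI allI impI t1(2))
      fix s t assume "t1 \<le> s \<and> s < T \<and> t1 \<le> t \<and> t < T"
      then show "\<bar>X s - X t\<bar> \<le> e0" using t1(3)[of s] t1(3)[of t] e(2) by auto
    qed
  qed
qed

section \<open>The limit of the schemes\<close>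

text \<open>Taking the upper limit makes the radius nonincreasing for every path, not just almost surely, so its
  hitting time is determined by its values at rational times without completing the filtration.\<close>

definition limit_R :: "real \<Rightarrow> real \<Rightarrow> real \<Rightarrow> real \<Rightarrow> (nat \<Rightarrow> nat) \<Rightarrow> (real \<Rightarrow> real) \<Rightarrow> real \<Rightarrow> real" where
  "limit_R v N r \<theta> p w t = real_of_ereal (limsup (\<lambda>k. ereal (max 0 (fst (step_euler v N r \<theta> k (p k) w t)))))"

text \<open>Where the schemes do not converge, \<open>lim\<close> returns an unspecified value. The
  limit is evaluated for solving the equations only where the limiting radius is positive, and there
  convergence is proved.\<close>

definition limit_X :: "real \<Rightarrow> real \<Rightarrow> real \<Rightarrow> real \<Rightarrow> (nat \<Rightarrow> nat) \<Rightarrow> (real \<Rightarrow> real) \<Rightarrow> real \<Rightarrow> real" where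
  "limit_X v N r \<theta> p w t = lim (\<lambda>k. snd (step_euler v N r \<theta> k (p k) w t))"

lemma grid_index_mono: "s \<le> t \<Longrightarrow> nat \<lfloor>s * 2^p\<rfloor> \<le> nat \<lfloor>t * 2^p\<rfloor>"
  by (intro nat_mono floor_mono mult_right_mono) auto

lemma step_euler_fst_antimono:
  "0 \<le> v \<Longrightarrow> s \<le> t \<Longrightarrow> fst (step_euler v N r \<theta> k p w t) \<le> fst (step_euler v N r \<theta> k p w s)"
  unfolding step_euler_def by (intro euler_fst_antimono grid_index_mono)

lemma step_euler_fst_le: "0 \<le> v \<Longrightarrow> fst (step_euler v N r \<theta> k p w t) \<le> r"
  unfolding step_euler_def
  using euler_fst_antimono[of v 0 _ N r \<theta> k p w] by (simp add: level_euler_def)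

lemma step_euler_fst_lower:
  assumes "0 \<le> v" "0 \<le> s" "s \<le> t"
  shows "fst (step_euler v N r \<theta> k p w s) - v * (t - s) - v * mesh p \<le> fst (step_euler v N r \<theta> k p w t)"
proof -
  let ?i = "nat \<lfloor>s * 2^p\<rfloor>" and ?j = "nat \<lfloor>t * 2^p\<rfloor>"
  have "mesh p * (real ?j - real ?i) \<le> (t - s) + mesh p"
    using grid_index(1)[of t p] grid_index(2)[of s p] assms by (simp add: algebra_simps)
  then have "v * (mesh p * (real ?j - real ?i)) \<le> v * ((t - s) + mesh p)"
    using assms by (intro mult_left_mono)
  then show ?thesis
    using euler_fst_lower[OF assms(1) grid_index_mono[OF assms(3), of p], of N r \<theta> k p w]
    unfolding step_euler_def by (simp add: algebra_simps)
qed

text \<open>The truncated radii lie between 0 and r, so their upper limit is finite and the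
  conversion to a real number loses nothing.\<close>

lemma limit_R_ereal:
  assumes "0 \<le> v" "0 \<le> r"
  shows "ereal (limit_R v N r \<theta> p w t) = limsup (\<lambda>k. ereal (max 0 (fst (step_euler v N r \<theta> k (p k) w t))))"
    and "0 \<le> limit_R v N r \<theta> p w t" and "limit_R v N r \<theta> p w t \<le> r"
proof -
  let ?L = "limsup (\<lambda>k. ereal (max 0 (fst (step_euler v N r \<theta> k (p k) w t))))"
  have 1: "?L \<le> ereal r"
    using step_euler_fst_le[OF assms(1)] assms(2) by (intro Limsup_bounded always_eventually) auto
  have 2: "ereal 0 \<le> ?L"
    by (rule order_trans[OF _ Liminf_le_Limsup]) (auto intro!: Liminf_bounded always_eventually simp: zero_ereal_def)
  from 1 2 obtain x where x: "?L = ereal x" by (cases ?L) auto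
  show "ereal (limit_R v N r \<theta> p w t) = ?L" "0 \<le> limit_R v N r \<theta> p w t" "limit_R v N r \<theta> p w t \<le> r"
    using 1 2 unfolding limit_R_def x by auto
qed

lemma limit_R_antimono:
  assumes "0 \<le> v" "0 \<le> r" "s \<le> t"
  shows "limit_R v N r \<theta> p w t \<le> limit_R v N r \<theta> p w s"
proof -
  have "ereal (limit_R v N r \<theta> p w t) \<le> ereal (limit_R v N r \<theta> p w s)"
    unfolding limit_R_ereal(1)[OF assms(1,2)]
  proof (intro Limsup_mono always_eventually allI)
    show "ereal (max 0 (fst (step_euler v N r \<theta> k (p k) w t))) \<le> ereal (max 0 (fst (step_euler v N r \<theta> k (p k) w s)))" for k
      unfolding ereal_less_eq by (rule max.mono[OF order_refl step_euler_fst_antimono[OF assms(1,3)]])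
  qed
  then show ?thesis by simp
qed

lemma step_euler_borel [measurable]:
  "(\<lambda>s. fst (step_euler v N r \<theta> k p w s)) \<in> borel_measurable borel"
  "(\<lambda>s. snd (step_euler v N r \<theta> k p w s)) \<in> borel_measurable borel"
proof -
  have i: "(\<lambda>s::real. nat \<lfloor>s * 2^p\<rfloor>) \<in> measurable borel (count_space UNIV)" by measurable
  show "(\<lambda>s. fst (step_euler v N r \<theta> k p w s)) \<in> borel_measurable borel"
    "(\<lambda>s. snd (step_euler v N r \<theta> k p w s)) \<in> borel_measurable borel"
    unfolding step_euler_def by (rule measurable_compose[OF i]; simp)+
qed

lemma limit_borel [measurable]:
  "limit_R v N r \<theta> p w \<in> borel_measurable borel" "limit_X v N r \<theta> p w \<in> borel_measurable borel"
  unfolding limit_R_def[abs_def] limit_X_def[abs_def] by measurable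

lemma step_function_integral:
  fixes g :: "nat \<Rightarrow> real"
  assumes "\<And>i. \<bar>g i\<bar> \<le> C"
  shows "(LBINT s:{0..mesh p * real n}. g (nat \<lfloor>s * 2^p\<rfloor>)) = (\<Sum>i<n. mesh p * g i)"
proof -
  have i: "(\<lambda>s::real. nat \<lfloor>s * 2^p\<rfloor>) \<in> measurable borel (count_space UNIV)" by measurable
  have "(\<lambda>s::real. g (nat \<lfloor>s * 2^p\<rfloor>)) \<in> borel_measurable borel" by (rule measurable_compose[OF i]) simp
  then have int: "set_integrable lborel {0..S} (\<lambda>s::real. g (nat \<lfloor>s * 2^p\<rfloor>))" for S
    using assms by (intro set_integrable_bounded[where C = C])
  show ?thesis
  proof (induction n)
    case 0 then show ?case by (simp add: set_integral_singleton)
  next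
    case (Suc n)
    let ?a = "mesh p * real n" and ?b = "mesh p * real (Suc n)"
    have ab: "0 \<le> ?a" "?a \<le> ?b" "?b - ?a = mesh p" using mesh_pos[of p] by (auto simp: algebra_simps)
    \<comment> \<open>On the half-open grid interval the integrand is the constant
      \<open>g n\<close>, so the approximation holds with error rate 0.\<close>
    have "\<bar>(LBINT s:{0..?b}. g (nat \<lfloor>s * 2^p\<rfloor>)) - (LBINT s:{0..?a}. g (nat \<lfloor>s * 2^p\<rfloor>)) - g n * (?b - ?a)\<bar> \<le> 0 * (?b - ?a)"
      by (rule integral_increment_approx[OF int ab(1,2) order_refl]) (use grid_index_unique in simp)
    then show ?case using Suc.IH unfolding ab(3) sum.lessThan_Suc mult.commute[of "mesh p" "g n"] by simp
  qed
qed

lemma wall_sgn_tendsto: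
  fixes f :: "'b \<Rightarrow> real"
  assumes "(f \<longlongrightarrow> x) F" "cos x \<noteq> 0"
  shows "((\<lambda>s. wall_sgn (f s)) \<longlongrightarrow> wall_sgn x) F"
proof -
  have c: "((\<lambda>s. cos (f s)) \<longlongrightarrow> cos x) F" by (rule isCont_tendsto_compose[OF isCont_cos assms(1)])
  have "eventually (\<lambda>s. wall_sgn (f s) = wall_sgn x) F"
  proof (cases "0 < cos x")
    case True
    from order_tendstoD(1)[OF c True] show ?thesis by eventually_elim (use True in \<open>auto simp: wall_sgn_def\<close>)
  next
    case False
    then have neg: "cos x < 0" using assms(2) by simp
    from order_tendstoD(2)[OF c neg] show ?thesis by eventually_elim (use neg in \<open>auto simp: wall_sgn_def\<close>)
  qed
  then show ?thesis by (rule tendsto_eventually)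
qed

section \<open>Convergence of the schemes along a single path\<close>

locale scheme_path =
  fixes v N r \<theta> :: real and \<eta> :: "nat \<Rightarrow> real" and p :: "nat \<Rightarrow> nat" and w :: "real \<Rightarrow> real"
  assumes v_pos: "0 < v" and N_gt: "1 < N" and r_pos: "0 < r"
    and \<eta>_pos: "\<And>k. 0 < \<eta> k" and p_mono: "mono p"
    and K_mesh: "\<And>k. level_K v N k * mesh (p k) \<le> \<eta> k / 4" and v_mesh: "\<And>k. v * mesh (p k) \<le> \<eta> k / 4"
    and good: "eventually (\<lambda>k. good_level v N r \<theta> k (p k) (\<eta> k) w) sequentially"
    and w_cont: "continuous_on {0..} w" and w0: "w 0 = 0"
begin

abbreviation Rs :: "nat \<Rightarrow> real \<Rightarrow> real" where
  "Rs k t \<equiv> fst (step_euler v N r \<theta> k (p k) w t)"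

abbreviation Xs :: "nat \<Rightarrow> real \<Rightarrow> real" where
  "Xs k t \<equiv> snd (step_euler v N r \<theta> k (p k) w t)"

abbreviation Rl :: "real \<Rightarrow> real" where
  "Rl \<equiv> limit_R v N r \<theta> p w"

abbreviation Xl :: "real \<Rightarrow> real" where
  "Xl \<equiv> limit_X v N r \<theta> p w"

definition round_down :: "nat \<Rightarrow> real \<Rightarrow> real" where
  "round_down k t = mesh (p k) * real (nat \<lfloor>t * 2^(p k)\<rfloor>)"

lemmas v0 = less_imp_le[OF v_pos]

lemma level_pathI: "good_level v N r \<theta> k (p k) (\<eta> k) w \<Longrightarrow> level_path v N r \<theta> k (p k) (\<eta> k) w"
  using v_pos N_gt by (intro level_path.intro \<eta>_pos K_mesh v_mesh) auto

lemma round_down_le: "0 \<le> t \<Longrightarrow> round_down k t \<le> t"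
  unfolding round_down_def by (rule grid_index(1))

lemma round_down_gt: "t - mesh (p k) < round_down k t" if "0 \<le> t"
  using grid_index(2)[OF that, of "p k"] unfolding round_down_def by (simp add: distrib_left)

text \<open>The gap starts at \<eta> and never decreases, so on a good level \<eta> is at most
  \<open>(1/2)^k\<close>, and \<open>v * mesh\<close> is at most a quarter of that.\<close>

lemma mesh_to_0: "(\<lambda>k. mesh (p k)) \<longlonglongrightarrow> 0"
proof (rule tendsto_sandwich[OF _ _ tendsto_const])
  show "eventually (\<lambda>k. mesh (p k) \<le> (1 / 2)^k * (1 / (4 * v))) sequentially"
    using good
  proof eventually_elim
    case (elim k)
    interpret level_path v N r \<theta> k "p k" "\<eta> k" w by (rule level_pathI[OF elim])
    have "\<eta> k \<le> (1 / 2)^k"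
      using gap_bounds(1)[of "level_end k (p k)"] elim unfolding good_level_def by linarith
    then have "v * mesh (p k) \<le> (1 / 2)^k / 4" using v_mesh by linarith
    then show ?case using v_pos by (simp add: field_simps)
  qed
  have "(\<lambda>k. (1 / 2 :: real)^k) \<longlonglongrightarrow> 0" by (intro LIMSEQ_realpow_zero) auto
  then show "(\<lambda>k. (1 / 2)^k * (1 / (4 * v))) \<longlonglongrightarrow> 0" by (rule tendsto_mult_left_zero)
  show "eventually (\<lambda>k. 0 \<le> mesh (p k)) sequentially"
    by (rule always_eventually) (simp add: less_imp_le mesh_pos)
qed

lemma round_down_tendsto: "0 \<le> t \<Longrightarrow> (\<lambda>k. round_down k t) \<longlonglongrightarrow> t"
proof (rule tendsto_sandwich[OF _ _ _ tendsto_const])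
  assume t: "0 \<le> t"
  show "eventually (\<lambda>k. t - mesh (p k) \<le> round_down k t) sequentially"
    using round_down_gt[OF t] by (auto intro!: always_eventually less_imp_le)
  show "eventually (\<lambda>k. round_down k t \<le> t) sequentially" using round_down_le[OF t] by simp
  show "(\<lambda>k. t - mesh (p k)) \<longlonglongrightarrow> t" using tendsto_diff[OF tendsto_const mesh_to_0, of t] by simp
qed

text \<open>The scheme satisfies the integral equation with the upper limit rounded down to the
  grid, which is the shape the comparison expects of a finer level.\<close>

lemma Rs_integral: "Rs k t = r + (LBINT s:{0..round_down k t}. pn_mu1 v (Rs k s) (Xs k s))"
proof -
  let ?E = "level_euler v N r \<theta> k (p k) w"
  have e: "fst (?E n) = r + (\<Sum>i<n. mesh (p k) * pn_mu1 v (fst (?E i)) (snd (?E i)))" for n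
  proof (induction n)
    case (Suc n) then show ?case unfolding level_euler_fst_Suc sum.lessThan_Suc by linarith
  qed (simp add: level_euler_def)
  have i: "(LBINT s:{0..round_down k t}. pn_mu1 v (Rs k s) (Xs k s))
    = (\<Sum>i<nat \<lfloor>t * 2^p k\<rfloor>. mesh (p k) * pn_mu1 v (fst (?E i)) (snd (?E i)))"
    unfolding step_euler_def round_down_def
    by (rule step_function_integral[where C = v]) (rule abs_pn_mu1_le[OF v0])
  show ?thesis unfolding i unfolding step_euler_def by (rule e)
qed

lemma Xs_integral:
  "Xs k t = \<theta> + (LBINT s:{0..round_down k t}. pn_mu2 v N (max (Rs k s) (level_eps k)) (Xs k s)) + w (round_down k t)"
proof -
  let ?E = "level_euler v N r \<theta> k (p k) w"
  let ?g = "\<lambda>i. pn_mu2 v N (max (fst (?E i)) (level_eps k)) (snd (?E i))"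
  have e: "snd (?E n) = \<theta> + (\<Sum>i<n. mesh (p k) * ?g i) + w (mesh (p k) * real n)" for n
  proof (induction n)
    case (Suc n) then show ?case unfolding level_euler_snd_Suc sum.lessThan_Suc by linarith
  qed (simp add: level_euler_def w0)
  have i: "(LBINT s:{0..round_down k t}. pn_mu2 v N (max (Rs k s) (level_eps k)) (Xs k s))
    = (\<Sum>i<nat \<lfloor>t * 2^p k\<rfloor>. mesh (p k) * ?g i)"
    unfolding step_euler_def round_down_def
    by (rule step_function_integral[where C = "level_K v N k"])
      (use v_pos N_gt level_eps_pos in \<open>auto simp: level_K_def intro!: abs_pn_mu2_le\<close>)
  show ?thesis unfolding i unfolding step_euler_def round_down_def by (rule e)
qed

lemma level_eps_antimono: "k \<le> l \<Longrightarrow> level_eps l \<le> level_eps k"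
  by (simp add: level_eps_def frac_le)

lemma round_down_grid:
  assumes "k \<le> l"
  shows "round_down l (mesh (p k) * real i) = mesh (p k) * real i"
proof -
  have pl: "p k \<le> p l" using p_mono assms by (simp add: monoD)
  have "(2::real)^(p l) = 2^(p k) * 2^(p l - p k)" using pl by (simp flip: power_add)
  then have e: "mesh (p k) * real i = mesh (p l) * real (i * 2^(p l - p k))"
    unfolding mesh_def by simp
  show ?thesis unfolding round_down_def e grid_index_mult ..
qed

text \<open>The finer scheme l takes the place of the solution in the comparison with level k. Its
  radius is nonincreasing, so the single condition at time S keeps it above the coarser cut-off on
  the whole interval, where the smaller cut-off of level l is inactive as well.\<close>

lemma levels_compare:
  assumes gk: "good_level v N r \<theta> k (p k) (\<eta> k) w" and kl: "k \<le> l"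
    and S: "0 \<le> S" "S \<le> real (Suc k)" "level_eps k \<le> Rs l S" and u: "0 \<le> u" "u \<le> S"
  shows "\<bar>Xs l u - Xs k u\<bar> + \<bar>Rs l u - Rs k u\<bar> \<le> level_gap v N r \<theta> k (p k) (\<eta> k) w (nat \<lfloor>u * 2^(p k)\<rfloor>)"
proof -
  interpret level_path v N r \<theta> k "p k" "\<eta> k" w by (rule level_pathI[OF gk])
  have ge: "level_eps k \<le> Rs l t" if "t \<le> S" for t
    using step_euler_fst_antimono[OF v0 that, of N r \<theta> l "p l" w] S(3) by linarith
  have mx: "max (Rs l t) (level_eps l) = Rs l t" if "t \<le> S" for t
    using ge[OF that] level_eps_antimono[OF kl] by simp
  have mu2: "set_integrable lborel {0..S} (\<lambda>s. pn_mu2 v N (max (Rs l s) (level_eps l)) (Xs l s))"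
  proof (rule set_integrable_bounded)
    show "\<bar>pn_mu2 v N (max (Rs l s) (level_eps l)) (Xs l s)\<bar> \<le> level_K v N l" for s
      using v_pos N_gt level_eps_pos unfolding level_K_def by (intro abs_pn_mu2_le) auto
  qed measurable
  show ?thesis
  proof (rule comparison[where \<rho> = "round_down l" and S = S])
    show "round_down l s \<le> round_down l t" if "s \<le> t" for s t
      unfolding round_down_def using grid_index_mono[OF that] mesh_pos[of "p l"] by simp
    show "round_down l (mesh (p k) * real i) = mesh (p k) * real i" for i by (rule round_down_grid[OF kl])
    show "set_integrable lborel {0..S} (\<lambda>s. pn_mu1 v (Rs l s) (Xs l s))"
      by (rule set_integrable_bounded[where C = v]) (use abs_pn_mu1_le[OF v0] in auto)
    show "set_integrable lborel {0..S} (\<lambda>s. pn_mu2 v N (Rs l s) (Xs l s))"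
      using mu2 by (rule set_integrable_cong[THEN iffD1, rotated -1]) (auto simp: mx)
    show "Xs l t = \<theta> + (LBINT s:{0..round_down l t}. pn_mu2 v N (Rs l s) (Xs l s)) + (w (round_down l t) - w 0)"
      if t: "0 \<le> t" "t \<le> S" for t
    proof -
      have "(LBINT s:{0..round_down l t}. pn_mu2 v N (max (Rs l s) (level_eps l)) (Xs l s))
        = (LBINT s:{0..round_down l t}. pn_mu2 v N (Rs l s) (Xs l s))"
        using round_down_le[OF t(1), of l] t(2) by (intro set_lebesgue_integral_cong) (auto simp: mx)
      then show ?thesis using Xs_integral[of l t] w0 by simp
    qed
    show "Rs l t = r + (LBINT s:{0..round_down l t}. pn_mu1 v (Rs l s) (Xs l s))" for t
      by (rule Rs_integral)
    show "round_down l t \<le> t" if "0 \<le> t" for t by (rule round_down_le[OF that])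
    show "level_eps k \<le> Rs l t" if "t \<le> S" for t by (rule ge[OF that])
  qed (fact S u)+
qed

text \<open>A certificate that is uniform in the level: from k on all levels are good, t lies within
  their horizons, and all radii at time t are above one common cut-off. It is inherited by later
  levels and earlier times.\<close>

definition reached :: "nat \<Rightarrow> real \<Rightarrow> bool" where
  "reached k t \<longleftrightarrow> (\<forall>l\<ge>k. good_level v N r \<theta> l (p l) (\<eta> l) w) \<and> t \<le> real (Suc k) \<and> (\<forall>l\<ge>k. level_eps k \<le> Rs l t)"

lemma reached_mono:
  assumes R: "reached k t" and kl: "k \<le> l" and ut: "u \<le> t"
  shows "reached l u"
  unfolding reached_def
proof (intro conjI allI impI)
  show "good_level v N r \<theta> m (p m) (\<eta> m) w" if "l \<le> m" for m
    using R kl that unfolding reached_def by auto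
  have "t \<le> real (Suc k)" using R unfolding reached_def by blast
  then show "u \<le> real (Suc l)" using kl ut by simp
  show "level_eps l \<le> Rs m u" if "l \<le> m" for m
  proof -
    have "level_eps k \<le> Rs m t" using R kl that unfolding reached_def by auto
    then show ?thesis
      using level_eps_antimono[OF kl] step_euler_fst_antimono[OF v0 ut, of N r \<theta> m "p m" w] by linarith
  qed
qed

lemma reached_compare:
  assumes "reached k t" "k \<le> k'" "k' \<le> l" "0 \<le> u" "u \<le> t"
  shows "\<bar>Xs l u - Xs k' u\<bar> + \<bar>Rs l u - Rs k' u\<bar> \<le> level_gap v N r \<theta> k' (p k') (\<eta> k') w (nat \<lfloor>u * 2^(p k')\<rfloor>)"
    and "level_gap v N r \<theta> k' (p k') (\<eta> k') w (nat \<lfloor>u * 2^(p k')\<rfloor>) \<le> (1 / 2)^k'"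
proof -
  have "reached k' u" by (rule reached_mono[OF assms(1,2,5)])
  then have g: "good_level v N r \<theta> k' (p k') (\<eta> k') w" and u: "u \<le> real (Suc k')" and e: "level_eps k' \<le> Rs l u"
    using assms(3) unfolding reached_def by auto
  show "\<bar>Xs l u - Xs k' u\<bar> + \<bar>Rs l u - Rs k' u\<bar> \<le> level_gap v N r \<theta> k' (p k') (\<eta> k') w (nat \<lfloor>u * 2^(p k')\<rfloor>)"
    by (rule levels_compare[OF g assms(3,4) u e assms(4) order_refl])
  show "level_gap v N r \<theta> k' (p k') (\<eta> k') w (nat \<lfloor>u * 2^(p k')\<rfloor>) \<le> (1 / 2)^k'"
    by (rule level_path.gap_index_le[OF level_pathI[OF g] assms(4) u])
qed

text \<open>A positive upper limit c yields only infinitely many levels with radius above 3/4 * c at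
  time t. Every late level k' can be compared with such a finer one, from which it differs by less
  than c / 4, so all late levels have a radius above c / 2.\<close>

lemma positive_reached:
  assumes t: "0 \<le> t" and pos: "0 < Rl t"
  shows "\<exists>k. reached k t"
proof -
  let ?c = "Rl t"
  have "eventually (\<lambda>k. (1 / 2 :: real)^k < ?c / 4) sequentially"
    using pos by (intro order_tendstoD(2)[OF LIMSEQ_realpow_zero]) auto
  moreover have "eventually (\<lambda>k. level_eps k < ?c / 4) sequentially"
    unfolding level_eps_def using pos
    by (intro order_tendstoD(2)[OF LIMSEQ_Suc[OF lim_1_over_n]]) auto
  moreover have "eventually (\<lambda>k. t < real k) sequentially"
    using reals_Archimedean2[of t] by (meson eventually_sequentiallyI less_le_trans of_nat_mono)
  ultimately have "eventually (\<lambda>k. (1 / 2 :: real)^k < ?c / 4 \<and> level_eps k < ?c / 4 \<and> t < real k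
      \<and> good_level v N r \<theta> k (p k) (\<eta> k) w) sequentially"
    using good by eventually_elim auto
  then obtain k where k: "\<And>l. k \<le> l \<Longrightarrow> (1 / 2 :: real)^l < ?c / 4 \<and> level_eps l < ?c / 4 \<and> t < real l
      \<and> good_level v N r \<theta> l (p l) (\<eta> l) w"
    unfolding eventually_sequentially by auto
  have "level_eps k \<le> Rs k' t" if k': "k \<le> k'" for k'
  proof -
    have "\<exists>l\<ge>k'. 3 / 4 * ?c < Rs l t"
    proof (rule ccontr)
      assume "\<not> (\<exists>l\<ge>k'. 3 / 4 * ?c < Rs l t)"
      then have "eventually (\<lambda>l. ereal (max 0 (Rs l t)) \<le> ereal (3 / 4 * ?c)) sequentially"
        using pos unfolding eventually_sequentially by (intro exI[of _ k']) (auto simp: not_less)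
      then have "limsup (\<lambda>l. ereal (max 0 (Rs l t))) \<le> ereal (3 / 4 * ?c)" by (rule Limsup_bounded)
      then have "?c \<le> 3 / 4 * ?c"
        unfolding limit_R_ereal(1)[OF v0 less_imp_le[OF r_pos], symmetric] ereal_less_eq .
      then show False using pos by simp
    qed
    then obtain l where l: "k' \<le> l" "3 / 4 * ?c < Rs l t" by auto
    have kk: "level_eps k' < ?c / 4" "t \<le> real (Suc k')" "(1 / 2 :: real)^k' < ?c / 4"
      and g: "good_level v N r \<theta> k' (p k') (\<eta> k') w" using k[OF k'] by auto
    have "level_eps k' \<le> Rs l t" using kk l pos by linarith
    from levels_compare[OF g l(1) t kk(2) this t order_refl]
      level_path.gap_index_le[OF level_pathI[OF g] t kk(2)] kk(3)
    have "\<bar>Rs l t - Rs k' t\<bar> < ?c / 4" by linarith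
    then show ?thesis using l(2) k[OF order_refl] by linarith
  qed
  then have "reached k t" unfolding reached_def using k k[OF order_refl] by auto
  then show ?thesis ..
qed

lemma reached_limits:
  assumes R: "reached k t" and u: "0 \<le> u" "u \<le> t"
  shows "(\<lambda>l. Rs l u) \<longlonglongrightarrow> Rl u" "(\<lambda>l. Xs l u) \<longlonglongrightarrow> Xl u" "level_eps k \<le> Rl u"
proof -
  have C: "\<bar>Xs l u - Xs k' u\<bar> + \<bar>Rs l u - Rs k' u\<bar> \<le> (1 / 2)^k'" if "k \<le> k'" "k' \<le> l" for k' l
    using reached_compare(1)[OF R that u] reached_compare(2)[OF R that u] by (rule order_trans)
  have cauchy: "Cauchy (\<lambda>l. Rs l u)" "Cauchy (\<lambda>l. Xs l u)"
  proof -
    have half: "\<exists>M\<ge>k. (1 / 2 :: real)^M < e" if e: "0 < e" for e :: real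
    proof -
      have "eventually (\<lambda>k. (1 / 2 :: real)^k < e) sequentially"
        by (rule order_tendstoD(2)[OF LIMSEQ_realpow_zero e]) auto
      then have "eventually (\<lambda>m. k \<le> m \<and> (1 / 2 :: real)^m < e) sequentially"
        by (intro eventually_conj eventually_ge_at_top)
      then show ?thesis by (rule eventually_happens'[OF sequentially_bot])
    qed
    show "Cauchy (\<lambda>l. Rs l u)"
    proof (rule metric_CauchyI)
      fix e :: real assume "0 < e"
      then obtain M where M: "k \<le> M" "(1 / 2 :: real)^M < e / 2" using half[OF half_gt_zero] by blast
      have "dist (Rs m u) (Rs n u) < e" if "M \<le> m" "M \<le> n" for m n
        using C[OF M(1) that(1)] C[OF M(1) that(2)] M(2) unfolding dist_real_def by linarith
      then show "\<exists>M. \<forall>m\<ge>M. \<forall>n\<ge>M. dist (Rs m u) (Rs n u) < e" by blast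
    qed
    show "Cauchy (\<lambda>l. Xs l u)"
    proof (rule metric_CauchyI)
      fix e :: real assume "0 < e"
      then obtain M where M: "k \<le> M" "(1 / 2 :: real)^M < e / 2" using half[OF half_gt_zero] by blast
      have "dist (Xs m u) (Xs n u) < e" if "M \<le> m" "M \<le> n" for m n
        using C[OF M(1) that(1)] C[OF M(1) that(2)] M(2) unfolding dist_real_def by linarith
      then show "\<exists>M. \<forall>m\<ge>M. \<forall>n\<ge>M. dist (Xs m u) (Xs n u) < e" by blast
    qed
  qed
  then show "(\<lambda>l. Xs l u) \<longlonglongrightarrow> Xl u"
    unfolding limit_X_def by (intro convergent_LIMSEQ_iff[THEN iffD1] Cauchy_convergent)
  obtain L where L: "(\<lambda>l. Rs l u) \<longlonglongrightarrow> L" using cauchy(1) by (auto simp: Cauchy_convergent_iff convergent_def)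
  have ev: "eventually (\<lambda>l. level_eps k \<le> Rs l u) sequentially"
  proof (rule eventually_sequentiallyI)
    show "level_eps k \<le> Rs l u" if "k \<le> l" for l
      using reached_mono[OF R order_refl u(2)] that unfolding reached_def by blast
  qed
  have Lk: "level_eps k \<le> L" by (rule tendsto_lowerbound[OF L ev]) simp
  have "(\<lambda>l. ereal (max 0 (Rs l u))) \<longlonglongrightarrow> ereal (max 0 L)"
    unfolding lim_ereal by (rule tendsto_max[OF tendsto_const L])
  then have "limsup (\<lambda>l. ereal (max 0 (Rs l u))) = ereal (max 0 L)"
    by (rule lim_imp_Limsup[OF sequentially_bot])
  then have "Rl u = L" unfolding limit_R_def using Lk level_eps_pos[of k] by simp
  then show "(\<lambda>l. Rs l u) \<longlonglongrightarrow> Rl u" "level_eps k \<le> Rl u" using L Lk by auto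
qed

lemma reached_limit_compare:
  assumes R: "reached k t" and k': "k \<le> k'" and u: "0 \<le> u" "u \<le> t"
  shows "\<bar>Xl u - Xs k' u\<bar> \<le> level_gap v N r \<theta> k' (p k') (\<eta> k') w (nat \<lfloor>u * 2^(p k')\<rfloor>)"
proof (rule tendsto_upperbound)
  show "(\<lambda>l. \<bar>Xs l u - Xs k' u\<bar>) \<longlonglongrightarrow> \<bar>Xl u - Xs k' u\<bar>"
    by (rule tendsto_rabs[OF tendsto_diff[OF reached_limits(2)[OF R u] tendsto_const]])
  show "eventually (\<lambda>l. \<bar>Xs l u - Xs k' u\<bar> \<le> level_gap v N r \<theta> k' (p k') (\<eta> k') w (nat \<lfloor>u * 2^(p k')\<rfloor>)) sequentially"
  proof (rule eventually_sequentiallyI)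
    fix l assume "k' \<le> l"
    from reached_compare(1)[OF R k' this u]
    show "\<bar>Xs l u - Xs k' u\<bar> \<le> level_gap v N r \<theta> k' (p k') (\<eta> k') w (nat \<lfloor>u * 2^(p k')\<rfloor>)" by linarith
  qed
qed simp

text \<open>Dropping the Lipschitz part of the recursion leaves just the charges for the jump. A
  small gap is therefore also a bound on the time that the scheme spends in the strips around the
  walls.\<close>

lemma gap_counts_wall_visits:
  assumes g: "good_level v N r \<theta> k (p k) (\<eta> k) w"
  shows "2 * level_K v N k * (\<Sum>i<n. mesh (p k) * (if \<bar>cos (snd (level_euler v N r \<theta> k (p k) w i))\<bar>
      \<le> level_gap v N r \<theta> k (p k) (\<eta> k) w i then 1 else 0)) \<le> level_gap v N r \<theta> k (p k) (\<eta> k) w n"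
proof (induction n)
  case 0
  show ?case using \<eta>_pos[of k] by (simp add: level_gap_def)
next
  case (Suc n)
  let ?d = "level_gap v N r \<theta> k (p k) (\<eta> k) w n"
  interpret level_path v N r \<theta> k "p k" "\<eta> k" w by (rule level_pathI[OF g])
  have "0 \<le> ?d" using gap_bounds(1)[of n] \<eta>_pos by linarith
  then have "0 \<le> mesh (p k) * (level_L v N k * ?d)"
    using level_L_nonneg[of v N k] v_pos N_gt mesh_pos[of "p k"] by (intro mult_nonneg_nonneg) auto
  then show ?case using Suc.IH unfolding level_gap_Suc sum.lessThan_Suc by (auto simp: algebra_simps)
qed

text \<open>When the limit angle is on a wall, every late scheme is within its own gap of that wall,
  so such times are covered by the grid intervals counted in \<open>gap_counts_wall_visits\<close>.
  Their total length at level l is at most a constant times \<open>(1/2)^l\<close>.\<close>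

lemma wall_null:
  assumes R: "reached k t" and t: "0 \<le> t"
  shows "AE s in lborel. s \<in> {0..t} \<longrightarrow> cos (Xl s) \<noteq> 0"
proof -
  define W where "W = {s \<in> {0..t}. cos (Xl s) = 0}"
  have W: "W \<in> sets lborel" unfolding W_def by measurable
  have K: "0 < (N - 1) * v" using v_pos N_gt by simp
  have le: "measure lborel W \<le> (1 / 2)^l * (1 / (2 * ((N - 1) * v)))" if l: "Suc k \<le> l" for l
  proof -
    have kl: "k \<le> l" using l by simp
    have Rl: "reached l t" by (rule reached_mono[OF R kl order_refl])
    have g: "good_level v N r \<theta> l (p l) (\<eta> l) w" using Rl unfolding reached_def by auto
    define V where "V = (\<lambda>i. \<bar>cos (snd (level_euler v N r \<theta> l (p l) w i))\<bar> \<le> level_gap v N r \<theta> l (p l) (\<eta> l) w i)"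
    define n where "n = nat \<lfloor>t * 2^p l\<rfloor>"
    define I where "I = (\<lambda>i. {mesh (p l) * real i..<mesh (p l) * real (Suc i)})"
    define A where "A = {i. i < Suc n \<and> V i}"
    have fin: "finite A" unfolding A_def by simp
    have sub: "W \<subseteq> (\<Union>i\<in>A. I i)"
    proof
      fix s assume "s \<in> W"
      then have s: "0 \<le> s" "s \<le> t" "cos (Xl s) = 0" unfolding W_def by auto
      let ?i = "nat \<lfloor>s * 2^p l\<rfloor>"
      have "\<bar>cos (Xs l s)\<bar> \<le> \<bar>Xl s - Xs l s\<bar>"
        using abs_cos_diff_le[of "Xl s" "Xs l s"] s(3) by simp
      then have "V ?i" unfolding V_def using reached_limit_compare[OF Rl order_refl s(1,2)]
        by (simp add: step_euler_def)
      moreover have "?i < Suc n" unfolding n_def using grid_index_mono[OF s(2)] by (simp add: le_imp_less_Suc)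
      moreover have "s \<in> I ?i" unfolding I_def using grid_index[OF s(1), of "p l"] by auto
      ultimately show "s \<in> (\<Union>i\<in>A. I i)" unfolding A_def by auto
    qed
    have len: "measure lborel (I i) = mesh (p l)" for i
      unfolding I_def using mesh_pos[of "p l"] by (simp add: algebra_simps)
    have "measure lborel W \<le> measure lborel (\<Union>i\<in>A. I i)"
    proof (rule measure_mono_fmeasurable[OF sub W])
      show "(\<Union>i\<in>A. I i) \<in> fmeasurable lborel"
        using fin
      proof (rule fmeasurable.finite_UN)
        fix i
        have "mesh (p l) * real i \<le> mesh (p l) * real (Suc i)" using mesh_pos[of "p l"] by simp
        then show "I i \<in> fmeasurable lborel" unfolding I_def by (intro fmeasurableI) auto
      qed
    qed
    also have "\<dots> \<le> (\<Sum>i\<in>A. measure lborel (I i))"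
      using fin unfolding I_def by (intro measure_UNION_le) auto
    also have "\<dots> = (\<Sum>i\<in>A. mesh (p l))" unfolding len ..
    also have "\<dots> = (\<Sum>i<Suc n. mesh (p l) * (if V i then 1 else 0))"
      unfolding A_def by (rule sum.mono_neutral_cong_left) auto
    finally have m: "measure lborel W \<le> (\<Sum>i<Suc n. mesh (p l) * (if V i then 1 else 0))" .
    \<comment> \<open>Since cut-offs are at most 1, the jump size is bounded below uniformly in the
      level, and the positivity of this bound comes from N > 1.\<close>
    have Kl: "(N - 1) * v \<le> level_K v N l"
      using K level_eps_pos[of l] level_eps_le_1[of l] unfolding level_K_def
      by (simp add: le_divide_eq mult_left_le)
    have "2 * ((N - 1) * v) * measure lborel W \<le> 2 * level_K v N l * measure lborel W"
      using Kl by (intro mult_right_mono) auto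
    also have "\<dots> \<le> 2 * level_K v N l * (\<Sum>i<Suc n. mesh (p l) * (if V i then 1 else 0))"
      using m Kl K by (intro mult_left_mono) auto
    also have "\<dots> \<le> level_gap v N r \<theta> l (p l) (\<eta> l) w (Suc n)"
      unfolding V_def by (rule gap_counts_wall_visits[OF g])
    finally have fin1: "2 * ((N - 1) * v) * measure lborel W \<le> level_gap v N r \<theta> l (p l) (\<eta> l) w (Suc n)" .
    have "t \<le> real l" using R l unfolding reached_def by auto
    \<comment> \<open>The last, possibly incomplete, grid interval costs one extra step. Taking l
      \<ge> k + 1 leaves a whole unit of time for it before the horizon of level l.\<close>
    then have "mesh (p l) * real (Suc n) \<le> mesh (p l) * real (level_end l (p l))"
      using grid_index(1)[OF t, of "p l"] mesh_le_1[of "p l"] unfolding mesh_mult_level_end n_def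
      by (simp add: distrib_left)
    then have "Suc n \<le> level_end l (p l)" using mesh_pos[of "p l"] by simp
    then have "level_gap v N r \<theta> l (p l) (\<eta> l) w (Suc n) \<le> (1 / 2)^l"
      using level_path.gap_bounds(2)[OF level_pathI[OF g]] g unfolding good_level_def by (meson order_trans)
    then have le: "2 * ((N - 1) * v) * measure lborel W \<le> (1 / 2)^l" using fin1 by linarith
    have "m \<le> q * (1 / c)" if "0 < c" "c * m \<le> q" for m q c :: real
      using that by (simp add: field_simps)
    from this[OF _ le] show ?thesis using K by simp
  qed
  have "measure lborel W \<le> 0"
  proof (rule tendsto_lowerbound)
    have "(\<lambda>l. (1 / 2 :: real)^l) \<longlonglongrightarrow> 0" by (intro LIMSEQ_realpow_zero) auto
    then show "(\<lambda>l. (1 / 2)^l * (1 / (2 * ((N - 1) * v)))) \<longlonglongrightarrow> 0" by (rule tendsto_mult_left_zero)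
    show "eventually (\<lambda>l. measure lborel W \<le> (1 / 2)^l * (1 / (2 * ((N - 1) * v)))) sequentially"
      by (rule eventually_sequentiallyI[OF le])
  qed simp
  then have "measure lborel W = 0" by (simp add: order_antisym)
  moreover have "emeasure lborel W < \<infinity>"
  proof -
    have "emeasure lborel W \<le> emeasure lborel {0..t}" unfolding W_def by (rule emeasure_mono) auto
    then show ?thesis using t by (simp add: order_le_less_trans)
  qed
  ultimately have "W \<in> null_sets lborel" using W by (simp add: null_sets_def emeasure_eq_ennreal_measure)
  then show ?thesis by (rule AE_I') (auto simp: W_def)
qed

lemma reached_drift_bound:
  assumes "reached k t" "k \<le> l" "0 \<le> u" "u \<le> t"
  shows "\<bar>pn_mu2 v N (max (Rs l u) (level_eps l)) (Xs l u)\<bar> \<le> level_K v N k"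
    and "\<bar>pn_mu2 v N (Rl u) (Xl u)\<bar> \<le> level_K v N k"
proof -
  have "level_eps k \<le> Rs l u" using reached_mono[OF assms(1) order_refl assms(4)] assms(2) unfolding reached_def by blast
  then have "level_eps k \<le> max (Rs l u) (level_eps l)" by linarith
  then show "\<bar>pn_mu2 v N (max (Rs l u) (level_eps l)) (Xs l u)\<bar> \<le> level_K v N k"
    unfolding level_K_def using v_pos N_gt level_eps_pos by (intro abs_pn_mu2_le) auto
  show "\<bar>pn_mu2 v N (Rl u) (Xl u)\<bar> \<le> level_K v N k"
    unfolding level_K_def using v_pos N_gt level_eps_pos reached_limits(3)[OF assms(1,3,4)]
    by (intro abs_pn_mu2_le) auto
qed

text \<open>Dominated convergence with a moving upper limit: every s < t is eventually below the
  rounded time, and the endpoint s = t is null.\<close>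

lemma set_integral_tendsto:
  fixes f :: "nat \<Rightarrow> real \<Rightarrow> real"
  assumes meas: "\<And>l. f l \<in> borel_measurable borel" "g \<in> borel_measurable borel"
    and lim: "AE s in lborel. s \<in> {0..t} \<longrightarrow> (\<lambda>l. f l s) \<longlonglongrightarrow> g s"
    and bound: "\<And>l s. k \<le> l \<Longrightarrow> 0 \<le> s \<Longrightarrow> s \<le> t \<Longrightarrow> \<bar>f l s\<bar> \<le> C" and t: "0 \<le> t" and C: "0 \<le> C"
  shows "(\<lambda>l. LBINT s:{0..round_down l t}. f l s) \<longlonglongrightarrow> (LBINT s:{0..t}. g s)"
proof -
  have "(\<lambda>l. LBINT s:{0..round_down (l + k) t}. f (l + k) s) \<longlonglongrightarrow> (LBINT s:{0..t}. g s)"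
    unfolding set_lebesgue_integral_def
  proof (rule integral_dominated_convergence[where w = "\<lambda>s. indicator {0..t} s *\<^sub>R C"])
    show "integrable lborel (\<lambda>s. indicator {0..t} s *\<^sub>R C)"
      by (intro integrable_scaleR_left integrable_real_indicator) (use t in auto)
    show "AE s in lborel. norm (indicator {0..round_down (l + k) t} s *\<^sub>R f (l + k) s) \<le> indicator {0..t} s *\<^sub>R C" for l
      using bound[of "l + k"] round_down_le[OF t, of "l + k"] C
      by (intro AE_I2) (auto simp: indicator_def)
    show "AE s in lborel. (\<lambda>l. indicator {0..round_down (l + k) t} s *\<^sub>R f (l + k) s) \<longlonglongrightarrow> indicator {0..t} s *\<^sub>R g s"
      using lim AE_lborel_singleton[of t]
    proof eventually_elim
      case (elim s)
      show ?case
      proof (cases "s \<in> {0..t}")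
        case False
        then have "s \<notin> {0..round_down l t}" for l using round_down_le[OF t, of l] by auto
        then show ?thesis using False by simp
      next
        case True
        then have st: "s < t" using elim(2) by auto
        have "eventually (\<lambda>l. s < round_down l t) sequentially"
          by (rule order_tendstoD(1)[OF round_down_tendsto[OF t] st])
        then have "eventually (\<lambda>l. f l s = indicator {0..round_down l t} s *\<^sub>R f l s) sequentially"
          by eventually_elim (use True in auto)
        moreover have "(\<lambda>l. f l s) \<longlonglongrightarrow> g s" using elim(1) True by blast
        ultimately have "(\<lambda>l. indicator {0..round_down l t} s *\<^sub>R f l s) \<longlonglongrightarrow> g s"
          by (rule Lim_transform_eventually[rotated])
        from LIMSEQ_ignore_initial_segment[OF this, of k] show ?thesis using True by simp
      qed
    qed
  qed (use meas in measurable)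
  then show ?thesis by (rule LIMSEQ_offset)
qed

lemma limit_solves:
  assumes R: "reached k t" and t: "0 \<le> t"
  shows "set_integrable lborel {0..t} (\<lambda>s. pn_mu1 v (Rl s) (Xl s))"
    "set_integrable lborel {0..t} (\<lambda>s. pn_mu2 v N (Rl s) (Xl s))"
    "Rl t = r + (LBINT s:{0..t}. pn_mu1 v (Rl s) (Xl s))"
    "Xl t = \<theta> + (LBINT s:{0..t}. pn_mu2 v N (Rl s) (Xl s)) + w t"
proof -
  show "set_integrable lborel {0..t} (\<lambda>s. pn_mu1 v (Rl s) (Xl s))"
    by (rule set_integrable_bounded[where C = v]) (use abs_pn_mu1_le[OF v0] in auto)
  have K0: "0 \<le> level_K v N k" using level_K_nonneg v_pos N_gt by simp
  show "set_integrable lborel {0..t} (\<lambda>s. pn_mu2 v N (Rl s) (Xl s))"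
    unfolding set_integrable_def
  proof (rule integrableI_bounded_set[where A = "{0..t}" and B = "level_K v N k"])
    show "AE s in lborel. s \<in> {0..t} \<longrightarrow> norm (indicator {0..t} s *\<^sub>R pn_mu2 v N (Rl s) (Xl s)) \<le> level_K v N k"
      using reached_drift_bound(2)[OF R order_refl] by (intro AE_I2) (auto simp: indicator_def)
  qed (use t in auto)
  have lims: "(\<lambda>l. Rs l s) \<longlonglongrightarrow> Rl s" "(\<lambda>l. Xs l s) \<longlonglongrightarrow> Xl s" "0 < Rl s" if "s \<in> {0..t}" for s
    using reached_limits[OF R, of s] that level_eps_pos[of k] by auto
  have "(\<lambda>l. r + (LBINT s:{0..round_down l t}. pn_mu1 v (Rs l s) (Xs l s))) \<longlonglongrightarrow> r + (LBINT s:{0..t}. pn_mu1 v (Rl s) (Xl s))"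
  proof (intro tendsto_add tendsto_const set_integral_tendsto[where k = 0 and C = v])
    show "AE s in lborel. s \<in> {0..t} \<longrightarrow> (\<lambda>l. pn_mu1 v (Rs l s) (Xs l s)) \<longlonglongrightarrow> pn_mu1 v (Rl s) (Xl s)"
      unfolding pn_mu1_eq using lims(2)
      by (intro AE_I2 impI tendsto_mult tendsto_const tendsto_rabs tendsto_cos) auto
  qed (use abs_pn_mu1_le[OF v0] t v_pos in auto)
  then have "(\<lambda>l. Rs l t) \<longlonglongrightarrow> r + (LBINT s:{0..t}. pn_mu1 v (Rl s) (Xl s))"
    by (subst Rs_integral)
  then show "Rl t = r + (LBINT s:{0..t}. pn_mu1 v (Rl s) (Xl s))"
    using lims(1)[of t] t by (auto intro: LIMSEQ_unique)
  have "(\<lambda>l. \<theta> + (LBINT s:{0..round_down l t}. pn_mu2 v N (max (Rs l s) (level_eps l)) (Xs l s)) + w (round_down l t))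
    \<longlonglongrightarrow> \<theta> + (LBINT s:{0..t}. pn_mu2 v N (Rl s) (Xl s)) + w t"
  proof (intro tendsto_add tendsto_const set_integral_tendsto[where k = k and C = "level_K v N k"])
    have "(\<lambda>l. level_eps l) \<longlonglongrightarrow> 0" unfolding level_eps_def by (rule LIMSEQ_Suc[OF lim_1_over_n])
    then have mx: "(\<lambda>l. max (Rs l s) (level_eps l)) \<longlonglongrightarrow> Rl s" if "s \<in> {0..t}" for s
      using tendsto_max[OF lims(1)[OF that], of level_eps 0] lims(3)[OF that] by simp
    show "AE s in lborel. s \<in> {0..t} \<longrightarrow> (\<lambda>l. pn_mu2 v N (max (Rs l s) (level_eps l)) (Xs l s)) \<longlonglongrightarrow> pn_mu2 v N (Rl s) (Xl s)"
      using wall_null[OF R t]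
    proof eventually_elim
      case (elim s)
      show ?case
      proof
        assume s: "s \<in> {0..t}"
        \<comment> \<open>Off the walls \<open>wall_sgn\<close> is locally constant, and at a
          positive radius the vanishing cut-off disappears in the limit; so the drift converges at
          every such s.\<close>
        have "cos (Xl s) \<noteq> 0" "Rl s \<noteq> 0" using elim s lims(3)[OF s] by auto
        then show "(\<lambda>l. pn_mu2 v N (max (Rs l s) (level_eps l)) (Xs l s)) \<longlonglongrightarrow> pn_mu2 v N (Rl s) (Xl s)"
          unfolding pn_mu2_eq
          by (intro tendsto_divide tendsto_mult tendsto_const tendsto_sin wall_sgn_tendsto mx lims(2) s)
      qed
    qed
    show "(\<lambda>l. w (round_down l t)) \<longlonglongrightarrow> w t"
    proof (rule continuous_on_tendsto_compose[OF w_cont round_down_tendsto[OF t]])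
      show "eventually (\<lambda>l. round_down l t \<in> {0..}) sequentially"
        unfolding round_down_def using mesh_pos by (intro always_eventually allI) (simp add: less_imp_le)
    qed (use t in auto)
    show "\<bar>pn_mu2 v N (max (Rs l s) (level_eps l)) (Xs l s)\<bar> \<le> level_K v N k" if "k \<le> l" "0 \<le> s" "s \<le> t" for l s
      by (rule reached_drift_bound(1)[OF R that])
  qed (use t K0 in auto)
  then have "(\<lambda>l. Xs l t) \<longlonglongrightarrow> \<theta> + (LBINT s:{0..t}. pn_mu2 v N (Rl s) (Xl s)) + w t"
    by (subst Xs_integral)
  then show "Xl t = \<theta> + (LBINT s:{0..t}. pn_mu2 v N (Rl s) (Xl s)) + w t"
    using lims(2)[of t] t by (auto intro: LIMSEQ_unique)
qed

text \<open>Convergence is used at the earlier time s only. At time t the limiting radius may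
  already be 0, where the schemes are not known to converge, so the bound is passed to the upper
  limit.\<close>

lemma limit_R_lower:
  assumes "0 \<le> s" "s \<le> t"
  shows "Rl s - v * (t - s) \<le> Rl t"
proof (cases "0 < Rl s")
  case False
  have "0 \<le> v * (t - s)" using v_pos assms by simp
  then show ?thesis using False limit_R_ereal(2)[OF v0 less_imp_le[OF r_pos], of N \<theta> p w t] by linarith
next
  case True
  then obtain k where "reached k s" using positive_reached[OF assms(1)] by auto
  then have "(\<lambda>l. Rs l s) \<longlonglongrightarrow> Rl s" by (rule reached_limits(1)[OF _ assms(1) order_refl])
  then have "(\<lambda>l. Rs l s - v * (t - s) - v * mesh (p l)) \<longlonglongrightarrow> Rl s - v * (t - s) - v * 0"
    by (intro tendsto_diff tendsto_mult tendsto_const mesh_to_0)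
  then have "(\<lambda>l. ereal (Rs l s - v * (t - s) - v * mesh (p l))) \<longlonglongrightarrow> ereal (Rl s - v * (t - s))"
    by simp
  then have "ereal (Rl s - v * (t - s)) = limsup (\<lambda>l. ereal (Rs l s - v * (t - s) - v * mesh (p l)))"
    by (rule lim_imp_Limsup[OF sequentially_bot, symmetric])
  also have "\<dots> \<le> limsup (\<lambda>l. ereal (max 0 (Rs l t)))"
  proof (intro Limsup_mono always_eventually allI)
    show "ereal (Rs l s - v * (t - s) - v * mesh (p l)) \<le> ereal (max 0 (Rs l t))" for l
      using step_euler_fst_lower[OF v0 assms, of N r \<theta> l "p l" w] unfolding ereal_less_eq by linarith
  qed
  also have "\<dots> = ereal (Rl t)" by (rule limit_R_ereal(1)[OF v0 less_imp_le[OF r_pos], symmetric])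
  finally show ?thesis by simp
qed

text \<open>The radius of a solution is nonincreasing, so \<open>R' S\<close> bounds it below on
  {0..S} and exceeds every late cut-off. The comparison with the identity as round-down map applies,
  and the limit on the left is built from the noise alone, which yields uniqueness.\<close>

lemma solution_is_limit:
  assumes S: "0 \<le> S" and pos: "\<And>t. 0 \<le> t \<Longrightarrow> t \<le> S \<Longrightarrow> 0 < R' t"
    and int1: "set_integrable lborel {0..S} (\<lambda>s. pn_mu1 v (R' s) (X' s))"
    and int2: "set_integrable lborel {0..S} (\<lambda>s. pn_mu2 v N (R' s) (X' s))"
    and R'_eq: "\<And>t. 0 \<le> t \<Longrightarrow> t \<le> S \<Longrightarrow> R' t = r + (LBINT s:{0..t}. pn_mu1 v (R' s) (X' s))"
    and X'_eq: "\<And>t. 0 \<le> t \<Longrightarrow> t \<le> S \<Longrightarrow> X' t = \<theta> + (LBINT s:{0..t}. pn_mu2 v N (R' s) (X' s)) + w t"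
  shows "(\<lambda>k. Rs k S) \<longlonglongrightarrow> R' S" "(\<lambda>k. Xs k S) \<longlonglongrightarrow> X' S"
proof -
  have dec: "R' S \<le> R' t" if "0 \<le> t" "t \<le> S" for t
  proof -
    have "(LBINT s:{0..S}. pn_mu1 v (R' s) (X' s)) - (LBINT s:{0..t}. pn_mu1 v (R' s) (X' s)) \<le> 0 * (S - t)"
      by (rule integral_increment_upper[OF int1 that order_refl]) (use v_pos in \<open>simp add: pn_mu1_eq\<close>)
    then show ?thesis using R'_eq[OF that] R'_eq[OF S order_refl] by simp
  qed
  have "eventually (\<lambda>k. level_eps k < R' S) sequentially"
    unfolding level_eps_def
    by (rule order_tendstoD(2)[OF LIMSEQ_Suc[OF lim_1_over_n] pos[OF S order_refl]])
  moreover have "eventually (\<lambda>k. S < real k) sequentially"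
    using reals_Archimedean2[of S] by (meson eventually_sequentiallyI less_le_trans of_nat_mono)
  ultimately have ev: "eventually (\<lambda>k. \<bar>X' S - Xs k S\<bar> + \<bar>R' S - Rs k S\<bar> \<le> (1 / 2)^k) sequentially"
    using good
  proof eventually_elim
    case (elim k)
    interpret level_path v N r \<theta> k "p k" "\<eta> k" w by (rule level_pathI[OF elim(3)])
    have Sk: "S \<le> real (Suc k)" using elim by simp
    have "\<bar>X' S - Xs k S\<bar> + \<bar>R' S - Rs k S\<bar> \<le> level_gap v N r \<theta> k (p k) (\<eta> k) w (nat \<lfloor>S * 2^p k\<rfloor>)"
    proof (rule comparison[where \<rho> = "\<lambda>t. t" and S = S])
      show "level_eps k \<le> R' t" if "0 \<le> t" "t \<le> S" for t using dec[OF that] elim by linarith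
      show "X' t = \<theta> + (LBINT s:{0..t}. pn_mu2 v N (R' s) (X' s)) + (w t - w 0)" if "0 \<le> t" "t \<le> S" for t
        using X'_eq[OF that] w0 by simp
      show "R' t = r + (LBINT s:{0..t}. pn_mu1 v (R' s) (X' s))" if "0 \<le> t" "t \<le> S" for t
        by (rule R'_eq[OF that])
    qed (use S Sk int1 int2 in auto)
    also have "\<dots> \<le> (1 / 2)^k" by (rule gap_index_le[OF S Sk])
    finally show ?case .
  qed
  have half: "(\<lambda>k. (1 / 2 :: real)^k) \<longlonglongrightarrow> 0" by (intro LIMSEQ_realpow_zero) auto
  have "(\<lambda>k. R' S - Rs k S) \<longlonglongrightarrow> 0" "(\<lambda>k. X' S - Xs k S) \<longlonglongrightarrow> 0"
    by (rule tendsto_0_le[OF half, where K = 1]; use ev in \<open>eventually_elim, simp\<close>)+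
  then show "(\<lambda>k. Rs k S) \<longlonglongrightarrow> R' S" "(\<lambda>k. Xs k S) \<longlonglongrightarrow> X' S"
    using tendsto_diff[OF tendsto_const[of "R' S"]] tendsto_diff[OF tendsto_const[of "X' S"]] by fastforce+
qed

end

section \<open>Hitting times and adaptedness\<close>

lemma le_hitting_time_iff: "ereal t \<le> hitting_time R \<omega> \<longleftrightarrow> (\<forall>s\<ge>0. R s \<omega> = 0 \<longrightarrow> t \<le> s)"
  unfolding hitting_time_def le_Inf_iff by auto

lemma hitting_time_le: "0 \<le> s \<Longrightarrow> R s \<omega> = 0 \<Longrightarrow> hitting_time R \<omega> \<le> ereal s"
  unfolding hitting_time_def by (rule Inf_lower) auto

lemma hitting_time_nonneg: "0 \<le> hitting_time R \<omega>"
  using le_hitting_time_iff[of 0 R \<omega>] by (simp add: zero_ereal_def)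

lemma less_hitting_time_mono: "ereal t < hitting_time R \<omega> \<Longrightarrow> s \<le> t \<Longrightarrow> ereal s < hitting_time R \<omega>"
  by (metis ereal_less_eq(3) order_le_less_trans)

text \<open>A zero of a non-negative nonincreasing function persists, so any zero before t is also
  seen at a later rational time before t.\<close>

lemma le_hitting_time_antimono_iff:
  fixes R :: "real \<Rightarrow> 'b \<Rightarrow> real"
  assumes nonneg: "\<And>t. 0 \<le> R t \<omega>" and anti: "\<And>s t. s \<le> t \<Longrightarrow> R t \<omega> \<le> R s \<omega>"
  shows "ereal t \<le> hitting_time R \<omega> \<longleftrightarrow> (\<forall>q\<in>\<rat>. 0 \<le> q \<and> q < t \<longrightarrow> 0 < R q \<omega>)"
  unfolding le_hitting_time_iff
proof safe
  fix q assume "\<forall>s\<ge>0. R s \<omega> = 0 \<longrightarrow> t \<le> s" "0 \<le> q" "q < t"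
  then have "R q \<omega> \<noteq> 0" by force
  then show "0 < R q \<omega>" using nonneg[of q] by linarith
next
  fix s assume q: "\<forall>q\<in>\<rat>. 0 \<le> q \<and> q < t \<longrightarrow> 0 < R q \<omega>" and s: "0 \<le> s" "R s \<omega> = 0"
  show "t \<le> s"
  proof (rule ccontr)
    assume "\<not> t \<le> s"
    then obtain x where x: "x \<in> \<rat>" "s < x" "x < t" using Rats_dense_in_real[of s t] by auto
    then have "0 < R x \<omega>" using q s by auto
    then show False using anti[of s x] x s by simp
  qed
qed

section \<open>Continuity and integrability of the drift along continuous paths\<close>

lemma continuous_on_set_integral:
  fixes f :: "real \<Rightarrow> real"
  assumes f: "set_integrable lborel {0..t} f" and bound: "\<And>s. 0 \<le> s \<Longrightarrow> s \<le> t \<Longrightarrow> \<bar>f s\<bar> \<le> C" and C: "0 \<le> C"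
  shows "continuous_on {0..t} (\<lambda>u. LBINT s:{0..u}. f s)"
proof (rule lipschitz_on_continuous_on)
  have le: "\<bar>(LBINT s:{0..b}. f s) - (LBINT s:{0..a}. f s)\<bar> \<le> C * (b - a)" if "0 \<le> a" "a \<le> b" "b \<le> t" for a b
    using integral_increment_approx[OF f that, of 0 C] bound that by auto
  show "C-lipschitz_on {0..t} (\<lambda>u. LBINT s:{0..u}. f s)"
  proof (rule lipschitz_onI[OF _ C])
    fix x y :: real assume xy: "x \<in> {0..t}" "y \<in> {0..t}"
    show "dist (LBINT s:{0..x}. f s) (LBINT s:{0..y}. f s) \<le> C * dist x y"
      using le[of x y] le[of y x] xy unfolding dist_real_def
      by (cases "x \<le> y") (auto simp: abs_minus_commute)
  qed
qed

text \<open>Integrability of the sum of absolute values bounds the two drifts but does not make them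
  measurable. Measurability comes from the continuity of the path on {0..t}; the path is cut off by
  an indicator because nothing is known of it outside.\<close>

lemma pn_mu_set_integrable:
  fixes R X :: "real \<Rightarrow> real"
  assumes cont: "continuous_on {0..t} (\<lambda>s. (R s, X s))"
    and int: "set_integrable lborel {0..t} (\<lambda>s. \<bar>pn_mu1 v (R s) (X s)\<bar> + \<bar>pn_mu2 v N (R s) (X s)\<bar>)"
  shows "set_integrable lborel {0..t} (\<lambda>s. pn_mu1 v (R s) (X s))"
    "set_integrable lborel {0..t} (\<lambda>s. pn_mu2 v N (R s) (X s))"
proof -
  have cR: "continuous_on {0..t} R" and cX: "continuous_on {0..t} X"
    using continuous_on_fst[OF cont] continuous_on_snd[OF cont] by simp_all
  have [measurable]: "(\<lambda>s. indicator {0..t} s *\<^sub>R R s) \<in> borel_measurable borel"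
    "(\<lambda>s. indicator {0..t} s *\<^sub>R X s) \<in> borel_measurable borel"
    using borel_measurable_continuous_on_indicator[OF _ cR] borel_measurable_continuous_on_indicator[OF _ cX] by auto
  have "(\<lambda>s. indicator {0..t} s *\<^sub>R pn_mu1 v (indicator {0..t} s *\<^sub>R R s) (indicator {0..t} s *\<^sub>R X s)) \<in> borel_measurable borel"
    by measurable
  also have "(\<lambda>s. indicator {0..t} s *\<^sub>R pn_mu1 v (indicator {0..t} s *\<^sub>R R s) (indicator {0..t} s *\<^sub>R X s))
    = (\<lambda>s. indicator {0..t} s *\<^sub>R pn_mu1 v (R s) (X s))" by (auto simp: indicator_def fun_eq_iff)
  finally have m1: "set_borel_measurable lborel {0..t} (\<lambda>s. pn_mu1 v (R s) (X s))"
    unfolding set_borel_measurable_def by simp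
  have "(\<lambda>s. indicator {0..t} s *\<^sub>R pn_mu2 v N (indicator {0..t} s *\<^sub>R R s) (indicator {0..t} s *\<^sub>R X s)) \<in> borel_measurable borel"
    by measurable
  also have "(\<lambda>s. indicator {0..t} s *\<^sub>R pn_mu2 v N (indicator {0..t} s *\<^sub>R R s) (indicator {0..t} s *\<^sub>R X s))
    = (\<lambda>s. indicator {0..t} s *\<^sub>R pn_mu2 v N (R s) (X s))" by (auto simp: indicator_def fun_eq_iff)
  finally have m2: "set_borel_measurable lborel {0..t} (\<lambda>s. pn_mu2 v N (R s) (X s))"
    unfolding set_borel_measurable_def by simp
  show "set_integrable lborel {0..t} (\<lambda>s. pn_mu1 v (R s) (X s))"
    by (rule set_integrable_bound[OF int m1]) auto
  show "set_integrable lborel {0..t} (\<lambda>s. pn_mu2 v N (R s) (X s))"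
    by (rule set_integrable_bound[OF int m2]) auto
qed

text \<open>The limit of the schemes is only controlled before the hitting time; evaluating it slightly
  earlier and letting the delay vanish produces the left limit at the hitting time.\<close>

definition limit_angle :: "real \<Rightarrow> real \<Rightarrow> real \<Rightarrow> real \<Rightarrow> (nat \<Rightarrow> nat) \<Rightarrow> (real \<Rightarrow> real) \<Rightarrow> real \<Rightarrow> real" where
  "limit_angle v N r \<theta> p w t = lim (\<lambda>n. limit_X v N r \<theta> p w (max 0 (t - 1 / real (Suc n))))"

lemma delayed_tendsto: "0 \<le> t \<Longrightarrow> (\<lambda>n. max 0 (t - 1 / real (Suc n))) \<longlonglongrightarrow> t"
proof -
  assume "0 \<le> t"
  have "(\<lambda>n. max 0 (t - 1 / real (Suc n))) \<longlonglongrightarrow> max 0 (t - 0)"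
    by (intro tendsto_max tendsto_diff tendsto_const LIMSEQ_Suc[OF lim_1_over_n])
  then show ?thesis using \<open>0 \<le> t\<close> by simp
qed

section \<open>The limit process up to its hitting time\<close>

context scheme_path
begin

abbreviation Xa :: "real \<Rightarrow> real" where
  "Xa \<equiv> limit_angle v N r \<theta> p w"

lemma limit_start: "Rl 0 = r" "Xl 0 = \<theta>"
proof -
  have "Rs k 0 = r" for k by (simp add: step_euler_def level_euler_def)
  then show "Rl 0 = r" unfolding limit_R_def using r_pos by (simp add: Limsup_const)
  then obtain k where "reached k 0" using positive_reached[of 0] r_pos by auto
  from limit_solves(4)[OF this order_refl] show "Xl 0 = \<theta>" by (simp add: set_integral_singleton w0)
qed

lemma limit_continuous:
  assumes t: "0 \<le> t" and pos: "0 < Rl t"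
  shows "continuous_on {0..t} Rl" "continuous_on {0..t} Xl"
proof -
  obtain k where R: "reached k t" using positive_reached[OF t pos] by auto
  have Ru: "reached k u" if "u \<le> t" for u by (rule reached_mono[OF R order_refl that])
  have "continuous_on {0..t} (\<lambda>u. r + (LBINT s:{0..u}. pn_mu1 v (Rl s) (Xl s)))"
    using abs_pn_mu1_le[OF v0] v0
    by (intro continuous_on_add continuous_on_const continuous_on_set_integral[OF limit_solves(1)[OF R t]]) auto
  then show "continuous_on {0..t} Rl"
    by (rule continuous_on_eq) (use limit_solves(3)[OF Ru] in simp)
  have "continuous_on {0..t} (\<lambda>u. \<theta> + (LBINT s:{0..u}. pn_mu2 v N (Rl s) (Xl s)) + w u)"
    using reached_drift_bound(2)[OF R order_refl] level_K_nonneg[of v N k] v_pos N_gt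
    by (intro continuous_on_add continuous_on_const continuous_on_set_integral[OF limit_solves(2)[OF R t]]
        continuous_on_subset[OF w_cont]) auto
  then show "continuous_on {0..t} Xl"
    by (rule continuous_on_eq) (use limit_solves(4)[OF Ru] in simp)
qed

lemma limit_angle_eq:
  assumes t: "0 \<le> t" and pos: "0 < Rl t"
  shows "Xa t = Xl t"
proof -
  have "(\<lambda>n. Xl (max 0 (t - 1 / real (Suc n)))) \<longlonglongrightarrow> Xl t"
    by (rule continuous_on_tendsto_compose[OF limit_continuous(2)[OF t pos] delayed_tendsto[OF t]])
      (use t in auto)
  then show ?thesis unfolding limit_angle_def by (rule limI)
qed

lemma limit_R_mono_pos: "0 < Rl t \<Longrightarrow> s \<le> t \<Longrightarrow> 0 < Rl s"
  using limit_R_antimono[OF v0 less_imp_le[OF r_pos], of s t N \<theta> p w] by linarith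

text \<open>The lower Lipschitz bound of the radius, read backwards from its zero at T, gives Rl t
  \<le> v * (T - t). This is the bound that makes the angular drift strong enough for
  \<open>angle_limit_exists\<close>.\<close>

lemma limit_at_hitting:
  assumes T: "0 \<le> T" and zero: "Rl T = 0" and pos: "\<And>t. 0 \<le> t \<Longrightarrow> t < T \<Longrightarrow> 0 < Rl t"
  shows "((\<lambda>t. (Rl t, Xa t)) \<longlongrightarrow> (Rl T, Xa T)) (at_left T)"
proof -
  have T0: "0 < T" using T zero limit_start(1) r_pos by (cases "T = 0") auto
  have le: "Rl t \<le> v * (T - t)" if "0 \<le> t" "t < T" for t
    using limit_R_lower[of t T] that zero by simp
  have ev: "eventually (\<lambda>t. 0 \<le> t \<and> t < T) (at_left T)"
    using eventually_at_left_real[OF T0] by eventually_elim auto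
  have "(Rl \<longlongrightarrow> 0) (at_left T)"
  proof (rule tendsto_sandwich[OF _ _ tendsto_const])
    show "eventually (\<lambda>t. 0 \<le> Rl t) (at_left T)"
      using limit_R_ereal(2)[OF v0 less_imp_le[OF r_pos]] by simp
    show "eventually (\<lambda>t. Rl t \<le> v * (T - t)) (at_left T)" using ev by eventually_elim (use le in auto)
    have "((\<lambda>t. v * (T - t)) \<longlongrightarrow> v * (T - T)) (at_left T)" by (intro tendsto_intros)
    then show "((\<lambda>t. v * (T - t)) \<longlongrightarrow> 0) (at_left T)" by simp
  qed
  moreover
  have reach: "\<exists>k. reached k t" if "0 \<le> t" "t < T" for t
    using positive_reached[OF that(1) pos[OF that]] .
  have "\<exists>l. (Xl \<longlongrightarrow> l) (at_left T)"
  proof (rule angle_limit_exists[OF v_pos N_gt T0 pos le, where w = w])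
    show "continuous_on {0..<T} Xl"
      unfolding continuous_on_eq_continuous_within
    proof
      fix t assume t: "t \<in> {0..<T}"
      define u where "u = (t + T) / 2"
      have u: "t < u" "u < T" "0 \<le> u" unfolding u_def using t by auto
      have "continuous_on {0..u} Xl" using limit_continuous(2)[of u] pos[of u] u by auto
      then have "continuous (at t within {0..u}) Xl" using t u by (auto simp: continuous_on_eq_continuous_within)
      moreover have "at t within {0..u} = at t within {0..<T}"
        by (rule at_within_nhd[where S = "{..<u}"]) (use t u in auto)
      ultimately show "continuous (at t within {0..<T}) Xl" by (simp add: continuous_within)
    qed
    show "continuous_on {0..T} w" by (rule continuous_on_subset[OF w_cont]) auto
    show "set_integrable lborel {0..t} (\<lambda>s. pn_mu2 v N (Rl s) (Xl s))" if "0 \<le> t" "t < T" for t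
      using reach[OF that] limit_solves(2) that by blast
    show "Xl t = \<theta> + (LBINT s:{0..t}. pn_mu2 v N (Rl s) (Xl s)) + w t" if "0 \<le> t" "t < T" for t
      using reach[OF that] limit_solves(4) that by blast
  qed
  then obtain l where l: "(Xl \<longlongrightarrow> l) (at_left T)" by auto
  have "(\<lambda>n. Xl (max 0 (T - 1 / real (Suc n)))) \<longlonglongrightarrow> l"
  proof (rule filterlim_compose[OF l])
    have "max 0 (T - 1 / real (Suc n)) < T" for n using T0 by simp
    then show "filterlim (\<lambda>n. max 0 (T - 1 / real (Suc n))) (at_left T) sequentially"
      unfolding filterlim_at using delayed_tendsto[OF T] by (simp add: less_imp_neq)
  qed
  then have "Xa T = l" unfolding limit_angle_def by (rule limI)
  moreover have "(Xa \<longlongrightarrow> l) (at_left T)"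
  proof (rule Lim_transform_eventually[OF l])
    show "eventually (\<lambda>t. Xl t = Xa t) (at_left T)"
      using ev by eventually_elim (use limit_angle_eq pos in auto)
  qed
  ultimately show ?thesis using zero by (intro tendsto_Pair) auto
qed

lemma limit_integral_equations:
  assumes t: "0 \<le> t" and pos: "0 < Rl t"
  shows "continuous_on {0..t} (\<lambda>s. (Rl s, Xa s))"
    "set_integrable lborel {0..t} (\<lambda>s. \<bar>pn_mu1 v (Rl s) (Xa s)\<bar> + \<bar>pn_mu2 v N (Rl s) (Xa s)\<bar>)"
    "Rl t = r + (LBINT s:{0..t}. pn_mu1 v (Rl s) (Xa s))"
    "Xa t = \<theta> + (LBINT s:{0..t}. pn_mu2 v N (Rl s) (Xa s)) + w t"
proof -
  have eq: "Xa s = Xl s" if "s \<in> {0..t}" for s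
    using limit_angle_eq[of s] limit_R_mono_pos[OF pos, of s] that by auto
  obtain k where R: "reached k t" using positive_reached[OF t pos] by auto
  note sol = limit_solves[OF R t]
  show "continuous_on {0..t} (\<lambda>s. (Rl s, Xa s))"
    using continuous_on_Pair[OF limit_continuous[OF t pos]] by (rule continuous_on_eq) (use eq in simp)
  have "set_integrable lborel {0..t} (\<lambda>s. \<bar>pn_mu1 v (Rl s) (Xl s)\<bar> + \<bar>pn_mu2 v N (Rl s) (Xl s)\<bar>)"
    by (intro set_integral_add(1) set_integrable_abs sol)
  then show "set_integrable lborel {0..t} (\<lambda>s. \<bar>pn_mu1 v (Rl s) (Xa s)\<bar> + \<bar>pn_mu2 v N (Rl s) (Xa s)\<bar>)"
    by (rule set_integrable_cong[THEN iffD1, rotated -1]) (use eq in auto)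
  have "(LBINT s:{0..t}. pn_mu1 v (Rl s) (Xa s)) = (LBINT s:{0..t}. pn_mu1 v (Rl s) (Xl s))"
    using eq by (intro set_lebesgue_integral_cong) auto
  then show "Rl t = r + (LBINT s:{0..t}. pn_mu1 v (Rl s) (Xa s))" using sol(3) by simp
  have "(LBINT s:{0..t}. pn_mu2 v N (Rl s) (Xa s)) = (LBINT s:{0..t}. pn_mu2 v N (Rl s) (Xl s))"
    using eq by (intro set_lebesgue_integral_cong) auto
  then show "Xa t = \<theta> + (LBINT s:{0..t}. pn_mu2 v N (Rl s) (Xa s)) + w t"
    using sol(4) eq[of t] t by simp
qed

end

lemma (in standard_brownian_motion) AE_scheme_path:
  assumes "0 < v" "1 < N" "0 < r"
    and "\<And>k. 0 < \<eta> k" "mono p" "\<And>k. level_K v N k * mesh (p k) \<le> \<eta> k / 4" "\<And>k. v * mesh (p k) \<le> \<eta> k / 4"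
    and "AE \<omega> in M. eventually (\<lambda>k. good_level v N r \<theta> k (p k) (\<eta> k) (\<lambda>t. \<sigma> * B t \<omega>)) sequentially"
  shows "AE \<omega> in M. scheme_path v N r \<theta> \<eta> p (\<lambda>t. \<sigma> * B t \<omega>)"
  using assms(8) start continuous_paths
proof eventually_elim
  case (elim \<omega>)
  then show ?case
    using assms(1-7) by (intro scheme_path.intro continuous_on_mult_left) auto
qed

lemma limit_measurable:
  assumes B: "\<And>s. 0 \<le> s \<Longrightarrow> s \<le> t \<Longrightarrow> B s \<in> borel_measurable G" and t: "0 \<le> t"
  shows "(\<lambda>\<omega>. limit_R v N r \<theta> p (\<lambda>s. \<sigma> * B s \<omega>) t) \<in> borel_measurable G"
    "(\<lambda>\<omega>. limit_X v N r \<theta> p (\<lambda>s. \<sigma> * B s \<omega>) t) \<in> borel_measurable G"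
proof -
  have [measurable]: "(\<lambda>\<omega>. fst (step_euler v N r \<theta> k q (\<lambda>s. \<sigma> * B s \<omega>) t)) \<in> borel_measurable G"
    "(\<lambda>\<omega>. snd (step_euler v N r \<theta> k q (\<lambda>s. \<sigma> * B s \<omega>) t)) \<in> borel_measurable G" for k q
    unfolding step_euler_def level_euler_def
    using euler_measurable[of "mesh q" "nat \<lfloor>t * 2^q\<rfloor>" B G v N "level_eps k" \<sigma> r \<theta>]
      grid_index(1)[OF t, of q] B mesh_pos[of q] by (auto simp: less_imp_le)
  show "(\<lambda>\<omega>. limit_R v N r \<theta> p (\<lambda>s. \<sigma> * B s \<omega>) t) \<in> borel_measurable G"
    "(\<lambda>\<omega>. limit_X v N r \<theta> p (\<lambda>s. \<sigma> * B s \<omega>) t) \<in> borel_measurable G"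
    unfolding limit_R_def limit_X_def by measurable
qed

lemma limit_angle_measurable:
  assumes B: "\<And>s. 0 \<le> s \<Longrightarrow> s \<le> t \<Longrightarrow> B s \<in> borel_measurable G" and t: "0 \<le> t"
  shows "(\<lambda>\<omega>. limit_angle v N r \<theta> p (\<lambda>s. \<sigma> * B s \<omega>) t) \<in> borel_measurable G"
  unfolding limit_angle_def
proof (rule borel_measurable_lim_metric)
  fix n
  have le: "max 0 (t - 1 / real (Suc n)) \<le> t" using t by simp
  show "(\<lambda>\<omega>. limit_X v N r \<theta> p (\<lambda>s. \<sigma> * B s \<omega>) (max 0 (t - 1 / real (Suc n)))) \<in> borel_measurable G"
    by (rule limit_measurable(2)[OF B[OF _ order_trans[OF _ le]]]) simp_all
qed

text \<open>The event that t is at most the hitting time is a countable intersection over the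
  rationals q < t of events of the sigma-algebra at time t. The filtration G is arbitrary so that
  the given and the augmented one are treated alike.\<close>

lemma adapted_until_limit:
  fixes M :: "'a measure" and B :: "real \<Rightarrow> 'a \<Rightarrow> real"
  assumes v: "0 \<le> v" "0 \<le> r"
    and G: "\<And>t. 0 \<le> t \<Longrightarrow> space (G t) = space M"
    and B: "\<And>s t. 0 \<le> s \<Longrightarrow> s \<le> t \<Longrightarrow> B s \<in> borel_measurable (G t)"
    and X: "\<And>t. 0 \<le> t \<Longrightarrow> X t \<in> borel_measurable (G t)"
  shows "adapted_until M G (hitting_time (\<lambda>t \<omega>. limit_R v N r \<theta> p (\<lambda>s. \<sigma> * B s \<omega>) t)) X"
  unfolding adapted_until_def
proof (intro allI impI ballI)
  fix t :: real and A :: "real set" assume t: "0 \<le> t" and A: "A \<in> sets borel"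
  let ?R = "\<lambda>t \<omega>. limit_R v N r \<theta> p (\<lambda>s. \<sigma> * B s \<omega>) t"
  have hit: "ereal t \<le> hitting_time ?R \<omega> \<longleftrightarrow> (\<forall>q\<in>\<rat>. 0 \<le> q \<and> q < t \<longrightarrow> 0 < ?R q \<omega>)" for \<omega>
    by (rule le_hitting_time_antimono_iff[where R = ?R, OF limit_R_ereal(2)[OF v] limit_R_antimono[OF v]])
  have meas: "{\<omega> \<in> space (G t). c \<longrightarrow> 0 < f \<omega>} \<in> sets (G t)"
    if "c \<Longrightarrow> f \<in> borel_measurable (G t)" for c and f :: "'a \<Rightarrow> real"
    using that by (cases c) auto
  have "{\<omega> \<in> space (G t). 0 \<le> q \<and> q < t \<longrightarrow> 0 < ?R q \<omega>} \<in> sets (G t)" for q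
    by (rule meas) (intro limit_measurable(1) B, auto)
  then have "{\<omega> \<in> space (G t). \<forall>q\<in>\<rat>. 0 \<le> q \<and> q < t \<longrightarrow> 0 < ?R q \<omega>} \<in> sets (G t)"
    by (intro sets.sets_Collect_countable_All' countable_rat)
  then have "{\<omega> \<in> space (G t). ereal t \<le> hitting_time ?R \<omega>} \<in> sets (G t)" unfolding hit .
  moreover have "{\<omega> \<in> space (G t). X t \<omega> \<in> A} \<in> sets (G t)"
    using measurable_sets[OF X[OF t] A] by (simp add: vimage_def Int_def conj_commute)
  ultimately show "{\<omega> \<in> space M. ereal t \<le> hitting_time ?R \<omega> \<and> X t \<omega> \<in> A} \<in> sets (G t)"
    unfolding G[OF t, symmetric] by (intro sets.sets_Collect_conj)
qed

lemma augmented_filtration_props: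
  shows "space (augmented_filtration M B t) = space M"
    and "0 \<le> s \<Longrightarrow> s \<le> t \<Longrightarrow> B s \<in> borel_measurable (augmented_filtration M B t)"
proof -
  let ?A = "{B s -` A \<inter> space M | s A. 0 \<le> s \<and> s \<le> t \<and> A \<in> sets borel} \<union> {A. \<exists>C\<in>null_sets M. A \<subseteq> C}"
  have sub: "?A \<subseteq> Pow (space M)" using sets.sets_into_space by (fastforce dest: null_setsD2)
  show sp: "space (augmented_filtration M B t) = space M"
    unfolding augmented_filtration_def by (rule space_measure_of[OF sub])
  show "B s \<in> borel_measurable (augmented_filtration M B t)" if "0 \<le> s" "s \<le> t"
  proof (rule measurableI)
    fix A :: "real set" assume "A \<in> sets borel"
    then have "B s -` A \<inter> space M \<in> ?A" using that by blast
    then show "B s -` A \<inter> space (augmented_filtration M B t) \<in> sets (augmented_filtration M B t)"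
      unfolding sp unfolding augmented_filtration_def sets_measure_of[OF sub] by (rule sigma_sets.Basic)
  qed simp
qed

context standard_brownian_motion
begin

text \<open>The probability of a positive limiting radius at time m is at most C / m. On that event
  all late schemes are above their cut-offs at time m, an event whose probability \<open>far\<close>
  bounds with a C that is free of m and of the level.\<close>

lemma limit_hits_zero:
  assumes par: "0 < v" "1 < N" "0 < \<sigma>" "0 < r"
    and path: "AE \<omega> in M. scheme_path v N r \<theta> \<eta> p (\<lambda>t. \<sigma> * B t \<omega>)"
    and far: "\<And>k m. m \<le> Suc k \<Longrightarrow> real m * prob {\<omega>\<in>space M. level_eps k
       < fst (level_euler v N r \<theta> k (p k) (\<lambda>t. \<sigma> * B t \<omega>) (m * 2^p k))} \<le> C"
  shows "AE \<omega> in M. \<exists>t\<ge>0. limit_R v N r \<theta> p (\<lambda>t. \<sigma> * B t \<omega>) t = 0"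
proof -
  let ?w = "\<lambda>\<omega> t. \<sigma> * B t \<omega>"
  let ?R = "\<lambda>t \<omega>. limit_R v N r \<theta> p (?w \<omega>) t"
  define E where "E = (\<lambda>m k. {\<omega>\<in>space M. level_eps k < fst (level_euler v N r \<theta> k (p k) (?w \<omega>) (m * 2^p k))})"
  define P where "P = (\<lambda>m::nat. {\<omega>\<in>space M. 0 < ?R (real m) \<omega>})"
  have RM: "?R t \<in> borel_measurable M" if "0 \<le> t" for t
    using that by (intro limit_measurable(1) B_borel_measurable)
  have PM: "P m \<in> sets M" for m using RM[of "real m"] unfolding P_def by measurable
  have EM: "E m k \<in> sets M" for m k
  proof -
    have "(\<lambda>\<omega>. fst (level_euler v N r \<theta> k (p k) (?w \<omega>) (m * 2^p k))) \<in> borel_measurable M"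
      unfolding level_euler_def using mesh_pos[of "p k"] B_borel_measurable
      by (intro euler_measurable[THEN conjunct1]) (auto simp: less_imp_le)
    then show ?thesis unfolding E_def by measurable
  qed
  have bound: "real m * prob (P m) \<le> C" for m
  proof -
    \<comment> \<open>The lower limit of the events \<open>E m l\<close> is the increasing union of
      these sets. A certificate at level k gives a radius of at least \<open>level_eps k\<close>,
      which exceeds \<open>level_eps l\<close> strictly from l = k + 1 on, hence the shift to
      \<open>D (Suc k)\<close> below.\<close>
    define D where "D = (\<lambda>k. \<Inter>l\<in>{k..}. E m l)"
    have DM: "D k \<in> sets M" for k unfolding D_def using EM by (intro sets.countable_INT') auto
    have inc: "incseq D" unfolding D_def by (intro incseq_SucI INT_anti_mono) auto
    have lim: "(\<lambda>k. prob (D k)) \<longlonglongrightarrow> prob (\<Union>k. D k)"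
      by (rule finite_Lim_measure_incseq[OF _ inc]) (use DM in auto)
    have "AE \<omega> in M. \<omega> \<in> P m \<longrightarrow> \<omega> \<in> (\<Union>k. D k)"
      using path
    proof (rule AE_mp, intro AE_I2 impI)
      fix \<omega> assume \<omega>: "\<omega> \<in> space M" "scheme_path v N r \<theta> \<eta> p (?w \<omega>)" "\<omega> \<in> P m"
      interpret scheme_path v N r \<theta> \<eta> p "?w \<omega>" by fact
      obtain k where k: "reached k (real m)" using positive_reached[of "real m"] \<omega>(3) unfolding P_def by auto
      have "\<omega> \<in> E m l" if l: "Suc k \<le> l" for l
      proof -
        have "level_eps k \<le> Rs l (real m)" using k l unfolding reached_def by auto
        moreover have "level_eps l < level_eps k" using l by (simp add: level_eps_def frac_less2)
        moreover have "Rs l (real m) = fst (level_euler v N r \<theta> l (p l) (?w \<omega>) (m * 2^p l))"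
        proof -
          have "real m * 2^p l = real (m * 2^p l)" by simp
          then have "nat \<lfloor>real m * 2^p l\<rfloor> = m * 2^p l" by (simp only: floor_of_nat nat_int)
          then show ?thesis unfolding step_euler_def by simp
        qed
        ultimately show ?thesis unfolding E_def using \<omega>(1) by simp
      qed
      then have "\<omega> \<in> D (Suc k)" unfolding D_def by auto
      then show "\<omega> \<in> (\<Union>k. D k)" by blast
    qed
    then have "prob (P m) \<le> prob (\<Union>k. D k)"
      using DM by (intro finite_measure_mono_AE) auto
    moreover have "real m * prob (\<Union>k. D k) \<le> C"
    proof (rule tendsto_upperbound[OF tendsto_mult[OF tendsto_const lim]])
      show "eventually (\<lambda>k. real m * prob (D k) \<le> C) sequentially"
      proof (rule eventually_sequentiallyI)
        fix k assume "m \<le> k"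
        have "prob (D k) \<le> prob (E m k)" using EM by (intro finite_measure_mono) (auto simp: D_def)
        then have "real m * prob (D k) \<le> real m * prob (E m k)" by (intro mult_left_mono) auto
        also have "\<dots> \<le> C" unfolding E_def by (rule far) (use \<open>m \<le> k\<close> in simp)
        finally show "real m * prob (D k) \<le> C" .
      qed
    qed simp
    ultimately show ?thesis using mult_left_mono[of "prob (P m)" "prob (\<Union>k. D k)" "real m"] by simp
  qed
  define Z where "Z = (\<Inter>m. P m)"
  have ZM: "Z \<in> sets M" unfolding Z_def using PM by auto
  have "prob Z \<le> C / real (Suc m)" for m
  proof -
    have "prob Z \<le> prob (P (Suc m))" unfolding Z_def using PM by (intro finite_measure_mono) auto
    then have "real (Suc m) * prob Z \<le> real (Suc m) * prob (P (Suc m))" by (intro mult_left_mono) auto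
    then have "real (Suc m) * prob Z \<le> C" using bound[of "Suc m"] by linarith
    then show ?thesis by (simp add: pos_le_divide_eq mult.commute)
  qed
  moreover have "(\<lambda>m. C / real (Suc m)) \<longlonglongrightarrow> 0"
    using tendsto_mult[OF tendsto_const[of C] LIMSEQ_Suc[OF lim_1_over_n]] by simp
  ultimately have "prob Z \<le> 0" by (intro tendsto_lowerbound[of _ 0]) auto
  then have "prob Z = 0" by (simp add: order_antisym)
  then have "Z \<in> null_sets M" using ZM by (simp add: null_sets_def emeasure_eq_measure)
  then have "AE \<omega> in M. \<omega> \<notin> Z" by (rule AE_not_in)
  then show ?thesis
  proof (rule AE_mp, intro AE_I2 impI)
    fix \<omega> assume "\<omega> \<in> space M" "\<omega> \<notin> Z"
    then obtain m where "\<not> 0 < ?R (real m) \<omega>" unfolding Z_def P_def by auto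
    moreover have "0 \<le> ?R (real m) \<omega>" by (rule limit_R_ereal(2)) (use par in auto)
    ultimately have "?R (real m) \<omega> = 0" by linarith
    then show "\<exists>t\<ge>0. ?R t \<omega> = 0" by (intro exI[of _ "real m"]) simp
  qed
qed

end

section \<open>Pathwise uniqueness and existence\<close>

context
  fixes B :: "real \<Rightarrow> 'a \<Rightarrow> real" and v N \<sigma> r \<theta> :: real and \<omega> :: 'a
begin

text \<open>The first almost sure clause of a strong solution at a fixed \<omega>, named so that the
  final argument can be carried out one path at a time.\<close>

definition solves_before_hitting :: "(real \<Rightarrow> 'a \<Rightarrow> real) \<Rightarrow> (real \<Rightarrow> 'a \<Rightarrow> real) \<Rightarrow> bool" where
  "solves_before_hitting R \<Theta> \<longleftrightarrow> R 0 \<omega> = r \<and> \<Theta> 0 \<omega> = \<theta> \<and>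
     (\<forall>t\<ge>0. ereal t < hitting_time R \<omega> \<longrightarrow> R t \<omega> > 0 \<and> continuous_on {0..t} (\<lambda>s. (R s \<omega>, \<Theta> s \<omega>)) \<and>
        integral_equations B \<sigma> (pn_mu1 v) (pn_mu2 v N) r \<theta> R \<Theta> t \<omega>)"

lemma solves_before_hittingD:
  assumes "solves_before_hitting R \<Theta>" "0 \<le> t" "ereal t < hitting_time R \<omega>"
  shows "0 < R t \<omega>" "continuous_on {0..t} (\<lambda>s. (R s \<omega>, \<Theta> s \<omega>))"
    "integral_equations B \<sigma> (pn_mu1 v) (pn_mu2 v N) r \<theta> R \<Theta> t \<omega>"
  using assms unfolding solves_before_hitting_def by auto

text \<open>Both processes are limits of the same schemes, which depend on the noise only.\<close>

lemma solution_unique_before_hitting: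
  assumes scheme: "scheme_path v N r \<theta> \<eta> p (\<lambda>t. \<sigma> * B t \<omega>)"
    and sol: "solves_before_hitting R \<Theta>" "solves_before_hitting R' \<Theta>'"
    and t: "0 \<le> t" "ereal t < hitting_time R \<omega>" "ereal t < hitting_time R' \<omega>"
  shows "R t \<omega> = R' t \<omega>" "\<Theta> t \<omega> = \<Theta>' t \<omega>"
proof -
  interpret scheme_path v N r \<theta> \<eta> p "\<lambda>t. \<sigma> * B t \<omega>" by (rule scheme)
  have lim: "(\<lambda>k. Rs k t) \<longlonglongrightarrow> R t \<omega>" "(\<lambda>k. Xs k t) \<longlonglongrightarrow> \<Theta> t \<omega>"
    if sol: "solves_before_hitting R \<Theta>" and t': "ereal t < hitting_time R \<omega>" for R \<Theta>
  proof -
    note at = solves_before_hittingD[OF sol _ less_hitting_time_mono[OF t']]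
    note ie = at(3)[unfolded integral_equations_def]
    note int = pn_mu_set_integrable[OF at(2)[OF t(1) order_refl] ie[OF t(1) order_refl, THEN conjunct1]]
    show "(\<lambda>k. Rs k t) \<longlonglongrightarrow> R t \<omega>" "(\<lambda>k. Xs k t) \<longlonglongrightarrow> \<Theta> t \<omega>"
      by (rule solution_is_limit[OF t(1) at(1) int]; use ie in blast)+
  qed
  show "R t \<omega> = R' t \<omega>" "\<Theta> t \<omega> = \<Theta>' t \<omega>"
    using lim[OF sol(1) t(2)] lim[OF sol(2) t(3)] by (auto intro: LIMSEQ_unique)
qed

text \<open>If R reached 0 at T while R' had not yet done so, the two would agree before T and so
  have the same left limit there. That limit is 0 for R, but positive for R' by continuity. The
  start r > 0 ensures T > 0, so that a left limit makes sense.\<close>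

lemma hitting_time_not_less:
  assumes "0 < r" and sol: "solves_before_hitting R \<Theta>" "solves_before_hitting R' \<Theta>'"
    and zero: "\<And>T. hitting_time R \<omega> = ereal T \<Longrightarrow> R T \<omega> = 0 \<and>
      ((\<lambda>t. (R t \<omega>, \<Theta> t \<omega>)) \<longlongrightarrow> (R T \<omega>, \<Theta> T \<omega>)) (at_left T)"
    and agree: "\<And>t. 0 \<le> t \<Longrightarrow> ereal t < hitting_time R \<omega> \<Longrightarrow> ereal t < hitting_time R' \<omega> \<Longrightarrow> R t \<omega> = R' t \<omega>"
  shows "\<not> hitting_time R \<omega> < hitting_time R' \<omega>"
proof
  assume less: "hitting_time R \<omega> < hitting_time R' \<omega>"
  have nonneg: "0 \<le> hitting_time R \<omega>" by (rule hitting_time_nonneg)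
  obtain T where T: "hitting_time R \<omega> = ereal T"
    using less nonneg by (cases "hitting_time R \<omega>") auto
  have "R 0 \<omega> = r" using sol(1) unfolding solves_before_hitting_def by blast
  then have T0: "0 < T" using nonneg zero[OF T] \<open>0 < r\<close> unfolding T by (cases "T = 0") (auto simp: zero_ereal_def)
  have T': "ereal T < hitting_time R' \<omega>" using less T by simp
  have "continuous_on {0..T} (\<lambda>t. R' t \<omega>)"
    using continuous_on_fst[OF solves_before_hittingD(2)[OF sol(2) less_imp_le[OF T0] T']] by simp
  then have "((\<lambda>t. R' t \<omega>) \<longlongrightarrow> R' T \<omega>) (at_left T)"
    using continuous_on_Icc_at_leftD T0 by blast
  moreover have "((\<lambda>t. R' t \<omega>) \<longlongrightarrow> R T \<omega>) (at_left T)"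
  proof (rule Lim_transform_eventually)
    show "((\<lambda>t. R t \<omega>) \<longlongrightarrow> R T \<omega>) (at_left T)" using tendsto_fst[OF conjunct2[OF zero[OF T]]] by simp
    show "eventually (\<lambda>t. R t \<omega> = R' t \<omega>) (at_left T)"
      using eventually_at_left_real[OF T0]
    proof eventually_elim
      case (elim t)
      then show ?case using agree[of t] less_hitting_time_mono[OF T', of t] unfolding T by simp
    qed
  qed
  ultimately have "R' T \<omega> = R T \<omega>" by (rule tendsto_unique[OF trivial_limit_at_left_real])
  then show False using solves_before_hittingD(1)[OF sol(2) less_imp_le[OF T0] T'] zero[OF T] by simp
qed

end

text \<open>The infimum is attained: a positive radius at T needs at least the time
  \<open>Rl T / v\<close> to vanish, which would push the hitting time beyond T.\<close>

lemma (in scheme_path) limit_R_zero_at_hitting: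
  assumes T: "hitting_time (\<lambda>t \<omega>. Rl t) \<omega> = ereal T"
  shows "0 \<le> T" "Rl T = 0"
proof -
  show T0: "0 \<le> T" using hitting_time_nonneg[of "\<lambda>t \<omega>. Rl t" \<omega>] unfolding T by (simp add: zero_ereal_def)
  have nonneg: "0 \<le> Rl s" for s by (rule limit_R_ereal(2)[OF v0 less_imp_le[OF r_pos]])
  have "ereal (T + Rl T / v) \<le> hitting_time (\<lambda>t \<omega>. Rl t) \<omega>"
    unfolding le_hitting_time_iff
  proof (intro allI impI)
    fix s assume s: "0 \<le> s" "Rl s = 0"
    have "T \<le> s" using hitting_time_le[of s "\<lambda>t \<omega>. Rl t" \<omega>] s unfolding T by simp
    then show "T + Rl T / v \<le> s" using limit_R_lower[OF T0, of s] s v_pos by (simp add: field_simps)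
  qed
  then have "Rl T / v \<le> 0" unfolding T by simp
  then show "Rl T = 0" using nonneg[of T] v_pos by (simp add: divide_le_0_iff)
qed

lemma (in scheme_path) limit_solves_until_hitting:
  assumes R: "\<And>t. R t \<omega> = Rl t" and X: "\<And>t. \<Theta> t \<omega> = Xa t" and w: "\<And>t. w t = \<sigma> * B t \<omega>"
  shows "solves_before_hitting B v N \<sigma> r \<theta> \<omega> R \<Theta>"
    "hitting_time R \<omega> = ereal T \<Longrightarrow> R T \<omega> = 0 \<and> ((\<lambda>t. (R t \<omega>, \<Theta> t \<omega>)) \<longlongrightarrow> (R T \<omega>, \<Theta> T \<omega>)) (at_left T)"
proof -
  have pos: "0 < Rl t" if "0 \<le> t" "ereal t < hitting_time R \<omega>" for t
  proof -
    have "Rl t \<noteq> 0" using hitting_time_le[of t R \<omega>] that R[of t] by auto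
    moreover have "0 \<le> Rl t" by (rule limit_R_ereal(2)[OF v0 less_imp_le[OF r_pos]])
    ultimately show ?thesis by linarith
  qed
  have "Xa 0 = \<theta>" using limit_angle_eq[OF order_refl] limit_start r_pos by simp
  then show "solves_before_hitting B v N \<sigma> r \<theta> \<omega> R \<Theta>"
    unfolding solves_before_hitting_def integral_equations_def R X w[symmetric]
    using limit_start(1) pos limit_integral_equations by blast
  assume T: "hitting_time R \<omega> = ereal T"
  have h: "hitting_time (\<lambda>t \<omega>. Rl t) \<omega> = ereal T" using T unfolding hitting_time_def R .
  note z = limit_R_zero_at_hitting[OF h]
  show "R T \<omega> = 0 \<and> ((\<lambda>t. (R t \<omega>, \<Theta> t \<omega>)) \<longlongrightarrow> (R T \<omega>, \<Theta> T \<omega>)) (at_left T)"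
    unfolding R X using limit_at_hitting[OF z] z(2) pos T by simp
qed

theorem theorem4p2:
  fixes M :: "'a measure" and F :: "real \<Rightarrow> 'a measure" and B :: "real \<Rightarrow> 'a \<Rightarrow> real"
    and v \<sigma> N r \<theta> :: real
  assumes "standard_brownian_motion M F B"
    and "v > 0" and "\<sigma> > 0" and "N \<ge> 2" and "r > 0"
  shows "(\<exists>R \<Theta>. strong_solution_up_to_hitting M F B \<sigma> (pn_mu1 v) (pn_mu2 v N) r \<theta> R \<Theta>) \<and>
    pathwise_unique_up_to_hitting M F B \<sigma> (pn_mu1 v) (pn_mu2 v N) r \<theta>"
proof -
  interpret standard_brownian_motion M F B by fact
  have par: "0 < v" "1 \<le> N" "0 < \<sigma>" "0 < r" and N1: "1 < N" using assms by auto
  obtain \<eta> p where scheme: "\<And>k. 0 < \<eta> k" "mono p" "\<And>k. level_K v N k * mesh (p k) \<le> \<eta> k / 4"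
      "\<And>k. v * mesh (p k) \<le> \<eta> k / 4"
      "AE \<omega> in M. eventually (\<lambda>k. good_level v N r \<theta> k (p k) (\<eta> k) (\<lambda>t. \<sigma> * B t \<omega>)) sequentially"
    and far: "\<And>k m. m \<le> Suc k \<Longrightarrow> real m * prob {\<omega>\<in>space M. level_eps k
       < fst (level_euler v N r \<theta> k (p k) (\<lambda>t. \<sigma> * B t \<omega>) (m * 2^p k))} \<le> far_bound v \<sigma> r"
    by (rule scheme_exists[OF par, where \<theta> = \<theta>], rule that)
  have path: "AE \<omega> in M. scheme_path v N r \<theta> \<eta> p (\<lambda>t. \<sigma> * B t \<omega>)"
    by (rule AE_scheme_path[OF par(1) N1 par(4) scheme])
  have hits: "AE \<omega> in M. \<exists>t\<ge>0. limit_R v N r \<theta> p (\<lambda>t. \<sigma> * B t \<omega>) t = 0"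
    by (rule limit_hits_zero[OF par(1) N1 par(3,4) path far])
  define R where "R = (\<lambda>t \<omega>. limit_R v N r \<theta> p (\<lambda>s. \<sigma> * B s \<omega>) t)"
  define \<Theta> where "\<Theta> = (\<lambda>t \<omega>. limit_angle v N r \<theta> p (\<lambda>s. \<sigma> * B s \<omega>) t)"
  have ad: "adapted_until M G (hitting_time R) X"
    if G: "\<And>t. 0 \<le> t \<Longrightarrow> space (G t) = space M"
      and B: "\<And>s t. 0 \<le> s \<Longrightarrow> s \<le> t \<Longrightarrow> B s \<in> borel_measurable (G t)" and X: "X \<in> {R, \<Theta>}" for G X
    unfolding R_def
  proof (rule adapted_until_limit)
    show "X t \<in> borel_measurable (G t)" if "0 \<le> t" for t
      using X limit_measurable(1)[OF B that] limit_angle_measurable[OF B that] unfolding R_def \<Theta>_def by fast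
  qed (use par G B in simp_all)
  have "strong_solution_up_to_hitting M F B \<sigma> (pn_mu1 v) (pn_mu2 v N) r \<theta> R \<Theta>"
    unfolding strong_solution_up_to_hitting_def
  proof (intro conjI ballI)
    fix X assume X: "X \<in> {R, \<Theta>}"
    show "adapted_until M F (hitting_time R) X"
      by (rule ad[OF space_F _ X]) (use adapted measurable_F_mono in auto)
    show "adapted_until M (augmented_filtration M B) (hitting_time R) X"
      by (rule ad[OF augmented_filtration_props X])
  next
    show "AE \<omega> in M. R 0 \<omega> = r \<and> \<Theta> 0 \<omega> = \<theta> \<and>
        (\<forall>t\<ge>0. ereal t < hitting_time R \<omega> \<longrightarrow> R t \<omega> > 0 \<and> continuous_on {0..t} (\<lambda>s. (R s \<omega>, \<Theta> s \<omega>)) \<and>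
           integral_equations B \<sigma> (pn_mu1 v) (pn_mu2 v N) r \<theta> R \<Theta> t \<omega>)"
      using path
    proof eventually_elim
      case (elim \<omega>)
      show ?case unfolding solves_before_hitting_def[symmetric]
        by (rule scheme_path.limit_solves_until_hitting(1)[OF elim]) (simp_all add: R_def \<Theta>_def)
    qed
    show "AE \<omega> in M. (\<forall>T. hitting_time R \<omega> = ereal T \<longrightarrow> R T \<omega> = 0 \<and>
           ((\<lambda>t. (R t \<omega>, \<Theta> t \<omega>)) \<longlongrightarrow> (R T \<omega>, \<Theta> T \<omega>)) (at_left T)) \<and>
        (hitting_time R \<omega> = \<infinity> \<longrightarrow> (\<exists>l. ((\<lambda>t. (R t \<omega>, \<Theta> t \<omega>)) \<longlongrightarrow> l) at_top))"
      using path hits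
    proof eventually_elim
      case (elim \<omega>)
      obtain t where t: "0 \<le> t" "R t \<omega> = 0" using elim(2) unfolding R_def by auto
      \<comment> \<open>The clause for an infinite hitting time is thereby vacuous on this
        path.\<close>
      have "hitting_time R \<omega> \<noteq> \<infinity>" using hitting_time_le[of t R \<omega>] t by auto
      moreover have "R T \<omega> = 0 \<and> ((\<lambda>t. (R t \<omega>, \<Theta> t \<omega>)) \<longlongrightarrow> (R T \<omega>, \<Theta> T \<omega>)) (at_left T)"
        if "hitting_time R \<omega> = ereal T" for T
        by (rule scheme_path.limit_solves_until_hitting(2)[OF elim(1) _ _ _ that]) (simp_all add: R_def \<Theta>_def)
      ultimately show ?case by blast
    qed
  qed
  moreover have "pathwise_unique_up_to_hitting M F B \<sigma> (pn_mu1 v) (pn_mu2 v N) r \<theta>"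
    unfolding pathwise_unique_up_to_hitting_def
  proof (intro allI impI)
    fix R \<Theta> R' \<Theta>' :: "real \<Rightarrow> 'a \<Rightarrow> real"
    assume sol: "strong_solution_up_to_hitting M F B \<sigma> (pn_mu1 v) (pn_mu2 v N) r \<theta> R \<Theta>"
      and sol': "strong_solution_up_to_hitting M F B \<sigma> (pn_mu1 v) (pn_mu2 v N) r \<theta> R' \<Theta>'"
    note s = sol[unfolded strong_solution_up_to_hitting_def, folded solves_before_hitting_def, THEN conjunct2]
      and s' = sol'[unfolded strong_solution_up_to_hitting_def, folded solves_before_hitting_def, THEN conjunct2]
    show "AE \<omega> in M. hitting_time R \<omega> = hitting_time R' \<omega> \<and>
       (\<forall>t\<ge>0. ereal t \<le> hitting_time R \<omega> \<longrightarrow> (R t \<omega>, \<Theta> t \<omega>) = (R' t \<omega>, \<Theta>' t \<omega>))"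
      using path s[THEN conjunct1] s[THEN conjunct2] s'[THEN conjunct1] s'[THEN conjunct2]
    proof eventually_elim
      case (elim \<omega>)
      note zero = elim(3)[THEN conjunct1, rule_format] and zero' = elim(5)[THEN conjunct1, rule_format]
      note agree = solution_unique_before_hitting[OF elim(1,2,4)]
      have "\<not> hitting_time R \<omega> < hitting_time R' \<omega>"
        by (rule hitting_time_not_less[OF par(4) elim(2,4) zero agree(1)])
      moreover have "\<not> hitting_time R' \<omega> < hitting_time R \<omega>"
        by (rule hitting_time_not_less[OF par(4) elim(4,2) zero' agree(1)[symmetric]])
      ultimately have eq: "hitting_time R' \<omega> = hitting_time R \<omega>" by simp
      have "(R t \<omega>, \<Theta> t \<omega>) = (R' t \<omega>, \<Theta>' t \<omega>)" if t: "0 \<le> t" "ereal t \<le> hitting_time R \<omega>" for t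
      proof (cases "ereal t < hitting_time R \<omega>")
        case True
        then show ?thesis using agree[OF t(1) True] eq by simp
      next
        case False
        then have T: "hitting_time R \<omega> = ereal t" "hitting_time R' \<omega> = ereal t" using t eq by auto
        have "R 0 \<omega> = r" using elim(2) unfolding solves_before_hitting_def by blast
        then have t0: "0 < t" using t zero[OF T(1)] par(4) by (cases "t = 0") auto
        \<comment> \<open>At the hitting time itself both processes equal their own left limits, and
          these coincide because the processes agree just before it.\<close>
        have "eventually (\<lambda>u. (R' u \<omega>, \<Theta>' u \<omega>) = (R u \<omega>, \<Theta> u \<omega>)) (at_left t)"
          using eventually_at_left_real[OF t0]
        proof eventually_elim
          case (elim u)
          then show ?case using agree[of u] unfolding T by simp
        qed
        from Lim_transform_eventually[OF conjunct2[OF zero'[OF T(2)]] this]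
        show ?thesis by (rule tendsto_unique[OF trivial_limit_at_left_real conjunct2[OF zero[OF T(1)]]])
      qed
      then show ?case using eq by simp
    qed
  qed
  ultimately show ?thesis by blast
qed

end
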